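(* Let $\mathcal C$ be either the algebra of all rich band operators on $\mathbf X=l^p(\mathbb Z^N,X)$ or the algebra of all rich band-dominated operators on $\mathbf X$, and let $A\in\mathcal C$. Then, for every $\varepsilon>0$, $$\mathrm{sp}_{\varepsilon,\mathrm{ess}}(A)=\bigcup_{\substack{T\in\mathcal L(\mathbf X,\mathcal P)\\ \|T\|<\varepsilon}}\mathrm{sp}_{\mathrm{ess}}(A+T)=\bigcup_{\substack{T\in\mathcal C\\ \|T\|<\varepsilon}}\mathrm{sp}_{\mathrm{ess}}(A+T).$$
   Context: Let $N\in\mathbb N$, $p\in\{0\}\cup[1,\infty]$, and let $X\ne\{0\}$ be a complex Banach space. $\mathbf X=l^p(\mathbb Z^N,X)$ is the space of sequences $x=(x_i)_{i\in\mathbb Z^N}$, $x_i\in X$, with the usual $p$-norm for $1\le p\le\infty$; $l^0(\mathbb Z^N,X)$ denotes the closure in $l^\infty(\mathbb Z^N,X)$ of the finitely supported sequences. $\mathcal L(\mathbf X)$ is the algebra of bounded linear operators. $P_n:=\chi_{\{-n,\dots,n\}^N}I$ (multiplication by the characteristic function), $Q_n:=I-P_n$ ($n\in\mathbb N$), $\mathcal P:=(P_n)$. $\mathcal K(\mathbf X,\mathcal P):=\{K\in\mathcal L(\mathbf X):\|Q_nK\|+\|KQ_n\|\to0\}$; $\mathcal L(\mathbf X,\mathcal P):=\{A\in\mathcal L(\mathbf X): AK,KA\in\mathcal K(\mathbf X,\mathcal P)\ \forall K\in\mathcal K(\mathbf X,\mathcal P)\}$, a closed subalgebra of $\mathcal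 L(\mathbf X)$ containing $\mathcal K(\mathbf X,\mathcal P)$ as a closed two-sided ideal. $(A_n)\subset\mathcal L(\mathbf X)$ converges $\mathcal P$-strongly to $A$ if $\|K(A_n-A)\|+\|(A_n-A)K\|\to0$ for every $K\in\mathcal K(\mathbf X,\mathcal P)$. Shifts: $(V_kx)_i=x_{i-k}$ for $k\in\mathbb Z^N$. For $A\in\mathcal L(\mathbf X,\mathcal P)$ and a sequence $h=(h_n)\subset\mathbb Z^N$ with $|h_n|\to\infty$, the limit operator $A_h$ is the $\mathcal P$-strong limit of $V_{-h_n}AV_{h_n}$, if it exists. $A$ is rich if every $h\subset\mathbb Z^N$ tending to infinity has a subsequence $g$ such that $A_g$ exists. A band operator is a finite sum $\sum_\alpha a_\alpha V_\alpha$ with $\alpha\in\mathbb Z^N$, $a_\alpha\in l^\infty(\mathbb Z^N,\mathcal L(X))$ acting by $(a_\alpha x)_i=a_\alpha(i)x_i$. Band-dominated operators are the elements of the norm closure in $\mathcal L(\mathbf X)$ of the set of band operators; they belong to $\mathcal L(\mathbf X,\mathcal P)$. For $A\in\mathcal L(\mathbf X,\mathcal P)$: $\mathrm{sp}_{\mathrm{ess}}(A)$ is the set of $\lambda\in\mathbb C$ for which $A-\lambda I+\mathcal K(\mathbf X,\mathcal P)$ is not invertible in the quotient algebra $\mathcal L(\mathbf X,\mathcal P)/\mathcal K(\mathbf X,\mathcal P)$; and $\mathrm{sp}_{\varepsilon,\mathrm{ess}}(A):=\{\lambda\in\mathbb C:\|(A-\lambda I+\mathcal K(\mathbf X,\mathcal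 P))^{-1}\|>1/\varepsilon\}$, with inverse and norm in that quotient algebra and $\|b^{-1}\|:=\infty$ if $b$ is not invertible. *)

theory Defs
  imports
    "HOL-Analysis.Analysis"
    "HOL-Library.Function_Algebras"
    "HOL-Algebra.QuotRing"
begin

class scaleC =
  fixes scaleC :: "complex \<Rightarrow> 'a \<Rightarrow> 'a"  (infixr \<open>*\<^sub>C\<close> 75)

class complex_banach = banach + scaleC +
  assumes scaleC_add_right: "a *\<^sub>C (x + y) = a *\<^sub>C x + a *\<^sub>C y"
    and scaleC_add_left: "(a + b) *\<^sub>C x = a *\<^sub>C x + b *\<^sub>C x"
    and scaleC_scaleC: "a *\<^sub>C (b *\<^sub>C x) = (a * b) *\<^sub>C x"
    and scaleC_of_real: "complex_of_real r *\<^sub>C x = r *\<^sub>R x"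
    and norm_scaleC: "norm (a *\<^sub>C x) = cmod a * norm x"

text \<open>Sequences and operators are added and subtracted pointwise
  (\<^theory>\<open>HOL-Library.Function_Algebras\<close>); \<open>CARD('n)\<close> is the dimension of the lattice.\<close>

type_synonym ('n, 'x) seqs = "int ^ 'n \<Rightarrow> 'x"
type_synonym ('n, 'x) oper = "('n, 'x) seqs \<Rightarrow> ('n, 'x) seqs"

text \<open>The exponent ranges over \<open>{0} \<union> [1,\<infinity>]\<close>. The exponent \<open>0\<close> stands for the closure of the
  finitely supported sequences in the space with exponent \<open>\<infinity>\<close>, with the supremum norm.\<close>

definition lp_norm :: "ennreal \<Rightarrow> ('n::finite, 'x::complex_banach) seqs \<Rightarrow> real" where
  "lp_norm p x =
    (if p = 0 \<or> p = \<infinity> then (SUP i. norm (x i))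
     else (\<Sum>\<^sub>\<infinity>i. norm (x i) powr enn2real p) powr (1 / enn2real p))"

definition linfty :: "('n::finite, 'x::complex_banach) seqs set" where
  "linfty = {x. bounded (range x)}"

definition lp :: "ennreal \<Rightarrow> ('n::finite, 'x::complex_banach) seqs set" where
  "lp p =
    (if p = 0 then
       {x \<in> linfty. \<forall>e>0. \<exists>y. finite {i. y i \<noteq> 0} \<and> lp_norm \<infinity> (x - y) < e}
     else if p = \<infinity> then linfty
     else {x. (\<lambda>i. norm (x i) powr enn2real p) summable_on UNIV})"

text \<open>An operator on \<^term>\<open>lp p\<close> is represented by a total function that vanishes outside
  \<^term>\<open>lp p\<close>. Hence equality of representing functions is equality of operators, and
  pointwise sums and compositions of operators are again of this form.\<close>

definition on_lp :: "ennreal \<Rightarrow> ('n::finite, 'x::complex_banach) oper \<Rightarrow> ('n, 'x) oper" where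
  "on_lp p f = (\<lambda>x. if x \<in> lp p then f x else 0)"

text \<open>As in \<^const>\<open>onorm\<close>, the zero sequence contributes \<open>0 / 0 = 0\<close>.\<close>

definition op_norm :: "ennreal \<Rightarrow> ('n::finite, 'x::complex_banach) oper \<Rightarrow> real" where
  "op_norm p A = (SUP x\<in>lp p. lp_norm p (A x) / lp_norm p x)"

definition bdd_ops :: "ennreal \<Rightarrow> ('n::finite, 'x::complex_banach) oper set" where
  "bdd_ops p = {A.
     (\<forall>x. x \<notin> lp p \<longrightarrow> A x = 0) \<and>
     (\<forall>x\<in>lp p. A x \<in> lp p) \<and>
     (\<forall>x\<in>lp p. \<forall>y\<in>lp p. A (x + y) = A x + A y) \<and>
     (\<forall>c. \<forall>x\<in>lp p. A (\<lambda>i. c *\<^sub>C x i) = (\<lambda>i. c *\<^sub>C A x i)) \<and>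
     (\<exists>C. \<forall>x\<in>lp p. lp_norm p (A x) \<le> C * lp_norm p x)}"

definition scalar_op :: "ennreal \<Rightarrow> complex \<Rightarrow> ('n::finite, 'x::complex_banach) oper" where
  "scalar_op p c = on_lp p (\<lambda>x i. c *\<^sub>C x i)"

definition id_op :: "ennreal \<Rightarrow> ('n::finite, 'x::complex_banach) oper" where
  "id_op p = on_lp p (\<lambda>x. x)"

definition P_op :: "ennreal \<Rightarrow> nat \<Rightarrow> ('n::finite, 'x::complex_banach) oper" where
  "P_op p n = on_lp p (\<lambda>x i. if \<forall>k. i $ k \<in> {- int n..int n} then x i else 0)"

definition Q_op :: "ennreal \<Rightarrow> nat \<Rightarrow> ('n::finite, 'x::complex_banach) oper" where
  "Q_op p n = id_op p - P_op p n"

definition shift_op :: "ennreal \<Rightarrow> int ^ 'n \<Rightarrow> ('n::finite, 'x::complex_banach) oper" where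
  "shift_op p k = on_lp p (\<lambda>x i. x (i - k))"

definition mult_op ::
    "ennreal \<Rightarrow> (int ^ 'n \<Rightarrow> 'x \<Rightarrow> 'x) \<Rightarrow> ('n::finite, 'x::complex_banach) oper" where
  "mult_op p a = on_lp p (\<lambda>x i. a i (x i))"

definition KP :: "ennreal \<Rightarrow> ('n::finite, 'x::complex_banach) oper set" where
  "KP p = {K \<in> bdd_ops p.
     (\<lambda>n. op_norm p (Q_op p n \<circ> K) + op_norm p (K \<circ> Q_op p n)) \<longlonglongrightarrow> 0}"

definition LP :: "ennreal \<Rightarrow> ('n::finite, 'x::complex_banach) oper set" where
  "LP p = {A \<in> bdd_ops p. \<forall>K\<in>KP p. A \<circ> K \<in> KP p \<and> K \<circ> A \<in> KP p}"

definition P_strongly_converges ::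
    "ennreal \<Rightarrow> (nat \<Rightarrow> ('n::finite, 'x::complex_banach) oper) \<Rightarrow> ('n, 'x) oper \<Rightarrow> bool" where
  "P_strongly_converges p As A \<longleftrightarrow>
     (\<forall>n. As n \<in> bdd_ops p) \<and> A \<in> bdd_ops p \<and>
     (\<forall>K\<in>KP p. (\<lambda>n. op_norm p (K \<circ> (As n - A)) + op_norm p ((As n - A) \<circ> K)) \<longlonglongrightarrow> 0)"

definition tends_to_infinity :: "(nat \<Rightarrow> int ^ 'n::finite) \<Rightarrow> bool" where
  "tends_to_infinity h \<longleftrightarrow> filterlim (\<lambda>n. MAX k. \<bar>h n $ k\<bar>) at_top sequentially"

definition is_limit_op ::
    "ennreal \<Rightarrow> ('n::finite, 'x::complex_banach) oper \<Rightarrow> (nat \<Rightarrow> int ^ 'n) \<Rightarrow> ('n, 'x) oper \<Rightarrow> bool"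
  where
  "is_limit_op p A h B \<longleftrightarrow>
     tends_to_infinity h \<and>
     P_strongly_converges p (\<lambda>n. shift_op p (- h n) \<circ> A \<circ> shift_op p (h n)) B"

definition rich :: "ennreal \<Rightarrow> ('n::finite, 'x::complex_banach) oper \<Rightarrow> bool" where
  "rich p A \<longleftrightarrow> A \<in> LP p \<and>
     (\<forall>h. tends_to_infinity h \<longrightarrow>
       (\<exists>r::nat \<Rightarrow> nat. strict_mono r \<and> (\<exists>B. is_limit_op p A (h \<circ> r) B)))"

definition bdd_clinear :: "('x::complex_banach \<Rightarrow> 'x) \<Rightarrow> bool" where
  "bdd_clinear f \<longleftrightarrow> bounded_linear f \<and> (\<forall>c x. f (c *\<^sub>C x) = c *\<^sub>C f x)"

definition linfty_coeffs :: "(int ^ 'n::finite \<Rightarrow> 'x::complex_banach \<Rightarrow> 'x) set" where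
  "linfty_coeffs = {a. (\<forall>i. bdd_clinear (a i)) \<and> bdd_above (range (\<lambda>i. onorm (a i)))}"

definition band_ops :: "ennreal \<Rightarrow> ('n::finite, 'x::complex_banach) oper set" where
  "band_ops p = {A. \<exists>S a. finite S \<and> (\<forall>\<alpha>\<in>S. a \<alpha> \<in> linfty_coeffs) \<and>
     A = (\<Sum>\<alpha>\<in>S. mult_op p (a \<alpha>) \<circ> shift_op p \<alpha>)}"

definition band_dominated_ops :: "ennreal \<Rightarrow> ('n::finite, 'x::complex_banach) oper set" where
  "band_dominated_ops p = {A \<in> bdd_ops p. \<forall>e>0. \<exists>B\<in>band_ops p. op_norm p (A - B) < e}"

definition rich_band_ops :: "ennreal \<Rightarrow> ('n::finite, 'x::complex_banach) oper set" where
  "rich_band_ops p = {A \<in> band_ops p. rich p A}"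

definition rich_band_dominated_ops ::
    "ennreal \<Rightarrow> ('n::finite, 'x::complex_banach) oper set" where
  "rich_band_dominated_ops p = {A \<in> band_dominated_ops p. rich p A}"

text \<open>Multiplication is composition; the pointwise product on functions plays no role.\<close>

definition LP_ring :: "ennreal \<Rightarrow> ('n::finite, 'x::complex_banach) oper ring" where
  "LP_ring p = \<lparr>carrier = LP p, mult = (\<lambda>A B. A \<circ> B), one = id_op p, zero = 0, add = (\<lambda>A B. A + B)\<rparr>"

definition LP_mod_KP :: "ennreal \<Rightarrow> ('n::finite, 'x::complex_banach) oper set ring" where
  "LP_mod_KP p = LP_ring p Quot KP p"

definition coset :: "ennreal \<Rightarrow> ('n::finite, 'x::complex_banach) oper \<Rightarrow> ('n, 'x) oper set" where
  "coset p A = KP p +>\<^bsub>LP_ring p\<^esub> A"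

definition quot_norm :: "ennreal \<Rightarrow> ('n::finite, 'x::complex_banach) oper set \<Rightarrow> real" where
  "quot_norm p b = (INF B\<in>b. op_norm p B)"

definition quot_inverse_norm ::
    "ennreal \<Rightarrow> ('n::finite, 'x::complex_banach) oper set \<Rightarrow> ereal" where
  "quot_inverse_norm p b =
     (if b \<in> Units (LP_mod_KP p) then ereal (quot_norm p (inv\<^bsub>LP_mod_KP p\<^esub> b)) else \<infinity>)"

definition sp_ess :: "ennreal \<Rightarrow> ('n::finite, 'x::complex_banach) oper \<Rightarrow> complex set" where
  "sp_ess p A = {z. coset p (A - scalar_op p z) \<notin> Units (LP_mod_KP p)}"

definition sp_eps_ess ::
    "ennreal \<Rightarrow> real \<Rightarrow> ('n::finite, 'x::complex_banach) oper \<Rightarrow> complex set" where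
  "sp_eps_ess p \<epsilon> A = {z. quot_inverse_norm p (coset p (A - scalar_op p z)) > ereal (1 / \<epsilon>)}"

end

theory Submission
  imports Defs
begin

text \<open>
  Let \<open>B = A - \<mu> I\<close>. If the inverse of the coset of \<open>B\<close> has norm at most \<open>1 / \<epsilon>\<close> and
  \<open>\<parallel>T\<parallel> < \<epsilon>\<close>, then a Neumann series shows that \<open>B + T\<close> is still invertible modulo \<open>\<K>(X,P)\<close>
  (\<open>small_perturbation_invertible\<close>). So the spectra of small perturbations lie in the
  pseudospectrum. The substance is the converse: when the coset of \<open>B\<close> is invertible and its
  inverse has norm above \<open>1 / \<epsilon>\<close>, a single \<open>T\<close> with \<open>\<parallel>T\<parallel> < \<epsilon>\<close> must destroy invertibility, and
  it must be rich, and band or band-dominated as \<open>A\<close> is.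

  A large inverse in the quotient means that \<open>B\<close> shrinks some sequences arbitrarily far out by a
  factor below \<open>\<epsilon>\<close> (\<open>almost_kernel_at_infinity\<close>). Wide Lipschitz cutoffs almost commute with
  \<open>B\<close>, for every exponent, so such sequences can be found with supports of a common bounded diameter
  (\<open>localised_almost_kernel\<close>). After translation to the origin, richness yields a limit operator
  \<open>L\<close> of \<open>A\<close> and one unit vector \<open>u\<close> of finite support such that \<open>w = L u - \<mu> u\<close> satisfies
  \<open>\<parallel>w\<parallel> < \<epsilon>\<close> (\<open>almost_kernel_of_limit_op\<close>). The Hahn--Banach theorem provides a functional \<open>f\<close> of
  norm one with \<open>f u = 1\<close> that depends only on the coordinates near the origin
  (\<open>norming_functional\<close>). Then \<open>x \<mapsto> - f(x) w\<close> has norm below \<open>\<epsilon>\<close>, and adding it to \<open>L - \<mu> I\<close>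
  gives an operator that annihilates \<open>u\<close>.

  Copies of this rank-one operator are placed along a sparse subsequence \<open>g\<close> of the sequence
  that defines \<open>L\<close>, the \<open>n\<close>-th copy being cut off to a ball about \<open>g n\<close>. These balls are
  disjoint and their radii grow. Their sum \<open>T\<close> is block diagonal, so its norm does not exceed that
  of one copy (\<open>lp_norm_disjoint_blocks\<close>). All copies being translates of one operator, every
  sequence tending to infinity has a subsequence along which the shifted \<open>T\<close> converges, either to
  \<open>0\<close> or to a translate of the rank-one operator: \<open>T\<close> is rich (\<open>block_op_rich\<close>). It is a band
  operator if \<open>w\<close> has finite support, which is the case when \<open>A\<close> is a band operator; in general
  \<open>w\<close> is a limit of finitely supported sequences, and \<open>T\<close> is band-dominated. Finally, the
  translates of \<open>u\<close> to the points \<open>g n\<close> are unit vectors that move off to infinity, and \<open>B + T\<close>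
  sends them to a null sequence. Hence \<open>B + T\<close> is not invertible modulo \<open>\<K>(X,P)\<close>
  (\<open>singular_perturbation\<close>).
\<close>

section \<open>Minkowski's inequality\<close>

lemma powr_convex_combination:
  fixes u v \<theta> r :: real
  assumes "r \<ge> 1" "u \<ge> 0" "v \<ge> 0" "0 < \<theta>" "\<theta> < 1"
  shows "((1 - \<theta>) * u + \<theta> * v) powr r \<le> (1 - \<theta>) * u powr r + \<theta> * v powr r"
proof -
  have small: "s powr r \<le> s" if "0 < s" "s < 1" for s :: real
    using powr_mono'[of 1 r s] that assms(1) by simp
  consider "u = 0" | "v = 0" | "u > 0" "v > 0" using assms by linarith
  then show ?thesis
  proof cases
    case 1
    then show ?thesis using small[of \<theta>] assms
      by (simp add: powr_mult mult_right_mono)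
  next
    case 2
    then show ?thesis using small[of "1 - \<theta>"] assms
      by (simp add: powr_mult mult_right_mono)
  next
    case 3
    then show ?thesis
      using convex_onD[OF powr_convex[OF assms(1)], of \<theta> u v] assms by simp
  qed
qed

text \<open>For \<open>a, b > 0\<close>, the number \<open>(u + v) / (a + b)\<close> is the convex combination of \<open>u / a\<close> and
  \<open>v / b\<close> with weights \<open>a / (a + b)\<close> and \<open>b / (a + b)\<close>, so the inequality already holds termwise
  before summation.\<close>

lemma Minkowski_sum:
  fixes u v :: "'i \<Rightarrow> real"
  assumes r: "r \<ge> 1" and ab: "a \<ge> 0" "b \<ge> 0"
    and F: "finite F"
    and u: "\<And>i. i \<in> F \<Longrightarrow> u i \<ge> 0" and v: "\<And>i. i \<in> F \<Longrightarrow> v i \<ge> 0"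
    and su: "(\<Sum>i\<in>F. u i powr r) \<le> a powr r" and sv: "(\<Sum>i\<in>F. v i powr r) \<le> b powr r"
  shows "(\<Sum>i\<in>F. (u i + v i) powr r) \<le> (a + b) powr r"
proof -
  have vanish: "\<forall>i\<in>F. w i = 0" if "(\<Sum>i\<in>F. w i powr r) \<le> 0 powr r" for w :: "'i \<Rightarrow> real"
  proof -
    have "(\<Sum>i\<in>F. w i powr r) = 0"
      using that by (intro antisym sum_nonneg) auto
    then show ?thesis using F by (simp add: sum_nonneg_eq_0_iff)
  qed
  consider "a = 0" | "b = 0" | "a > 0" "b > 0" using ab by linarith
  then show ?thesis
  proof cases
    case 1
    then show ?thesis using vanish[of u] su sv by simp
  next
    case 2
    then show ?thesis using vanish[of v] su sv by simp
  next
    case 3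
    define \<theta> where "\<theta> = b / (a + b)"
    have \<theta>: "0 < \<theta>" "\<theta> < 1" "1 - \<theta> = a / (a + b)" using 3 by (auto simp: \<theta>_def field_simps)
    have "(u i + v i) powr r \<le>
        (a + b) powr r * ((1 - \<theta>) * (u i powr r / a powr r) + \<theta> * (v i powr r / b powr r))"
      if i: "i \<in> F" for i
    proof -
      have split: "u i + v i = (a + b) * ((1 - \<theta>) * (u i / a) + \<theta> * (v i / b))"
      proof -
        have "(a + b) * (1 - \<theta>) = a" "(a + b) * \<theta> = b" using 3 unfolding \<theta>(3) by (auto simp: \<theta>_def)
        then have "(a + b) * ((1 - \<theta>) * (u i / a) + \<theta> * (v i / b)) = a * (u i / a) + b * (v i / b)"
          by (metis distrib_left mult.assoc)
        then show ?thesis using 3 by simp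
      qed
      have "(u i + v i) powr r = (a + b) powr r * ((1 - \<theta>) * (u i / a) + \<theta> * (v i / b)) powr r"
        by (subst split) (simp only: powr_mult)
      also have "\<dots> \<le> (a + b) powr r * ((1 - \<theta>) * (u i / a) powr r + \<theta> * (v i / b) powr r)"
        using powr_convex_combination[OF r, of "u i / a" "v i / b" \<theta>] u[OF i] v[OF i] 3 \<theta>
        by (intro mult_left_mono) auto
      finally show ?thesis by (simp add: powr_divide)
    qed
    then have "(\<Sum>i\<in>F. (u i + v i) powr r) \<le>
        (\<Sum>i\<in>F. (a + b) powr r * ((1 - \<theta>) * (u i powr r / a powr r) + \<theta> * (v i powr r / b powr r)))"
      by (rule sum_mono)
    also have "\<dots> = (a + b) powr r *
        ((1 - \<theta>) * ((\<Sum>i\<in>F. u i powr r) / a powr r) + \<theta> * ((\<Sum>i\<in>F. v i powr r) / b powr r))"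
      by (simp add: sum_distrib_left sum.distrib sum_divide_distrib distrib_left)
    also have "\<dots> \<le> (a + b) powr r * ((1 - \<theta>) * 1 + \<theta> * 1)"
      using su sv 3 \<theta> by (intro mult_left_mono add_mono) (auto simp: divide_le_eq)
    finally show ?thesis by simp
  qed
qed

section \<open>The sequence spaces\<close>

lemma scaleC_0_right [simp]: "c *\<^sub>C (0::'x::complex_banach) = 0"
  using norm_scaleC[of c "0::'x"] by simp

lemma scaleC_0_left [simp]: "0 *\<^sub>C (x::'x::complex_banach) = 0"
  using norm_scaleC[of 0 x] by simp

lemma scaleC_1_left [simp]: "1 *\<^sub>C (x::'x::complex_banach) = x"
  using scaleC_of_real[of 1 x] by simp

lemma scaleC_minus_right: "c *\<^sub>C (- x) = - (c *\<^sub>C (x::'x::complex_banach))"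
  using scaleC_add_right[of c x "- x"] by (simp add: eq_neg_iff_add_eq_0 add.commute)

lemma scaleC_minus_left: "(- c) *\<^sub>C x = - (c *\<^sub>C (x::'x::complex_banach))"
  using scaleC_add_left[of c "- c" x] by (simp add: eq_neg_iff_add_eq_0 add.commute)

lemma scaleC_diff_right: "c *\<^sub>C (x - y) = c *\<^sub>C x - c *\<^sub>C (y::'x::complex_banach)"
  using scaleC_add_right[of c x "- y"] by (simp add: scaleC_minus_right)

lemma scaleC_sum_left: "(\<Sum>i\<in>S. f i) *\<^sub>C x = (\<Sum>i\<in>S. f i *\<^sub>C (x :: 'x::complex_banach))"
  by (induction S rule: infinite_finite_induct) (auto simp: scaleC_add_left)

lemma bounded_linear_scaleC: "bounded_linear (\<lambda>x::'x::complex_banach. c *\<^sub>C x)"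
proof
  show "c *\<^sub>C (r *\<^sub>R x) = r *\<^sub>R (c *\<^sub>C x)" for r and x :: 'x
    by (simp add: scaleC_scaleC mult.commute flip: scaleC_of_real)
  show "\<exists>K. \<forall>x::'x. norm (c *\<^sub>C x) \<le> norm x * K"
    by (auto simp: norm_scaleC mult.commute intro!: exI[of _ "cmod c"])
qed (simp add: scaleC_add_right)

lemma sum_fun_apply: "(\<Sum>a\<in>S. f a) x = (\<Sum>a\<in>S. f a x)"
  by (induction S rule: infinite_finite_induct) auto

definition restr :: "'i set \<Rightarrow> ('i \<Rightarrow> 'x) \<Rightarrow> 'i \<Rightarrow> 'x::zero" where
  "restr U x = (\<lambda>i. if i \<in> U then x i else 0)"

lemma finite_blocks_meeting:
  fixes C :: "nat \<Rightarrow> 'i set"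
  assumes "finite F" and disj: "\<And>m n. m \<noteq> n \<Longrightarrow> C m \<inter> C n = {}"
  shows "finite {n. C n \<inter> F \<noteq> {}}"
proof (rule finite_subset)
  show "{n. C n \<inter> F \<noteq> {}} \<subseteq> (\<lambda>i. THE n. i \<in> C n) ` F"
  proof
    fix n assume "n \<in> {n. C n \<inter> F \<noteq> {}}"
    then obtain i where i: "i \<in> C n" "i \<in> F" by blast
    have "(THE n. i \<in> C n) = n" using i(1) disj by (intro the_equality) blast+
    then show "n \<in> (\<lambda>i. THE n. i \<in> C n) ` F" using i(2) by blast
  qed
qed (use assms(1) in simp)

locale lp_exponent =
  fixes p :: ennreal
  assumes exponent: "p = 0 \<or> 1 \<le> p"
begin

definition r :: real where "r = enn2real p"

lemma r_ge_1:
  assumes "p \<noteq> 0" "p \<noteq> \<infinity>" shows "r \<ge> 1"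
  using assms exponent unfolding r_def
  by (metis enn2real_1 enn2real_mono infinity_ennreal_def top.not_eq_extremum)

text \<open>This reduces every estimate for a finite exponent to finite sums: summability is
  boundedness of the partial sums, since the terms are nonnegative.\<close>

lemma finite_exponent_iff:
  assumes "p \<noteq> 0" "p \<noteq> \<infinity>"
  shows "x \<in> lp p \<and> lp_norm p x \<le> C \<longleftrightarrow>
    0 \<le> C \<and> (\<forall>F. finite F \<longrightarrow> (\<Sum>i\<in>F. norm (x i) powr r) \<le> C powr r)"
proof -
  note r1 = r_ge_1[OF assms]
  let ?s = "\<Sum>\<^sub>\<infinity>i. norm (x i) powr r"
  have lp: "x \<in> lp p \<longleftrightarrow> (\<lambda>i. norm (x i) powr r) summable_on UNIV"
    using assms by (simp add: lp_def r_def)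
  have N: "lp_norm p x = ?s powr (1 / r)"
    using assms by (simp add: lp_norm_def r_def)
  have s0: "0 \<le> ?s" by (rule infsum_nonneg) simp
  have NC: "lp_norm p x \<le> C \<longleftrightarrow> 0 \<le> C \<and> ?s \<le> C powr r"
  proof
    assume *: "lp_norm p x \<le> C"
    moreover have "0 \<le> lp_norm p x" by (simp add: N)
    moreover have "lp_norm p x powr r = ?s" using r1 s0 by (simp add: N powr_powr)
    ultimately show "0 \<le> C \<and> ?s \<le> C powr r"
      using powr_mono2[of r "lp_norm p x" C] r1 by auto
  next
    assume *: "0 \<le> C \<and> ?s \<le> C powr r"
    then have "?s powr (1 / r) \<le> (C powr r) powr (1 / r)"
      using r1 s0 by (intro powr_mono2) auto
    also have "\<dots> = C" using r1 * by (simp add: powr_powr)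
    finally show "lp_norm p x \<le> C" by (simp add: N)
  qed
  show ?thesis
  proof
    assume L: "x \<in> lp p \<and> lp_norm p x \<le> C"
    have "(\<Sum>i\<in>F. norm (x i) powr r) \<le> ?s" if "finite F" for F
      using L lp that by (intro finite_sum_le_infsum) auto
    then show "0 \<le> C \<and> (\<forall>F. finite F \<longrightarrow> (\<Sum>i\<in>F. norm (x i) powr r) \<le> C powr r)"
      using L NC by (meson order_trans)
  next
    assume R: "0 \<le> C \<and> (\<forall>F. finite F \<longrightarrow> (\<Sum>i\<in>F. norm (x i) powr r) \<le> C powr r)"
    have "(\<lambda>i. norm (x i) powr r) summable_on UNIV"
      by (rule nonneg_bdd_above_summable_on) (use R in \<open>auto intro!: bdd_aboveI\<close>)
    moreover from this have "?s \<le> C powr r"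
      by (rule infsum_le_finite_sums) (use R in auto)
    ultimately show "x \<in> lp p \<and> lp_norm p x \<le> C" using R lp NC by blast
  qed
qed

lemma sup_exponent_le_iff:
  assumes "p = 0 \<or> p = \<infinity>" "bounded (range x)"
  shows "lp_norm p x \<le> C \<longleftrightarrow> (\<forall>i. norm (x i) \<le> C)"
proof -
  have "bdd_above (range (\<lambda>i. norm (x i)))"
    using assms(2) by (auto simp: bounded_iff bdd_above_def)
  then show ?thesis using assms(1)
    by (subst lp_norm_def) (auto simp: cSUP_le_iff)
qed

lemma infinite_exponent_iff:
  assumes "p = \<infinity>"
  shows "x \<in> lp p \<and> lp_norm p x \<le> C \<longleftrightarrow> (\<forall>i. norm (x i) \<le> C)"
  using assms sup_exponent_le_iff[of x C] by (auto simp: lp_def linfty_def bounded_iff)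

lemma zero_exponent_iff:
  assumes "p = 0"
  shows "x \<in> lp p \<and> lp_norm p x \<le> C \<longleftrightarrow>
    (\<forall>i. norm (x i) \<le> C) \<and> (\<forall>e>0. finite {i. norm (x i) \<ge> e})"
proof -
  interpret top: lp_exponent \<infinity> by standard simp
  have "x \<in> lp 0 \<longleftrightarrow> bounded (range x) \<and> (\<forall>e>0. finite {i. norm (x i) \<ge> e})"
  proof
    assume x: "x \<in> lp 0"
    have "finite {i. norm (x i) \<ge> e}" if "e > 0" for e
    proof -
      obtain y where y: "finite {i. y i \<noteq> 0}" "lp_norm \<infinity> (x - y) < e"
        using x \<open>e > 0\<close> unfolding lp_def by (auto simp del: infinity_ennreal_def)
      have "bounded (range y)"
      proof -
        have "range y \<subseteq> insert 0 (y ` {i. y i \<noteq> 0})" by auto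
        then show ?thesis using y(1) finite_imp_bounded by (metis bounded_subset finite_imageI finite_insert)
      qed
      moreover have "bounded (range x)" using x by (simp add: lp_def linfty_def)
      ultimately have "bounded (range (x - y))"
        using bounded_minus_comp[of x UNIV y] by (simp add: fun_diff_def)
      then have *: "norm (x i - y i) \<le> lp_norm \<infinity> (x - y)" for i
        using top.sup_exponent_le_iff[of "x - y"] by auto
      have "y i \<noteq> 0" if "norm (x i) \<ge> e" for i
        using *[of i] y(2) that by auto
      then show ?thesis using y(1) by (auto elim!: finite_subset[rotated])
    qed
    then show "bounded (range x) \<and> (\<forall>e>0. finite {i. norm (x i) \<ge> e})"
      using x by (simp add: lp_def linfty_def)
  next
    assume x: "bounded (range x) \<and> (\<forall>e>0. finite {i. norm (x i) \<ge> e})"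
    have "\<exists>y. finite {i. y i \<noteq> 0} \<and> lp_norm \<infinity> (x - y) < e" if "e > 0" for e
    proof (intro exI conjI)
      let ?y = "\<lambda>i. if norm (x i) \<ge> e/2 then x i else 0"
      have "{i. ?y i \<noteq> 0} \<subseteq> {i. norm (x i) \<ge> e/2}" by auto
      then show "finite {i. ?y i \<noteq> 0}" using x that by (meson finite_subset half_gt_zero)
      have le: "\<forall>i. norm ((x - ?y) i) \<le> e/2" using that by auto
      then have "bounded (range (x - ?y))" unfolding bounded_iff by blast
      then show "lp_norm \<infinity> (x - ?y) < e"
        using top.sup_exponent_le_iff[of "x - ?y" "e/2"] le that by force
    qed
    then show "x \<in> lp 0" using x by (simp add: lp_def linfty_def)
  qed
  moreover have "bounded (range x)" if "\<forall>i. norm (x i) \<le> C"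
    using that by (auto simp: bounded_iff)
  ultimately show ?thesis using assms sup_exponent_le_iff[of x C] by blast
qed

lemma exponent_cases [case_names zero infinite finite]:
  obtains "p = 0" | "p = \<infinity>" | "p \<noteq> 0" "p \<noteq> \<infinity>" "r \<ge> 1"
  using r_ge_1 by blast

lemma lp_solid_aux:
  assumes "x \<in> lp p" "lp_norm p x \<le> C" "\<And>i. norm (y i) \<le> norm (x i)"
  shows "y \<in> lp p \<and> lp_norm p y \<le> C"
proof (cases rule: exponent_cases)
  case zero
  note iff = zero_exponent_iff[OF zero]
  have x: "\<forall>i. norm (x i) \<le> C" "\<And>e. e > 0 \<Longrightarrow> finite {i. norm (x i) \<ge> e}"
    using assms(1,2) iff[of x C] by auto
  have "finite {i. norm (y i) \<ge> e}" if "e > 0" for e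
    using x(2)[OF that] by (rule finite_subset[rotated]) (use assms(3) order_trans in auto)
  moreover have "\<forall>i. norm (y i) \<le> C" using x(1) assms(3) order_trans by blast
  ultimately show ?thesis using iff by blast
next
  case infinite
  have "\<forall>i. norm (x i) \<le> C" using infinite_exponent_iff[OF infinite, of x C] assms(1,2) by blast
  then have "\<forall>i. norm (y i) \<le> C" using assms(3) order_trans by blast
  then show ?thesis using infinite_exponent_iff[OF infinite, of y C] by blast
next
  case finite
  have "(\<Sum>i\<in>F. norm (y i) powr r) \<le> (\<Sum>i\<in>F. norm (x i) powr r)" for F
    using assms(3) finite by (intro sum_mono powr_mono2) auto
  then show ?thesis
    using finite_exponent_iff[OF finite(1,2), of x C] finite_exponent_iff[OF finite(1,2), of y C]
      assms(1,2) order_trans by blast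
qed

lemma lp_solid:
  assumes "x \<in> lp p" "\<And>i. norm (y i) \<le> norm (x i)"
  shows "y \<in> lp p" "lp_norm p y \<le> lp_norm p x"
  using lp_solid_aux[OF assms(1) order_refl assms(2)] by auto

lemma lp_add:
  assumes "x \<in> lp p" "y \<in> lp p"
  shows "x + y \<in> lp p" "lp_norm p (x + y) \<le> lp_norm p x + lp_norm p y"
proof -
  let ?a = "lp_norm p x" and ?b = "lp_norm p y"
  have "x + y \<in> lp p \<and> lp_norm p (x + y) \<le> ?a + ?b"
  proof (cases rule: exponent_cases)
    case zero
    note z = zero_exponent_iff[OF zero]
    have x: "\<And>i. norm (x i) \<le> ?a" "\<And>e. e>0 \<Longrightarrow> finite {i. norm (x i) \<ge> e}" using z[of x ?a] assms by auto
    have y: "\<And>i. norm (y i) \<le> ?b" "\<And>e. e>0 \<Longrightarrow> finite {i. norm (y i) \<ge> e}" using z[of y ?b] assms by auto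
    have "norm ((x + y) i) \<le> ?a + ?b" for i
      using x(1)[of i] y(1)[of i] norm_triangle_ineq[of "x i" "y i"] by simp
    moreover have "finite {i. norm ((x + y) i) \<ge> e}" if "e > 0" for e
    proof (rule finite_subset)
      show "{i. norm ((x + y) i) \<ge> e} \<subseteq> {i. norm (x i) \<ge> e/2} \<union> {i. norm (y i) \<ge> e/2}"
      proof
        fix i assume "i \<in> {i. norm ((x + y) i) \<ge> e}"
        then show "i \<in> {i. norm (x i) \<ge> e/2} \<union> {i. norm (y i) \<ge> e/2}"
          using norm_triangle_ineq[of "x i" "y i"] by auto
      qed
      show "finite ({i. norm (x i) \<ge> e/2} \<union> {i. norm (y i) \<ge> e/2})"
        using x(2)[of "e/2"] y(2)[of "e/2"] that by simp
    qed
    ultimately show ?thesis using z by blast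
  next
    case infinite
    note z = infinite_exponent_iff[OF infinite]
    have "norm ((x + y) i) \<le> ?a + ?b" for i
      using z[of x ?a] z[of y ?b] assms norm_triangle_ineq[of "x i" "y i"]
      by (smt (verit) plus_fun_apply)
    then show ?thesis using z by blast
  next
    case finite
    note z = finite_exponent_iff[OF finite(1,2)]
    have x: "0 \<le> ?a" "\<And>F. finite F \<Longrightarrow> (\<Sum>i\<in>F. norm (x i) powr r) \<le> ?a powr r" using z[of x ?a] assms by auto
    have y: "0 \<le> ?b" "\<And>F. finite F \<Longrightarrow> (\<Sum>i\<in>F. norm (y i) powr r) \<le> ?b powr r" using z[of y ?b] assms by auto
    have "(\<Sum>i\<in>F. norm ((x + y) i) powr r) \<le> (?a + ?b) powr r" if "finite F" for F
    proof -
      have "(\<Sum>i\<in>F. norm ((x + y) i) powr r) \<le> (\<Sum>i\<in>F. (norm (x i) + norm (y i)) powr r)"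
        using finite by (intro sum_mono powr_mono2) (auto simp: norm_triangle_ineq)
      also have "\<dots> \<le> (?a + ?b) powr r"
        using Minkowski_sum[of r ?a ?b F "\<lambda>i. norm (x i)" "\<lambda>i. norm (y i)"] finite x y that by simp
      finally show ?thesis .
    qed
    then show ?thesis using z x(1) y(1) add_nonneg_nonneg by blast
  qed
  then show "x + y \<in> lp p" "lp_norm p (x + y) \<le> ?a + ?b" by auto
qed

lemma finite_support_lp:
  assumes "finite {i. x i \<noteq> 0}" shows "x \<in> lp p"
proof -
  let ?S = "{i. x i \<noteq> 0}"
  define C where "C = (\<Sum>i\<in>?S. norm (x i))"
  have le: "norm (x i) \<le> C" for i
  proof (cases "i \<in> ?S")
    case True
    then show ?thesis unfolding C_def using assms by (intro member_le_sum) auto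
  next
    case False
    then show ?thesis by (simp add: C_def sum_nonneg)
  qed
  show ?thesis
  proof (cases rule: exponent_cases)
    case zero
    have "{i. norm (x i) \<ge> e} \<subseteq> ?S" if "e > 0" for e using that by auto
    then show ?thesis using zero_exponent_iff[OF zero, of x C] assms le by (meson finite_subset)
  next
    case infinite
    then show ?thesis using infinite_exponent_iff le by blast
  next
    case finite
    let ?s = "\<Sum>i\<in>?S. norm (x i) powr r"
    have s0: "?s \<ge> 0" by (simp add: sum_nonneg)
    have "(\<Sum>i\<in>F. norm (x i) powr r) \<le> ?s" if "finite F" for F
    proof -
      have "(\<Sum>i\<in>F. norm (x i) powr r) = (\<Sum>i\<in>F \<inter> ?S. norm (x i) powr r)"
        using that by (intro sum.mono_neutral_right) auto
      also have "\<dots> \<le> ?s" using assms by (intro sum_mono2) auto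
      finally show ?thesis .
    qed
    moreover have "(?s powr (1 / r)) powr r = ?s" using finite s0 by (simp add: powr_powr)
    ultimately show ?thesis
      using finite_exponent_iff[OF finite(1,2), of x "?s powr (1 / r)"] by simp
  qed
qed

lemma lp_0 [simp]: "0 \<in> lp p" "(\<lambda>i. 0) \<in> lp p"
  using finite_support_lp[of 0] by (auto simp: zero_fun_def)

lemma norm_le_lp_norm:
  assumes "x \<in> lp p" shows "norm (x i) \<le> lp_norm p x"
proof (cases rule: exponent_cases)
  case zero
  then show ?thesis using zero_exponent_iff assms by blast
next
  case infinite
  then show ?thesis using infinite_exponent_iff assms by blast
next
  case finite
  have "0 \<le> lp_norm p x \<and> (\<Sum>i\<in>{i}. norm (x i) powr r) \<le> lp_norm p x powr r"
    using finite_exponent_iff[OF finite(1,2), of x "lp_norm p x"] assms by blast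
  then have "norm (x i) powr r \<le> lp_norm p x powr r" "0 \<le> lp_norm p x" by auto
  then show ?thesis using finite powr_less_mono2[of r "lp_norm p x" "norm (x i)"] by force
qed

lemma lp_norm_nonneg: "x \<in> lp p \<Longrightarrow> 0 \<le> lp_norm p x"
  using norm_le_lp_norm[of x undefined] norm_ge_zero order_trans by blast

lemma lp_norm_0 [simp]: "lp_norm p 0 = 0" "lp_norm p (\<lambda>i. 0) = 0"
  by (auto simp: lp_norm_def infsum_0)

lemma lp_norm_eq_0: "x \<in> lp p \<Longrightarrow> lp_norm p x = 0 \<Longrightarrow> x = 0"
  using norm_le_lp_norm[of x] by (auto simp: fun_eq_iff)

lemma lp_scale_aux:
  assumes x: "x \<in> lp p" and y: "\<And>i. norm (y i) = c * norm (x i)" and c: "c > 0"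
  shows "y \<in> lp p \<and> lp_norm p y \<le> c * lp_norm p x"
proof (cases rule: exponent_cases)
  case zero
  have "{i. norm (y i) \<ge> e} = {i. norm (x i) \<ge> e / c}" for e
    using c by (auto simp: y pos_divide_le_eq mult.commute)
  then show ?thesis
    using zero_exponent_iff[OF zero, of x "lp_norm p x"] zero_exponent_iff[OF zero, of y "c * lp_norm p x"] x c
    by (auto simp: y)
next
  case infinite
  then show ?thesis
    using infinite_exponent_iff[of x "lp_norm p x"] infinite_exponent_iff[of y "c * lp_norm p x"] x c
    by (auto simp: y)
next
  case finite
  have "(\<Sum>i\<in>F. norm (y i) powr r) = c powr r * (\<Sum>i\<in>F. norm (x i) powr r)" for F
    using c by (simp add: y powr_mult sum_distrib_left)
  moreover have "(c * lp_norm p x) powr r = c powr r * lp_norm p x powr r"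
    by (simp add: powr_mult)
  ultimately show ?thesis
    using finite_exponent_iff[OF finite(1,2), of x "lp_norm p x"]
      finite_exponent_iff[OF finite(1,2), of y "c * lp_norm p x"] x c
    by (auto intro: mult_left_mono)
qed

lemma lp_scaleC:
  assumes "x \<in> lp p"
  shows "(\<lambda>i. c *\<^sub>C x i) \<in> lp p" "lp_norm p (\<lambda>i. c *\<^sub>C x i) = cmod c * lp_norm p x"
proof -
  have "(\<lambda>i. c *\<^sub>C x i) \<in> lp p \<and> lp_norm p (\<lambda>i. c *\<^sub>C x i) = cmod c * lp_norm p x"
  proof (cases "c = 0")
    case False
    have 1: "(\<lambda>i. c *\<^sub>C x i) \<in> lp p \<and> lp_norm p (\<lambda>i. c *\<^sub>C x i) \<le> cmod c * lp_norm p x"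
      using False assms by (intro lp_scale_aux) (auto simp: norm_scaleC)
    moreover have "lp_norm p x \<le> inverse (cmod c) * lp_norm p (\<lambda>i. c *\<^sub>C x i)"
      using 1 False lp_scale_aux[of "\<lambda>i. c *\<^sub>C x i" x "inverse (cmod c)"] by (auto simp: norm_scaleC)
    then have "cmod c * lp_norm p x \<le> lp_norm p (\<lambda>i. c *\<^sub>C x i)"
      using False by (simp add: divide_simps mult.commute split: if_splits)
    ultimately show ?thesis by linarith
  qed auto
  then show "(\<lambda>i. c *\<^sub>C x i) \<in> lp p" "lp_norm p (\<lambda>i. c *\<^sub>C x i) = cmod c * lp_norm p x" by auto
qed

lemma lp_uminus:
  assumes "x \<in> lp p" shows "- x \<in> lp p" "lp_norm p (- x) = lp_norm p x"
proof -
  have "- x = (\<lambda>i. (- 1) *\<^sub>C x i)" by (auto simp: scaleC_minus_left)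
  then show "- x \<in> lp p" "lp_norm p (- x) = lp_norm p x"
    using lp_scaleC[OF assms, of "- 1"] by auto
qed

lemma lp_diff:
  assumes "x \<in> lp p" "y \<in> lp p"
  shows "x - y \<in> lp p" "lp_norm p (x - y) \<le> lp_norm p x + lp_norm p y"
  using lp_add[OF assms(1) lp_uminus(1)[OF assms(2)]] lp_uminus[OF assms(2)] by auto

lemma lp_norm_diff_ge:
  assumes "x \<in> lp p" "y \<in> lp p"
  shows "lp_norm p x - lp_norm p y \<le> lp_norm p (x - y)"
  using lp_add(2)[OF lp_diff(1)[OF assms] assms(2)] by simp

lemma lp_sum:
  assumes "\<And>a. a \<in> S \<Longrightarrow> f a \<in> lp p"
  shows "(\<Sum>a\<in>S. f a) \<in> lp p" "lp_norm p (\<Sum>a\<in>S. f a) \<le> (\<Sum>a\<in>S. lp_norm p (f a))"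
proof -
  have "(\<Sum>a\<in>S. f a) \<in> lp p \<and> lp_norm p (\<Sum>a\<in>S. f a) \<le> (\<Sum>a\<in>S. lp_norm p (f a))"
    using assms
  proof (induction S rule: infinite_finite_induct)
    case (insert a S)
    have f: "f a \<in> lp p" "sum f S \<in> lp p" "lp_norm p (sum f S) \<le> (\<Sum>a\<in>S. lp_norm p (f a))"
      using insert.IH insert.prems by auto
    have s: "sum f (insert a S) = f a + sum f S" using insert.hyps by (rule sum.insert)
    have "(\<Sum>a\<in>insert a S. lp_norm p (f a)) = lp_norm p (f a) + (\<Sum>a\<in>S. lp_norm p (f a))"
      using insert.hyps by simp
    then show ?case unfolding s using f(3) lp_add[OF f(1,2)] by linarith
  qed auto
  then show "(\<Sum>a\<in>S. f a) \<in> lp p" "lp_norm p (\<Sum>a\<in>S. f a) \<le> (\<Sum>a\<in>S. lp_norm p (f a))"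
    by auto
qed

lemma lp_shift_aux:
  fixes x :: "('n::finite, 'x::complex_banach) seqs"
  assumes x: "x \<in> lp p" 
  shows "(\<lambda>i. x (i - k)) \<in> lp p \<and> lp_norm p (\<lambda>i. x (i - k)) \<le> lp_norm p x"
proof -
  have inj: "inj_on (\<lambda>i. i - k) F" for F :: "(int ^ 'n) set" by (auto simp: inj_on_def)
  show ?thesis
  proof (cases rule: exponent_cases)
    case zero
    have "{i. norm (x (i - k)) \<ge> e} = (\<lambda>i. i + k) ` {i. norm (x i) \<ge> e}" for e
      by (auto simp: image_def)
    then show ?thesis
      using zero_exponent_iff[OF zero, of x "lp_norm p x"]
        zero_exponent_iff[OF zero, of "\<lambda>i. x (i - k)" "lp_norm p x"] x
      by auto
  next
    case infinite
    then show ?thesis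
      using infinite_exponent_iff[of x "lp_norm p x"]
        infinite_exponent_iff[of "\<lambda>i. x (i - k)" "lp_norm p x"] x
      by auto
  next
    case finite
    have "(\<Sum>i\<in>F. norm (x (i - k)) powr r) = (\<Sum>i\<in>(\<lambda>i. i - k) ` F. norm (x i) powr r)" for F
      using inj by (simp add: sum.reindex)
    then show ?thesis
      using finite_exponent_iff[OF finite(1,2), of x "lp_norm p x"] x
        finite_exponent_iff[OF finite(1,2), of "\<lambda>i. x (i - k)" "lp_norm p x"]
      by auto
  qed
qed

lemma lp_shift:
  assumes x: "x \<in> lp p" 
  shows "(\<lambda>i. x (i - k)) \<in> lp p" "lp_norm p (\<lambda>i. x (i - k)) = lp_norm p x"
  using lp_shift_aux[OF x, of k] lp_shift_aux[of "\<lambda>i. x (i - k)" "- k"] by (auto intro: antisym)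

lemma lp_norm_single: "lp_norm p (\<lambda>i. if i = j then \<xi> else 0) \<le> norm \<xi>"
proof -
  let ?x = "\<lambda>i. if i = j then \<xi> else 0"
  have "(\<Sum>i\<in>F. norm (?x i) powr r) \<le> norm \<xi> powr r" if "finite F" for F
  proof -
    have "(\<Sum>i\<in>F. norm (?x i) powr r) = (\<Sum>i\<in>F \<inter> {j}. norm (?x i) powr r)"
      using that by (intro sum.mono_neutral_right) auto
    also have "\<dots> \<le> (\<Sum>i\<in>{j}. norm (?x i) powr r)"
      by (intro sum_mono2) auto
    finally show ?thesis by simp
  qed
  moreover have "finite {i. norm (?x i) \<ge> e}" if "e > 0" for e
    using that by (auto intro: finite_subset[of _ "{j}"])
  moreover have "\<forall>i. norm (?x i) \<le> norm \<xi>" by simp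
  ultimately show ?thesis
    using zero_exponent_iff[of ?x "norm \<xi>"] infinite_exponent_iff[of ?x "norm \<xi>"]
      finite_exponent_iff[of ?x "norm \<xi>"] norm_ge_zero[of \<xi>]
    by (cases rule: exponent_cases) blast+
qed

text \<open>A bound on the norms passes to a coordinatewise limit, because it is tested on finitely many
  coordinates at a time. For the exponent \<open>0\<close> this gives no decay of the limit at infinity,
  whence the extra hypothesis.\<close>

lemma lp_norm_limit_le:
  assumes z: "\<And>m. z m \<in> lp p" "\<And>m. lp_norm p (z m) \<le> c"
    and lim: "\<And>i. (\<lambda>m. z m i) \<longlonglongrightarrow> y i"
    and y: "p = 0 \<Longrightarrow> y \<in> lp p"
  shows "y \<in> lp p \<and> lp_norm p y \<le> c"
proof -
  have le: "norm (y i) \<le> c" for i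
    using norm_le_lp_norm[OF z(1)] z(2)
    by (intro Lim_bounded[OF tendsto_norm[OF lim]]) (meson order_trans)
  show ?thesis
  proof (cases rule: exponent_cases)
    case zero
    then show ?thesis using zero_exponent_iff[OF zero, of y c]
      zero_exponent_iff[OF zero, of y "lp_norm p y"] le y by blast
  next
    case infinite
    then show ?thesis using infinite_exponent_iff le by blast
  next
    case finite
    note iff = finite_exponent_iff[OF finite(1,2)]
    have m: "0 \<le> c" "\<And>m F. finite F \<Longrightarrow> (\<Sum>i\<in>F. norm (z m i) powr r) \<le> c powr r"
      using z iff by blast+
    have "(\<Sum>i\<in>F. norm (y i) powr r) \<le> c powr r" if "finite F" for F
    proof (rule Lim_bounded)
      show "(\<lambda>m. \<Sum>i\<in>F. norm (z m i) powr r) \<longlonglongrightarrow> (\<Sum>i\<in>F. norm (y i) powr r)"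
        using finite by (intro tendsto_sum tendsto_powr' tendsto_norm lim tendsto_const) auto
    qed (use m that in auto)
    then show ?thesis using iff m(1) by blast
  qed
qed

text \<open>Completeness, in the form that the Neumann series uses. The sum is taken coordinatewise; for
  the exponent \<open>0\<close> it decays at infinity because the partial sums approximate it uniformly.\<close>

lemma lp_series:
  fixes x :: "nat \<Rightarrow> ('n::finite, 'x::complex_banach) seqs"
  assumes x: "\<And>k. x k \<in> lp p" "\<And>k. lp_norm p (x k) \<le> a k" and a: "summable a"
  defines "y \<equiv> \<lambda>i. \<Sum>k. x k i"
  shows "y \<in> lp p" "\<And>n. lp_norm p (y - (\<Sum>k<n. x k)) \<le> (\<Sum>k. a (k + n))"
proof -
  have a0: "a k \<ge> 0" for k using x lp_norm_nonneg order_trans by blast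
  have sx: "summable (\<lambda>k. x k i)" for i
    using norm_le_lp_norm[OF x(1)] x(2)
    by (intro summable_comparison_test'[OF a, of 0]) (meson order_trans)
  have an: "summable (\<lambda>k. a (k + n))" for n using a by (simp add: summable_iff_shift)
  have part: "(\<Sum>k<n+m. x k) - (\<Sum>k<n. x k) = (\<Sum>k<m. x (k + n))" for n m
  proof (induction m)
    case (Suc m)
    have "(\<Sum>k<n + Suc m. x k) = (\<Sum>k<n + m. x k) + x (m + n)" by (simp add: add.commute)
    moreover have "(\<Sum>k<Suc m. x (k + n)) = (\<Sum>k<m. x (k + n)) + x (m + n)" by simp
    ultimately show ?case unfolding Suc.IH[symmetric] by (simp only: diff_add_eq)
  qed simp
  have partN: "(\<Sum>k<m. x (k + n)) \<in> lp p \<and> lp_norm p (\<Sum>k<m. x (k + n)) \<le> (\<Sum>k. a (k + n))" for n m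
  proof -
    have "lp_norm p (\<Sum>k<m. x (k + n)) \<le> (\<Sum>k<m. lp_norm p (x (k + n)))"
      using x(1) by (intro lp_sum)
    also have "\<dots> \<le> (\<Sum>k<m. a (k + n))" using x(2) by (intro sum_mono)
    also have "\<dots> \<le> (\<Sum>k. a (k + n))" using an a0 by (intro sum_le_suminf) auto
    finally show ?thesis using x(1) lp_sum(1)[of "{..<m}" "\<lambda>k. x (k + n)"] by auto
  qed
  have lim: "(\<lambda>m. (\<Sum>k<m. x (k + n)) i) \<longlonglongrightarrow> (y - (\<Sum>k<n. x k)) i" for n i
  proof -
    have "(\<lambda>m. (\<Sum>k<m. x k i)) \<longlonglongrightarrow> y i"
      using summable_LIMSEQ[OF sx] by (simp add: y_def)
    then have "(\<lambda>m. (\<Sum>k<m+n. x k i) - (\<Sum>k<n. x k i)) \<longlonglongrightarrow> y i - (\<Sum>k<n. x k i)"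
      by (intro tendsto_diff tendsto_const LIMSEQ_ignore_initial_segment)
    moreover have "(\<Sum>k<m+n. x k i) - (\<Sum>k<n. x k i) = (\<Sum>k<m. x (k + n)) i" for m
      using part[of n m] by (auto simp: fun_eq_iff sum_fun_apply add.commute)
    ultimately show ?thesis by (simp add: sum_fun_apply)
  qed
  have y: "y \<in> lp p"
  proof (cases "p = 0")
    case False
    show ?thesis
      using lp_norm_limit_le[of "\<lambda>m. \<Sum>k<m. x (k + 0)" "\<Sum>k. a (k + 0)" y] partN[where n=0] lim[where n=0] False
      by simp
  next
    case True
    note iff = zero_exponent_iff[OF True]
    have close: "norm (y i - (\<Sum>k<n. x k) i) \<le> (\<Sum>k. a (k + n))" for n i
    proof (rule Lim_bounded)
      show "(\<lambda>m. norm ((\<Sum>k<m. x (k + n)) i)) \<longlonglongrightarrow> norm (y i - (\<Sum>k<n. x k) i)"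
        using tendsto_norm[OF lim[of n i]] by simp
      show "\<forall>m\<ge>0. norm ((\<Sum>k<m. x (k + n)) i) \<le> (\<Sum>k. a (k + n))"
        using partN norm_le_lp_norm order_trans by blast
    qed
    have "finite {i. norm (y i) \<ge> e}" if e: "e > 0" for e
    proof -
      have "(\<lambda>n. \<Sum>k. a (k + n)) \<longlonglongrightarrow> 0" by (rule suminf_exist_split2[OF a])
      then obtain n where n: "(\<Sum>k. a (k + n)) < e/2"
        using e by (metis (no_types, lifting) half_gt_zero order_tendstoD(2) eventually_happens' sequentially_bot)
      have "(\<Sum>k<n. x k) \<in> lp p" using x(1) by (intro lp_sum)
      then have "finite {i. norm ((\<Sum>k<n. x k) i) \<ge> e/2}"
        using iff[of "\<Sum>k<n. x k" "lp_norm p (\<Sum>k<n. x k)"] half_gt_zero[OF e] by blast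
      moreover have "norm ((\<Sum>k<n. x k) i) \<ge> e/2" if "norm (y i) \<ge> e" for i
        using close[of i n] n that norm_triangle_ineq2[of "y i" "(\<Sum>k<n. x k) i"] by linarith
      ultimately show ?thesis by (auto elim!: finite_subset[rotated])
    qed
    moreover have "\<forall>i. norm (y i) \<le> (\<Sum>k. a (k + 0))"
      using close[of _ 0] by simp
    ultimately show ?thesis using iff by blast
  qed
  then show "y \<in> lp p" .
  fix n
  have "y - (\<Sum>k<n. x k) \<in> lp p" using y x(1) by (intro lp_diff lp_sum)
  then show "lp_norm p (y - (\<Sum>k<n. x k)) \<le> (\<Sum>k. a (k + n))"
    using lp_norm_limit_le[of "\<lambda>m. \<Sum>k<m. x (k + n)" "\<Sum>k. a (k + n)" "y - (\<Sum>k<n. x k)"] partN lim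
    by blast
qed

lemma lp_restr:
  assumes "x \<in> lp p" shows "restr U x \<in> lp p" "lp_norm p (restr U x) \<le> lp_norm p x"
  using lp_solid[OF assms, of "restr U x"] by (auto simp: restr_def)

lemma restr_finite_lp: "finite U \<Longrightarrow> restr U x \<in> lp p"
  by (rule finite_support_lp) (auto simp: restr_def elim!: finite_subset[rotated])

lemma lp_norm_restr_finite:
  assumes "p \<noteq> 0" "p \<noteq> \<infinity>" "finite U"
  shows "lp_norm p (restr U x) powr r = (\<Sum>i\<in>U. norm (x i) powr r)"
proof -
  note r1 = r_ge_1[OF assms(1,2)]
  have "(\<Sum>\<^sub>\<infinity>i. norm (restr U x i) powr r) = (\<Sum>\<^sub>\<infinity>i\<in>U. norm (x i) powr r)"
    using r1 by (intro infsum_cong_neutral) (auto simp: restr_def)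
  then have "lp_norm p (restr U x) = (\<Sum>i\<in>U. norm (x i) powr r) powr (1 / r)"
    using assms by (simp add: lp_norm_def r_def)
  then show ?thesis using r1 by (simp add: powr_powr sum_nonneg)
qed

text \<open>Disjoint blocks contribute independently to \<open>x\<close> and to its image \<open>y\<close>, whatever the exponent.
  So the norm of a block diagonal operator is bounded by the norms of its blocks.\<close>

lemma lp_norm_disjoint_blocks:
  assumes x: "x \<in> lp p" and c: "c \<ge> 0"
    and C: "\<And>n::nat. finite (C n)" "\<And>m n. m \<noteq> n \<Longrightarrow> C m \<inter> C n = {}"
    and off: "\<And>i. i \<notin> (\<Union>n. C n) \<Longrightarrow> y i = 0"
    and blk: "\<And>n. lp_norm p (restr (C n) y) \<le> c * lp_norm p (restr (C n) x)"
  shows "y \<in> lp p \<and> lp_norm p y \<le> c * lp_norm p x"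
proof -
  have yC: "norm (y i) \<le> c * lp_norm p (restr (C n) x)" if "i \<in> C n" for i n
  proof -
    have "norm (restr (C n) y i) \<le> lp_norm p (restr (C n) y)"
      by (rule norm_le_lp_norm[OF restr_finite_lp[OF C(1)]])
    then show ?thesis using that blk[of n] by (simp add: restr_def)
  qed
  have le: "norm (y i) \<le> c * lp_norm p x" for i
  proof (cases "i \<in> (\<Union>n. C n)")
    case True
    then obtain n where "i \<in> C n" by blast
    from yC[OF this] show ?thesis
      using mult_left_mono[OF lp_restr(2)[OF x] c] order_trans by blast
  next
    case False
    then show ?thesis using off[OF False] c lp_norm_nonneg[OF x] by simp
  qed
  show ?thesis
  proof (cases rule: exponent_cases)
    case zero
    note iff = zero_exponent_iff[OF zero]
    have "finite {i. norm (y i) \<ge> e}" if e: "e > 0" for e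
    proof (cases "c = 0")
      case True
      then show ?thesis using le e by (metis (mono_tags, lifting) Collect_empty_eq finite.emptyI mult_zero_left not_le order.strict_trans2)
    next
      case False
      then have cpos: "c > 0" using c by simp
      let ?X = "{i. norm (x i) \<ge> e / (2 * c)}"
      let ?I = "{n. C n \<inter> ?X \<noteq> {}}"
      have "finite ?X" using iff[of x "lp_norm p x"] x e cpos by simp
      then have I: "finite ?I" using C(2) by (rule finite_blocks_meeting)
      have "{i. norm (y i) \<ge> e} \<subseteq> (\<Union>n\<in>?I. C n)"
      proof
        fix i assume i: "i \<in> {i. norm (y i) \<ge> e}"
        then have "y i \<noteq> 0" using e by auto
        then obtain n where n: "i \<in> C n" using off by blast
        have "C n \<inter> ?X \<noteq> {}"
        proof
          assume "C n \<inter> ?X = {}"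
          then have *: "norm (restr (C n) x j) \<le> e / (2 * c)" for j
            using e cpos by (auto simp: restr_def not_le disjoint_iff)
          have "lp_norm p (restr (C n) x) \<le> e / (2 * c)"
            using sup_exponent_le_iff[of "restr (C n) x"] zero *
            by (metis (no_types, lifting) bounded_iff rangeE)
          then have "norm (y i) \<le> c * (e / (2 * c))"
            using yC[OF n] c mult_left_mono order_trans by blast
          then show False using i e cpos by simp
        qed
        then show "i \<in> (\<Union>n\<in>?I. C n)" using n by blast
      qed
      then show ?thesis using I C(1) by (meson finite_UN_I finite_subset)
    qed
    then show ?thesis using iff le by blast
  next
    case infinite
    then show ?thesis using infinite_exponent_iff le by blast
  next
    case finite
    note iff = finite_exponent_iff[OF finite(1,2)]
    note R = lp_norm_restr_finite[OF finite(1,2)]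
    have "(\<Sum>i\<in>F. norm (y i) powr r) \<le> (c * lp_norm p x) powr r" if F: "finite F" for F
    proof -
      define I where "I = {n. C n \<inter> F \<noteq> {}}"
      have I: "finite I" unfolding I_def using F C(2) by (rule finite_blocks_meeting)
      have "(\<Sum>i\<in>F. norm (y i) powr r) = (\<Sum>i\<in>F \<inter> (\<Union>n\<in>I. C n). norm (y i) powr r)"
        proof (rule sum.mono_neutral_right)
        show "\<forall>i\<in>F - F \<inter> (\<Union>n\<in>I. C n). norm (y i) powr r = 0"
        proof
          fix i assume i: "i \<in> F - F \<inter> (\<Union>n\<in>I. C n)"
          then have "i \<notin> (\<Union>n. C n)" unfolding I_def by blast
          then show "norm (y i) powr r = 0" using off by simp
        qed
      qed (use F in auto)
      also have "\<dots> \<le> (\<Sum>i\<in>(\<Union>n\<in>I. C n). norm (y i) powr r)"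
        using I C(1) by (intro sum_mono2) auto
      also have "\<dots> = (\<Sum>n\<in>I. \<Sum>i\<in>C n. norm (y i) powr r)"
        using I C by (intro sum.UNION_disjoint) auto
      also have "\<dots> \<le> (\<Sum>n\<in>I. c powr r * (\<Sum>i\<in>C n. norm (x i) powr r))"
      proof (rule sum_mono)
        fix n
        have "lp_norm p (restr (C n) y) powr r \<le> (c * lp_norm p (restr (C n) x)) powr r"
          using finite blk[of n] lp_norm_nonneg[OF restr_finite_lp[OF C(1)]] by (intro powr_mono2) auto
        then show "(\<Sum>i\<in>C n. norm (y i) powr r) \<le> c powr r * (\<Sum>i\<in>C n. norm (x i) powr r)"
          by (simp add: powr_mult R[OF C(1)])
      qed
      also have "\<dots> = c powr r * (\<Sum>i\<in>(\<Union>n\<in>I. C n). norm (x i) powr r)"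
        using I C by (subst sum.UNION_disjoint) (auto simp: sum_distrib_left)
      also have "\<dots> \<le> c powr r * lp_norm p x powr r"
        using iff[of x "lp_norm p x"] x I C(1) by (intro mult_left_mono) auto
      finally show ?thesis by (simp add: powr_mult)
    qed
    then show ?thesis using iff mult_nonneg_nonneg[OF c lp_norm_nonneg[OF x]] by blast
  qed
qed

end

section \<open>Bounded operators\<close>

text \<open>\<open>mag\<close> is the maximum norm on the lattice; its balls are the windows of the projections
  \<open>P\<^sub>n\<close>.\<close>

definition mag :: "int ^ 'n::finite \<Rightarrow> int" where
  "mag i = (MAX k. \<bar>i $ k\<bar>)"

definition cube :: "nat \<Rightarrow> (int ^ 'n::finite) set" where
  "cube m = {i. mag i \<le> int m}"

lemma mag_le_iff: "mag i \<le> c \<longleftrightarrow> (\<forall>k. \<bar>i $ k\<bar> \<le> c)"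
  unfolding mag_def by (subst Max_le_iff) auto

lemma mag_component: "\<bar>i $ k\<bar> \<le> mag i"
  using mag_le_iff[of i "mag i"] by blast

lemma mag_nonneg [simp]: "0 \<le> mag i"
  using mag_component[of i undefined] by linarith

lemma mag_triangle: "mag (i + j) \<le> mag i + mag j"
  unfolding mag_le_iff using mag_component[of i] mag_component[of j]
  by (metis abs_triangle_ineq add_mono order_trans vector_add_component)

lemma mag_minus [simp]: "mag (- i) = mag i"
  by (simp add: mag_def)

lemma mag_commute: "mag (i - j) = mag (j - i)"
  using mag_minus[of "i - j"] by simp

lemma mag_triangle_diff: "mag (i - j) \<le> mag i + mag j"
  using mag_triangle[of i "- j"] by simp

lemma mag_0 [simp]: "mag 0 = 0"
  by (simp add: mag_def)

lemma cube_altdef: "cube m = {i. \<forall>k. i $ k \<in> {- int m..int m}}"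
  by (auto simp: cube_def mag_le_iff abs_le_iff minus_le_iff)

lemma cube_eq_image:
  "(cube m :: (int ^ 'n::finite) set) = vec_lambda ` (UNIV \<rightarrow>\<^sub>E {- int m..int m})"
proof (rule equalityI; rule subsetI)
  fix i :: "int ^ 'n" assume "i \<in> cube m"
  then have "i = vec_lambda (vec_nth i)" "vec_nth i \<in> UNIV \<rightarrow>\<^sub>E {- int m..int m}"
    by (auto simp: cube_altdef)
  then show "i \<in> vec_lambda ` (UNIV \<rightarrow>\<^sub>E {- int m..int m})" by blast
qed (auto simp: cube_altdef PiE_iff)

lemma finite_cube [simp]: "finite (cube m :: (int ^ 'n::finite) set)"
  unfolding cube_eq_image by (intro finite_imageI finite_PiE) auto

lemma card_cube: "card (cube m :: (int ^ 'n::finite) set) = (2 * m + 1) ^ CARD('n)"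
proof -
  have "inj_on (vec_lambda :: ('n \<Rightarrow> int) \<Rightarrow> _) (UNIV \<rightarrow>\<^sub>E {- int m..int m})"
    by (auto simp: inj_on_def vec_lambda_inject)
  then show ?thesis
    unfolding cube_eq_image by (subst card_image) (simp_all add: card_PiE nat_add_distrib nat_mult_distrib)
qed

lemma cube_mono: "m \<le> n \<Longrightarrow> cube m \<subseteq> cube n"
  by (auto simp: cube_def)

lemma finite_imp_subset_cube:
  assumes "finite F" shows "\<exists>m. F \<subseteq> cube m"
proof
  show "F \<subseteq> cube (nat (\<Sum>i\<in>F. mag i))"
    using member_le_sum[of _ F mag] assms by (auto simp: cube_def sum_nonneg)
qed

context lp_exponent
begin

lemma lp_norm_add_le:
  "x \<in> lp p \<Longrightarrow> y \<in> lp p \<Longrightarrow> lp_norm p x \<le> a \<Longrightarrow> lp_norm p y \<le> b \<Longrightarrow> lp_norm p (x + y) \<le> a + b"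
  using lp_add(2)[of x y] by linarith

lemma lp_norm_diff_le:
  "x \<in> lp p \<Longrightarrow> y \<in> lp p \<Longrightarrow> lp_norm p x \<le> a \<Longrightarrow> lp_norm p y \<le> b \<Longrightarrow> lp_norm p (x - y) \<le> a + b"
  using lp_diff(2)[of x y] by linarith

lemma bdd_opsD:
  assumes "A \<in> bdd_ops p"
  shows bdd_ops_outside: "x \<notin> lp p \<Longrightarrow> A x = 0"
    and bdd_ops_lp: "x \<in> lp p \<Longrightarrow> A x \<in> lp p"
    and bdd_ops_add: "x \<in> lp p \<Longrightarrow> y \<in> lp p \<Longrightarrow> A (x + y) = A x + A y"
    and bdd_ops_scaleC: "x \<in> lp p \<Longrightarrow> A (\<lambda>i. c *\<^sub>C x i) = (\<lambda>i. c *\<^sub>C A x i)"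
  using assms by (auto simp: bdd_ops_def)

lemma bdd_ops_lp': "A \<in> bdd_ops p \<Longrightarrow> A x \<in> lp p"
  by (cases "x \<in> lp p") (auto simp: bdd_opsD)

lemma bdd_ops_0:
  assumes "A \<in> bdd_ops p" shows "A 0 = 0" "A (\<lambda>i. 0) = 0"
proof -
  show A0: "A 0 = 0" using bdd_ops_add[OF assms, of 0 0] by simp
  show "A (\<lambda>i. 0) = 0" using A0 unfolding zero_fun_def .
qed

lemma bdd_ops_uminus:
  assumes "A \<in> bdd_ops p" "x \<in> lp p" shows "A (- x) = - A x"
  using bdd_ops_add[OF assms lp_uminus(1)[OF assms(2)]] bdd_ops_0[OF assms(1)]
  by (simp add: eq_neg_iff_add_eq_0 add.commute)

lemma bdd_ops_diff:
  assumes "A \<in> bdd_ops p" "x \<in> lp p" "y \<in> lp p" shows "A (x - y) = A x - A y"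
  using bdd_ops_add[OF assms(1,2) lp_uminus(1)[OF assms(3)]] bdd_ops_uminus[OF assms(1,3)] by simp

lemma bdd_opsI:
  assumes "\<And>x. x \<notin> lp p \<Longrightarrow> A x = 0"
    and "\<And>x. x \<in> lp p \<Longrightarrow> A x \<in> lp p"
    and "\<And>x y. x \<in> lp p \<Longrightarrow> y \<in> lp p \<Longrightarrow> A (x + y) = A x + A y"
    and "\<And>c x. x \<in> lp p \<Longrightarrow> A (\<lambda>i. c *\<^sub>C x i) = (\<lambda>i. c *\<^sub>C A x i)"
    and "\<And>x. x \<in> lp p \<Longrightarrow> lp_norm p (A x) \<le> C * lp_norm p x"
  shows "A \<in> bdd_ops p"
  unfolding bdd_ops_def using assms by blast

lemma op_norm_le:
  assumes "0 \<le> c" "\<And>x. x \<in> lp p \<Longrightarrow> lp_norm p (A x) \<le> c * lp_norm p x"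
  shows "op_norm p A \<le> c"
  unfolding op_norm_def
proof (rule cSUP_least)
  show "lp p \<noteq> {}" using lp_0 by blast
  show "lp_norm p (A x) / lp_norm p x \<le> c" if "x \<in> lp p" for x
    using assms(1) assms(2)[OF that] lp_norm_nonneg[OF that]
    by (cases "lp_norm p x = 0") (auto simp: divide_le_eq)
qed

lemma op_norm_bdd_above:
  assumes "A \<in> bdd_ops p"
  shows "bdd_above ((\<lambda>x. lp_norm p (A x) / lp_norm p x) ` lp p)"
proof -
  obtain C where C: "\<forall>x\<in>lp p. lp_norm p (A x) \<le> C * lp_norm p x"
    using assms by (auto simp: bdd_ops_def)
  have "lp_norm p (A x) / lp_norm p x \<le> max C 0" if "x \<in> lp p" for x
    using C that lp_norm_nonneg[OF that]
    by (cases "lp_norm p x = 0") (auto simp: divide_le_eq le_max_iff_disj)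
  then show ?thesis by (rule bdd_aboveI2)
qed

lemma op_norm_nonneg:
  assumes "A \<in> bdd_ops p" shows "0 \<le> op_norm p A"
  unfolding op_norm_def
  using cSUP_upper[OF lp_0(1) op_norm_bdd_above[OF assms]] by simp

lemma op_norm_bound:
  assumes "A \<in> bdd_ops p" "x \<in> lp p"
  shows "lp_norm p (A x) \<le> op_norm p A * lp_norm p x"
proof (cases "lp_norm p x = 0")
  case True
  then show ?thesis using lp_norm_eq_0[OF assms(2)] bdd_ops_0[OF assms(1)] by simp
next
  case False
  then have "lp_norm p (A x) / lp_norm p x \<le> op_norm p A"
    unfolding op_norm_def by (intro cSUP_upper op_norm_bdd_above assms)
  then show ?thesis using False lp_norm_nonneg[OF assms(2)] by (simp add: divide_le_eq)
qed

lemma op_norm_bound':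
  assumes "A \<in> bdd_ops p" "x \<in> lp p" "op_norm p A \<le> c" "lp_norm p x \<le> d"
  shows "lp_norm p (A x) \<le> c * d"
  using op_norm_bound[OF assms(1,2)] assms(3,4) lp_norm_nonneg[OF assms(2)] op_norm_nonneg[OF assms(1)]
  by (meson mult_mono order_trans)

lemma bdd_ops_zero [simp]: "0 \<in> bdd_ops p"
  by (rule bdd_opsI[where C=0]) auto

lemma op_norm_0 [simp]: "op_norm p 0 = 0"
  by (rule antisym[OF op_norm_le op_norm_nonneg[OF bdd_ops_zero]]) auto

lemma bdd_ops_comp:
  assumes "A \<in> bdd_ops p" "B \<in> bdd_ops p"
  shows "A \<circ> B \<in> bdd_ops p" "op_norm p (A \<circ> B) \<le> op_norm p A * op_norm p B"
proof -
  note A = bdd_opsD[OF assms(1)] and B = bdd_opsD[OF assms(2)]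
  have bd: "lp_norm p ((A \<circ> B) x) \<le> (op_norm p A * op_norm p B) * lp_norm p x" if "x \<in> lp p" for x
    using op_norm_bound'[OF assms(1) B(2)[OF that] order_refl op_norm_bound[OF assms(2) that]] by simp
  show "A \<circ> B \<in> bdd_ops p"
    by (rule bdd_opsI[OF _ _ _ _ bd])
      (auto simp: A B bdd_ops_0[OF assms(1)] zero_fun_def[symmetric])
  show "op_norm p (A \<circ> B) \<le> op_norm p A * op_norm p B"
    using op_norm_nonneg[OF assms(1)] op_norm_nonneg[OF assms(2)] by (intro op_norm_le bd) auto
qed

lemma op_norm_comp_le:
  assumes "A \<in> bdd_ops p" "B \<in> bdd_ops p" "op_norm p A \<le> a" "op_norm p B \<le> b"
  shows "op_norm p (A \<circ> B) \<le> a * b"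
  using bdd_ops_comp(2)[OF assms(1,2)] assms(3,4) op_norm_nonneg[OF assms(1)] op_norm_nonneg[OF assms(2)]
  by (meson mult_mono order_trans)

lemma bdd_ops_plus:
  assumes "A \<in> bdd_ops p" "B \<in> bdd_ops p"
  shows "A + B \<in> bdd_ops p" "op_norm p (A + B) \<le> op_norm p A + op_norm p B"
proof -
  note A = bdd_opsD[OF assms(1)] and B = bdd_opsD[OF assms(2)]
  have bd: "lp_norm p ((A + B) x) \<le> (op_norm p A + op_norm p B) * lp_norm p x" if "x \<in> lp p" for x
    using op_norm_bound[OF assms(1) that] op_norm_bound[OF assms(2) that]
      lp_add(2)[OF A(2)[OF that] B(2)[OF that]] by (simp add: distrib_right)
  show "A + B \<in> bdd_ops p"
    by (rule bdd_opsI[OF _ _ _ _ bd]) (auto simp: A B lp_add scaleC_add_right fun_eq_iff)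
  show "op_norm p (A + B) \<le> op_norm p A + op_norm p B"
    using op_norm_nonneg[OF assms(1)] op_norm_nonneg[OF assms(2)] by (intro op_norm_le bd) auto
qed

lemma bdd_ops_neg:
  assumes "A \<in> bdd_ops p"
  shows "- A \<in> bdd_ops p" "op_norm p (- A) = op_norm p A"
proof -
  note A = bdd_opsD[OF assms(1)]
  have bd: "lp_norm p ((- A) x) \<le> op_norm p A * lp_norm p x" if "x \<in> lp p" for x
    using op_norm_bound[OF assms(1) that] lp_uminus(2)[OF A(2)[OF that]] by simp
  show "- A \<in> bdd_ops p"
    by (rule bdd_opsI[OF _ _ _ _ bd]) (auto simp: A lp_uminus scaleC_minus_right fun_eq_iff)
  have "op_norm p (- A) = (SUP x\<in>lp p. lp_norm p (A x) / lp_norm p x)"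
    unfolding op_norm_def using lp_uminus(2)[OF A(2)] by (intro SUP_cong) auto
  then show "op_norm p (- A) = op_norm p A" by (simp add: op_norm_def)
qed

lemma bdd_ops_minus:
  assumes "A \<in> bdd_ops p" "B \<in> bdd_ops p"
  shows "A - B \<in> bdd_ops p" "op_norm p (A - B) \<le> op_norm p A + op_norm p B"
  using bdd_ops_plus[OF assms(1) bdd_ops_neg(1)[OF assms(2)]] bdd_ops_neg(2)[OF assms(2)] by auto

lemma comp_plus_left: "(A + B) \<circ> C = (A \<circ> C) + (B \<circ> C)"
  by (auto simp: fun_eq_iff)

lemma comp_minus_left: "(A - B) \<circ> C = (A \<circ> C) - (B \<circ> C)"
  by (auto simp: fun_eq_iff)

lemma comp_plus_right:
  assumes "A \<in> bdd_ops p" "B \<in> bdd_ops p" "C \<in> bdd_ops p"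
  shows "A \<circ> (B + C) = (A \<circ> B) + (A \<circ> C)"
  using bdd_ops_add[OF assms(1) bdd_ops_lp'[OF assms(2)] bdd_ops_lp'[OF assms(3)]] by (auto simp: fun_eq_iff)

lemma comp_minus_right:
  assumes "A \<in> bdd_ops p" "B \<in> bdd_ops p" "C \<in> bdd_ops p"
  shows "A \<circ> (B - C) = (A \<circ> B) - (A \<circ> C)"
  using bdd_ops_diff[OF assms(1) bdd_ops_lp'[OF assms(2)] bdd_ops_lp'[OF assms(3)]] by (auto simp: fun_eq_iff)

lemma scalar_op_apply: "x \<in> lp p \<Longrightarrow> scalar_op p c x = (\<lambda>i. c *\<^sub>C x i)"
  by (simp add: scalar_op_def on_lp_def)

lemma id_op_apply: "x \<in> lp p \<Longrightarrow> id_op p x = x"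
  by (simp add: id_op_def on_lp_def)

lemma shift_op_apply: "x \<in> lp p \<Longrightarrow> shift_op p k x = (\<lambda>i. x (i - k))"
  by (simp add: shift_op_def on_lp_def)

lemma P_op_apply: "x \<in> lp p \<Longrightarrow> P_op p n x = restr (cube n) x"
  by (simp add: P_op_def on_lp_def restr_def cube_altdef)

lemma Q_op_apply: "x \<in> lp p \<Longrightarrow> Q_op p n x = restr (- cube n) x"
  by (auto simp: Q_op_def P_op_apply id_op_apply restr_def)

lemma scalar_op_bdd [simp]: "scalar_op p c \<in> bdd_ops p"
proof (rule bdd_opsI[where C="cmod c"])
  fix x y :: "('a::finite, 'b::complex_banach) seqs" and d
  show "x \<notin> lp p \<Longrightarrow> scalar_op p c x = 0" by (simp add: scalar_op_def on_lp_def)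
  show "x \<in> lp p \<Longrightarrow> scalar_op p c x \<in> lp p" by (simp add: scalar_op_apply lp_scaleC)
  show "x \<in> lp p \<Longrightarrow> y \<in> lp p \<Longrightarrow> scalar_op p c (x + y) = scalar_op p c x + scalar_op p c y"
    by (auto simp: scalar_op_apply lp_add scaleC_add_right fun_eq_iff)
  show "x \<in> lp p \<Longrightarrow> scalar_op p c (\<lambda>i. d *\<^sub>C x i) = (\<lambda>i. d *\<^sub>C scalar_op p c x i)"
    by (auto simp: scalar_op_apply lp_scaleC scaleC_scaleC fun_eq_iff mult.commute)
  show "x \<in> lp p \<Longrightarrow> lp_norm p (scalar_op p c x) \<le> cmod c * lp_norm p x"
    by (simp add: scalar_op_apply lp_scaleC)
qed

lemma id_op_eq_scalar_op: "id_op p = scalar_op p 1"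
  by (simp add: id_op_def scalar_op_def)

lemma id_op_bdd [simp]: "id_op p \<in> bdd_ops p"
  by (simp add: id_op_eq_scalar_op)

lemma id_op_comp [simp]: "A \<in> bdd_ops p \<Longrightarrow> id_op p \<circ> A = A"
  by (rule ext) (simp add: id_op_apply bdd_ops_lp')

lemma comp_id_op [simp]:
  assumes "A \<in> bdd_ops p" shows "A \<circ> id_op p = A"
proof
  fix x
  show "(A \<circ> id_op p) x = A x"
    using bdd_ops_outside[OF assms, of x] bdd_ops_0[OF assms]
    by (cases "x \<in> lp p") (auto simp: id_op_def on_lp_def zero_fun_def)
qed

lemma on_lp_restr_bdd: "on_lp p (restr U) \<in> bdd_ops p"
proof (rule bdd_opsI[where C=1])
  fix x y :: "('a::finite, 'b::complex_banach) seqs" and d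
  show "x \<notin> lp p \<Longrightarrow> on_lp p (restr U) x = 0" by (simp add: on_lp_def)
  show "x \<in> lp p \<Longrightarrow> on_lp p (restr U) x \<in> lp p" by (simp add: on_lp_def lp_restr)
  show "x \<in> lp p \<Longrightarrow> y \<in> lp p \<Longrightarrow>
      on_lp p (restr U) (x + y) = on_lp p (restr U) x + on_lp p (restr U) y"
    using lp_add(1)[of x y] by (auto simp: on_lp_def restr_def fun_eq_iff)
  show "x \<in> lp p \<Longrightarrow> on_lp p (restr U) (\<lambda>i. d *\<^sub>C x i) = (\<lambda>i. d *\<^sub>C on_lp p (restr U) x i)"
    using lp_scaleC(1)[of x d] by (auto simp: on_lp_def restr_def fun_eq_iff)
  show "x \<in> lp p \<Longrightarrow> lp_norm p (on_lp p (restr U) x) \<le> 1 * lp_norm p x"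
    using lp_restr(2)[of x U] by (simp add: on_lp_def)
qed

lemma P_op_eq: "P_op p n = on_lp p (restr (cube n))"
  by (auto simp: P_op_def on_lp_def restr_def cube_altdef fun_eq_iff)

lemma Q_op_eq: "Q_op p n = on_lp p (restr (- cube n))"
  by (auto simp: Q_op_def id_op_def P_op_eq on_lp_def restr_def fun_eq_iff)

lemma P_op_bdd [simp]: "P_op p n \<in> bdd_ops p"
  by (simp add: P_op_eq on_lp_restr_bdd)

lemma Q_op_bdd [simp]: "Q_op p n \<in> bdd_ops p"
  by (simp add: Q_op_eq on_lp_restr_bdd)

lemma op_norm_Q_op: "op_norm p (Q_op p n) \<le> 1"
  by (rule op_norm_le) (auto simp: Q_op_apply lp_restr)

lemma P_op_plus_Q_op: "P_op p n + Q_op p n = id_op p"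
  by (simp add: Q_op_def)

text \<open>Inserting \<open>I = P\<^sub>m + Q\<^sub>m\<close> between two operators.\<close>

lemma comp_split:
  assumes "A \<in> bdd_ops p" "B \<in> bdd_ops p"
  shows "A \<circ> B = (A \<circ> (P_op p m \<circ> B)) + (A \<circ> (Q_op p m \<circ> B))"
proof -
  have "B = (P_op p m \<circ> B) + (Q_op p m \<circ> B)"
    using comp_plus_left[of "P_op p m" "Q_op p m" B] P_op_plus_Q_op assms(2) by (metis id_op_comp)
  then show ?thesis
    using comp_plus_right[OF assms(1) bdd_ops_comp(1)[OF P_op_bdd assms(2)] bdd_ops_comp(1)[OF Q_op_bdd assms(2)]]
    by metis
qed

lemma Q_op_Q_op:
  assumes "m \<le> n" shows "Q_op p n \<circ> Q_op p m = Q_op p n" "Q_op p m \<circ> Q_op p n = Q_op p n"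
  using cube_mono[OF assms]
  by (auto simp: Q_op_eq on_lp_def lp_restr bdd_ops_zero intro!: ext) (auto simp: restr_def)

lemma Q_op_P_op:
  assumes "m \<le> n" shows "Q_op p n \<circ> P_op p m = 0" "P_op p m \<circ> Q_op p n = 0"
  using cube_mono[OF assms]
  by (auto simp: Q_op_eq P_op_eq on_lp_def lp_restr intro!: ext) (auto simp: restr_def)

lemma shift_op_bdd [simp]: "shift_op p k \<in> bdd_ops p"
proof (rule bdd_opsI[where C=1])
  fix x y :: "('a::finite, 'b::complex_banach) seqs" and d
  show "x \<notin> lp p \<Longrightarrow> shift_op p k x = 0" by (simp add: shift_op_def on_lp_def)
  show "x \<in> lp p \<Longrightarrow> shift_op p k x \<in> lp p" by (simp add: shift_op_apply lp_shift)
  show "x \<in> lp p \<Longrightarrow> y \<in> lp p \<Longrightarrow> shift_op p k (x + y) = shift_op p k x + shift_op p k y"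
    by (auto simp: shift_op_apply lp_add)
  show "x \<in> lp p \<Longrightarrow> shift_op p k (\<lambda>i. d *\<^sub>C x i) = (\<lambda>i. d *\<^sub>C shift_op p k x i)"
    by (auto simp: shift_op_apply lp_scaleC)
  show "x \<in> lp p \<Longrightarrow> lp_norm p (shift_op p k x) \<le> 1 * lp_norm p x"
    by (simp add: shift_op_apply lp_shift)
qed

lemma lp_norm_shift_op: "x \<in> lp p \<Longrightarrow> lp_norm p (shift_op p k x) = lp_norm p x"
  by (simp add: shift_op_apply lp_shift)

section \<open>The algebras \<open>\<K>(X,P)\<close> and \<open>\<L>(X,P)\<close>\<close>

text \<open>The quantities \<open>op_norm p (Q_op p n \<circ> K)\<close> and \<open>op_norm p (K \<circ> Q_op p n)\<close> decrease
  in \<open>n\<close>. So their convergence to \<open>0\<close> means that they become small at a single index.\<close>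

lemma op_norm_Q_decreasing:
  assumes "K \<in> bdd_ops p" "m \<le> n"
  shows "op_norm p (Q_op p n \<circ> K) \<le> op_norm p (Q_op p m \<circ> K)"
    "op_norm p (K \<circ> Q_op p n) \<le> op_norm p (K \<circ> Q_op p m)"
proof -
  have "Q_op p n \<circ> K = Q_op p n \<circ> (Q_op p m \<circ> K)" "K \<circ> Q_op p n = (K \<circ> Q_op p m) \<circ> Q_op p n"
    using Q_op_Q_op[OF assms(2)] by (metis comp_assoc)+
  then show "op_norm p (Q_op p n \<circ> K) \<le> op_norm p (Q_op p m \<circ> K)"
    "op_norm p (K \<circ> Q_op p n) \<le> op_norm p (K \<circ> Q_op p m)"
    using op_norm_comp_le[OF Q_op_bdd bdd_ops_comp(1)[OF Q_op_bdd assms(1)] op_norm_Q_op[of n] order_refl, of m]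
      op_norm_comp_le[OF bdd_ops_comp(1)[OF assms(1) Q_op_bdd] Q_op_bdd order_refl op_norm_Q_op[of n], of m]
    by simp_all
qed

lemma KP_iff:
  "K \<in> KP p \<longleftrightarrow> K \<in> bdd_ops p \<and>
    (\<forall>e>0. \<exists>n. op_norm p (Q_op p n \<circ> K) \<le> e \<and> op_norm p (K \<circ> Q_op p n) \<le> e)"
proof (cases "K \<in> bdd_ops p")
  case True
  let ?a = "\<lambda>n. op_norm p (Q_op p n \<circ> K)" and ?b = "\<lambda>n. op_norm p (K \<circ> Q_op p n)"
  have nn: "0 \<le> ?a n" "0 \<le> ?b n" for n
    using True by (auto intro!: op_norm_nonneg bdd_ops_comp)
  have "(\<lambda>n. ?a n + ?b n) \<longlonglongrightarrow> 0 \<longleftrightarrow> (\<forall>e>0. \<exists>n. ?a n \<le> e \<and> ?b n \<le> e)"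
  proof
    assume L: "(\<lambda>n. ?a n + ?b n) \<longlonglongrightarrow> 0"
    show "\<forall>e>0. \<exists>n. ?a n \<le> e \<and> ?b n \<le> e"
    proof (intro allI impI)
      fix e :: real assume "e > 0"
      with L obtain n where "?a n + ?b n < e"
        by (metis (no_types, lifting) eventually_happens' order_tendstoD(2) sequentially_bot)
      then show "\<exists>n. ?a n \<le> e \<and> ?b n \<le> e" using nn[of n] by (intro exI[of _ n]) linarith
    qed
  next
    assume R: "\<forall>e>0. \<exists>n. ?a n \<le> e \<and> ?b n \<le> e"
    show "(\<lambda>n. ?a n + ?b n) \<longlonglongrightarrow> 0"
    proof (rule LIMSEQ_I)
      fix e :: real assume "e > 0"
      then obtain m where m: "?a m \<le> e/3" "?b m \<le> e/3" using R by (metis divide_pos_pos zero_less_numeral)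
      have "norm (?a n + ?b n - 0) < e" if "m \<le> n" for n
        using op_norm_Q_decreasing[OF True that] m nn[of n] \<open>e > 0\<close> by simp
      then show "\<exists>no. \<forall>n\<ge>no. norm (?a n + ?b n - 0) < e" by blast
    qed
  qed
  then show ?thesis using True by (simp add: KP_def)
qed (simp add: KP_def)

lemma KP_bdd: "K \<in> KP p \<Longrightarrow> K \<in> bdd_ops p"
  by (simp add: KP_iff)

lemma LP_bdd: "A \<in> LP p \<Longrightarrow> A \<in> bdd_ops p"
  by (simp add: LP_def)

lemma KP_obtain:
  assumes "K \<in> KP p" "e > 0"
  obtains n where "\<And>m. m \<ge> n \<Longrightarrow> op_norm p (Q_op p m \<circ> K) \<le> e"
    "\<And>m. m \<ge> n \<Longrightarrow> op_norm p (K \<circ> Q_op p m) \<le> e"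
proof -
  obtain n where "op_norm p (Q_op p n \<circ> K) \<le> e" "op_norm p (K \<circ> Q_op p n) \<le> e"
    using assms KP_iff by blast
  then show ?thesis using that op_norm_Q_decreasing[OF KP_bdd[OF assms(1)]] order_trans by meson
qed

text \<open>Left and right multiplication by \<open>Q\<^sub>n\<close> are contractions, so an approximant of \<open>A\<close> in
  \<open>\<K>(X,P)\<close> controls \<open>Q\<^sub>n A\<close> and \<open>A Q\<^sub>n\<close>.\<close>

lemma KP_closed:
  assumes "A \<in> bdd_ops p" "\<And>e. e > 0 \<Longrightarrow> \<exists>K\<in>KP p. op_norm p (A - K) \<le> e"
  shows "A \<in> KP p"
  unfolding KP_iff
proof (intro conjI allI impI assms(1))
  fix e :: real assume "e > 0"
  then obtain K where K: "K \<in> KP p" "op_norm p (A - K) \<le> e/2" using assms(2)[of "e/2"] by auto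
  note Kb = KP_bdd[OF K(1)]
  note D = bdd_ops_minus(1)[OF assms(1) Kb]
  obtain n where n: "op_norm p (Q_op p n \<circ> K) \<le> e/2" "op_norm p (K \<circ> Q_op p n) \<le> e/2"
    by (rule KP_obtain[OF K(1) half_gt_zero[OF \<open>e > 0\<close>]]) blast
  have 1: "Q_op p n \<circ> A = (Q_op p n \<circ> (A - K)) + (Q_op p n \<circ> K)"
    using comp_minus_right[OF Q_op_bdd assms(1) Kb] by simp
  have 2: "A \<circ> Q_op p n = ((A - K) \<circ> Q_op p n) + (K \<circ> Q_op p n)"
    by (simp add: comp_minus_left)
  have "op_norm p (Q_op p n \<circ> A) \<le> 1 * (e/2) + e/2"
    unfolding 1 using bdd_ops_plus(2)[OF bdd_ops_comp(1)[OF Q_op_bdd D] bdd_ops_comp(1)[OF Q_op_bdd Kb]]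
      op_norm_comp_le[OF Q_op_bdd D op_norm_Q_op K(2)] n(1) add_mono order_trans by meson
  moreover have "op_norm p (A \<circ> Q_op p n) \<le> (e/2) * 1 + e/2"
    unfolding 2 using bdd_ops_plus(2)[OF bdd_ops_comp(1)[OF D Q_op_bdd] bdd_ops_comp(1)[OF Kb Q_op_bdd]]
      op_norm_comp_le[OF D Q_op_bdd K(2) op_norm_Q_op] n(2) add_mono order_trans by meson
  ultimately show "\<exists>n. op_norm p (Q_op p n \<circ> A) \<le> e \<and> op_norm p (A \<circ> Q_op p n) \<le> e"
    by (intro exI[of _ n]) simp
qed

lemma KP_zero [simp]: "(0 :: ('n::finite, 'x::complex_banach) oper) \<in> KP p"
  unfolding KP_iff
proof (intro conjI allI impI)
  fix e :: real assume "e > 0"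
  have "Q_op p n \<circ> (0 :: ('n, 'x) oper) = 0" "(0 :: ('n, 'x) oper) \<circ> Q_op p n = 0" for n
    using bdd_ops_0[OF Q_op_bdd] by (auto simp: fun_eq_iff)
  then show "\<exists>n. op_norm p (Q_op p n \<circ> (0 :: ('n, 'x) oper)) \<le> e \<and> op_norm p ((0 :: ('n, 'x) oper) \<circ> Q_op p n) \<le> e"
    using \<open>e > 0\<close> by simp
qed simp

lemma KP_plus:
  assumes "K \<in> KP p" "L \<in> KP p" shows "K + L \<in> KP p"
  unfolding KP_iff
proof (intro conjI allI impI)
  note Kb = KP_bdd[OF assms(1)] and Lb = KP_bdd[OF assms(2)]
  show "K + L \<in> bdd_ops p" using Kb Lb by (rule bdd_ops_plus)
  fix e :: real assume "e > 0"
  then have e2: "e/2 > 0" by simp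
  obtain m where m: "\<And>n. n \<ge> m \<Longrightarrow> op_norm p (Q_op p n \<circ> K) \<le> e/2"
    "\<And>n. n \<ge> m \<Longrightarrow> op_norm p (K \<circ> Q_op p n) \<le> e/2" by (rule KP_obtain[OF assms(1) e2]) blast
  obtain m' where m': "\<And>n. n \<ge> m' \<Longrightarrow> op_norm p (Q_op p n \<circ> L) \<le> e/2"
    "\<And>n. n \<ge> m' \<Longrightarrow> op_norm p (L \<circ> Q_op p n) \<le> e/2" by (rule KP_obtain[OF assms(2) e2]) blast
  define n where "n = max m m'"
  have "op_norm p (Q_op p n \<circ> (K + L)) \<le> e/2 + e/2"
    unfolding comp_plus_right[OF Q_op_bdd Kb Lb]
    using m(1)[of n] m'(1)[of n] Kb Lb
    by (intro order_trans[OF bdd_ops_plus(2)] add_mono bdd_ops_comp Q_op_bdd) (auto simp: n_def)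
  moreover have "op_norm p ((K + L) \<circ> Q_op p n) \<le> e/2 + e/2"
    unfolding comp_plus_left
    using m(2)[of n] m'(2)[of n] Kb Lb
    by (intro order_trans[OF bdd_ops_plus(2)] add_mono bdd_ops_comp Q_op_bdd) (auto simp: n_def)
  ultimately show "\<exists>n. op_norm p (Q_op p n \<circ> (K + L)) \<le> e \<and> op_norm p ((K + L) \<circ> Q_op p n) \<le> e"
    by (intro exI[of _ n]) simp
qed

lemma comp_neg_right:
  assumes "A \<in> bdd_ops p" "B \<in> bdd_ops p" shows "A \<circ> (- B) = - (A \<circ> B)"
  using bdd_ops_uminus[OF assms(1) bdd_ops_lp'[OF assms(2)]] by (auto simp: fun_eq_iff)

lemma comp_neg_left: "(- A) \<circ> B = - (A \<circ> B)"
  by (auto simp: fun_eq_iff)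

lemma KP_neg:
  assumes "K \<in> KP p" shows "- K \<in> KP p"
proof -
  note Kb = KP_bdd[OF assms]
  show ?thesis
    using assms bdd_ops_neg(1)[OF Kb] unfolding KP_iff comp_neg_right[OF Q_op_bdd Kb] comp_neg_left
    by (simp add: bdd_ops_neg(2)[OF bdd_ops_comp(1)[OF Q_op_bdd Kb]] bdd_ops_neg(2)[OF bdd_ops_comp(1)[OF Kb Q_op_bdd]])
qed

lemma KP_minus: "K \<in> KP p \<Longrightarrow> L \<in> KP p \<Longrightarrow> K - L \<in> KP p"
  using KP_plus[of K "- L"] KP_neg[of L] by simp

lemma P_op_KP [simp]: "P_op p m \<in> KP p"
  unfolding KP_iff by (auto intro!: exI[of _ m] simp: Q_op_P_op)

lemma LP_comp_KP: "A \<in> LP p \<Longrightarrow> K \<in> KP p \<Longrightarrow> A \<circ> K \<in> KP p"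
  and KP_comp_LP: "A \<in> LP p \<Longrightarrow> K \<in> KP p \<Longrightarrow> K \<circ> A \<in> KP p"
  by (auto simp: LP_def)

text \<open>If \<open>A\<close> sees the window of radius \<open>m\<close> only from within that of radius \<open>n\<close>, and conversely,
  then \<open>Q\<^sub>n A K = Q\<^sub>n A Q\<^sub>m K\<close> and \<open>K A Q\<^sub>n = K Q\<^sub>m A Q\<^sub>n\<close>; these are small because \<open>Q\<^sub>m K\<close> and
  \<open>K Q\<^sub>m\<close> are.\<close>

lemma LP_I:
  fixes A :: "('n::finite, 'x::complex_banach) oper"
  assumes A: "A \<in> bdd_ops p"
    and loc: "\<And>m. \<exists>n\<ge>m. Q_op p n \<circ> A \<circ> P_op p m = 0 \<and> P_op p m \<circ> A \<circ> Q_op p n = 0"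
  shows "A \<in> LP p"
proof -
  have "A \<circ> K \<in> KP p \<and> K \<circ> A \<in> KP p" if K: "K \<in> KP p" for K :: "('n, 'x) oper"
  proof -
    note Kb = KP_bdd[OF K]
    let ?a = "op_norm p A"
    have ex: "\<exists>n. op_norm p (Q_op p n \<circ> (A \<circ> K)) \<le> e \<and> op_norm p (A \<circ> K \<circ> Q_op p n) \<le> e \<and>
        op_norm p (Q_op p n \<circ> (K \<circ> A)) \<le> e \<and> op_norm p (K \<circ> A \<circ> Q_op p n) \<le> e" if e: "e > 0" for e
    proof -
      define d where "d = e / (?a + 1)"
      have a1: "?a + 1 > 0" using op_norm_nonneg[OF A] by simp
      have d: "d > 0" unfolding d_def using e a1 by simp
      have "(?a + 1) * d = e" unfolding d_def using a1 by simp
      then have ad: "?a * d \<le> e" using d by (simp add: distrib_right)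
      obtain m where m: "op_norm p (Q_op p m \<circ> K) \<le> d" "op_norm p (K \<circ> Q_op p m) \<le> d"
        using K d KP_iff by blast
      obtain n where n: "m \<le> n" "Q_op p n \<circ> A \<circ> P_op p m = 0" "P_op p m \<circ> A \<circ> Q_op p n = 0"
        using loc by blast
      have "K \<circ> (0 :: ('n, 'x) oper) = 0" using bdd_ops_0[OF Kb] by (auto simp: fun_eq_iff)
      then have "K \<circ> (P_op p m \<circ> (A \<circ> Q_op p n)) = 0" using n(3) by (metis comp_assoc)
      moreover have "(Q_op p n \<circ> A) \<circ> (P_op p m \<circ> K) = 0" using n(2) by (auto simp: fun_eq_iff)
      ultimately have eq: "Q_op p n \<circ> (A \<circ> K) = Q_op p n \<circ> (A \<circ> (Q_op p m \<circ> K))"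
        "K \<circ> A \<circ> Q_op p n = (K \<circ> Q_op p m) \<circ> (A \<circ> Q_op p n)"
        using comp_split[OF bdd_ops_comp(1)[OF Q_op_bdd A] Kb, of n m]
          comp_split[OF Kb bdd_ops_comp(1)[OF A Q_op_bdd], of n m]
        by (simp_all only: comp_assoc add_0_left)
      have "op_norm p (Q_op p n \<circ> (A \<circ> K)) \<le> 1 * (?a * d)"
        "op_norm p (K \<circ> A \<circ> Q_op p n) \<le> d * (?a * 1)"
        unfolding eq using Kb A m by (intro op_norm_comp_le bdd_ops_comp op_norm_Q_op; simp)+
      moreover have "op_norm p (A \<circ> (K \<circ> Q_op p n)) \<le> ?a * d" "op_norm p ((Q_op p n \<circ> K) \<circ> A) \<le> d * ?a"
        using op_norm_Q_decreasing[OF Kb n(1)] m Kb A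
        by (intro op_norm_comp_le bdd_ops_comp Q_op_bdd order_refl; simp)+
      ultimately show ?thesis using ad
        by (intro exI[of _ n]) (auto simp: comp_assoc mult.commute)
    qed
    then show ?thesis unfolding KP_iff using bdd_ops_comp(1)[OF A Kb] bdd_ops_comp(1)[OF Kb A] by meson
  qed
  then show ?thesis using A by (simp add: LP_def)
qed

lemma LP_plus:
  fixes A B :: "('n::finite, 'x::complex_banach) oper"
  assumes "A \<in> LP p" "B \<in> LP p" shows "A + B \<in> LP p"
  unfolding LP_def
proof (intro CollectI conjI ballI)
  note Ab = LP_bdd[OF assms(1)] and Bb = LP_bdd[OF assms(2)]
  show "A + B \<in> bdd_ops p" using Ab Bb by (rule bdd_ops_plus)
  fix K :: "('n, 'x) oper" assume "K \<in> KP p"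
  then show "(A + B) \<circ> K \<in> KP p" "K \<circ> (A + B) \<in> KP p"
    using assms comp_plus_left[of A B K] comp_plus_right[OF KP_bdd Ab Bb, of K]
    by (auto simp: LP_comp_KP KP_comp_LP KP_plus)
qed

lemma LP_neg:
  fixes A :: "('n::finite, 'x::complex_banach) oper"
  assumes "A \<in> LP p" shows "- A \<in> LP p"
  unfolding LP_def
proof (intro CollectI conjI ballI)
  note Ab = LP_bdd[OF assms(1)]
  show "- A \<in> bdd_ops p" using Ab by (rule bdd_ops_neg)
  fix K :: "('n, 'x) oper" assume "K \<in> KP p"
  then show "(- A) \<circ> K \<in> KP p" "K \<circ> (- A) \<in> KP p"
    using assms comp_neg_left[of A K] comp_neg_right[OF KP_bdd Ab, of K]
    by (auto simp: LP_comp_KP KP_comp_LP KP_neg)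
qed

lemma LP_minus: "A \<in> LP p \<Longrightarrow> B \<in> LP p \<Longrightarrow> A - B \<in> LP p"
  using LP_plus[of A "- B"] LP_neg[of B] by simp

lemma LP_comp:
  fixes A B :: "('n::finite, 'x::complex_banach) oper"
  assumes "A \<in> LP p" "B \<in> LP p" shows "A \<circ> B \<in> LP p"
  unfolding LP_def
proof (intro CollectI conjI ballI)
  show "A \<circ> B \<in> bdd_ops p" using assms LP_bdd by (intro bdd_ops_comp) auto
  fix K :: "('n, 'x) oper" assume "K \<in> KP p"
  then show "(A \<circ> B) \<circ> K \<in> KP p" "K \<circ> (A \<circ> B) \<in> KP p"
    using LP_comp_KP[OF assms(1) LP_comp_KP[OF assms(2)]] KP_comp_LP[OF assms(2) KP_comp_LP[OF assms(1)]]
    by (auto simp: comp_assoc)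
qed

lemma KP_LP:
  fixes K :: "('n::finite, 'x::complex_banach) oper"
  assumes "K \<in> KP p" shows "K \<in> LP p"
  unfolding LP_def
proof (intro CollectI conjI ballI)
  note Kb = KP_bdd[OF assms]
  show "K \<in> bdd_ops p" by fact
  have "K \<circ> L \<in> KP p" if KL: "K \<in> KP p" "L \<in> KP p" for K L :: "('n, 'x) oper"
    unfolding KP_iff
  proof (intro conjI allI impI)
    note Kb = KP_bdd[OF KL(1)] and Lb = KP_bdd[OF KL(2)]
    show "K \<circ> L \<in> bdd_ops p" using Kb Lb by (rule bdd_ops_comp)
    fix e :: real assume e: "e > 0"
    define s where "s = op_norm p K + op_norm p L + 1"
    have s: "s > 0" "op_norm p K \<le> s" "op_norm p L \<le> s"
      using op_norm_nonneg[OF Kb] op_norm_nonneg[OF Lb] by (auto simp: s_def)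
    have es: "e / s > 0" using e s by simp
    obtain m where m: "\<And>n. n \<ge> m \<Longrightarrow> op_norm p (Q_op p n \<circ> K) \<le> e/s"
      by (rule KP_obtain[OF KL(1) es]) blast
    obtain m' where m': "\<And>n. n \<ge> m' \<Longrightarrow> op_norm p (L \<circ> Q_op p n) \<le> e/s"
      by (rule KP_obtain[OF KL(2) es]) blast
    let ?n = "max m m'"
    have "op_norm p ((Q_op p ?n \<circ> K) \<circ> L) \<le> (e/s) * s"
      using m[of ?n] s Kb Lb by (intro op_norm_comp_le bdd_ops_comp) auto
    moreover have "op_norm p (K \<circ> (L \<circ> Q_op p ?n)) \<le> s * (e/s)"
      using m'[of ?n] s Kb Lb by (intro op_norm_comp_le bdd_ops_comp) auto
    ultimately show "\<exists>n. op_norm p (Q_op p n \<circ> (K \<circ> L)) \<le> e \<and> op_norm p (K \<circ> L \<circ> Q_op p n) \<le> e"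
      using s(1) by (intro exI[of _ ?n]) (simp add: comp_assoc)
  qed
  then show "K \<circ> L \<in> KP p" "L \<circ> K \<in> KP p" if "L \<in> KP p" for L :: "('n, 'x) oper" using that assms by auto
qed

lemma LP_closed:
  fixes A :: "('n::finite, 'x::complex_banach) oper"
  assumes A: "A \<in> bdd_ops p" and app: "\<And>e. e > 0 \<Longrightarrow> \<exists>B\<in>LP p. op_norm p (A - B) \<le> e"
  shows "A \<in> LP p"
  unfolding LP_def
proof (intro CollectI conjI ballI A)
  fix K :: "('n, 'x) oper" assume K: "K \<in> KP p"
  note Kb = KP_bdd[OF K]
  have ex: "\<exists>B\<in>LP p. op_norm p ((A \<circ> K) - (B \<circ> K)) \<le> e \<and> op_norm p ((K \<circ> A) - (K \<circ> B)) \<le> e" if e: "e > 0" for e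
  proof -
    define d where "d = e / (op_norm p K + 1)"
    have d: "d > 0" "d * op_norm p K \<le> e" "op_norm p K * d \<le> e"
      using e op_norm_nonneg[OF Kb] by (auto simp: d_def field_simps)
    obtain B where B: "B \<in> LP p" "op_norm p (A - B) \<le> d" using app[OF d(1)] by blast
    note D = bdd_ops_minus(1)[OF A LP_bdd[OF B(1)]]
    show ?thesis
      using op_norm_comp_le[OF D Kb B(2) order_refl] op_norm_comp_le[OF Kb D order_refl B(2)] d B(1)
      unfolding comp_minus_left comp_minus_right[OF Kb A LP_bdd[OF B(1)]]
      by (intro bexI[of _ B]) auto
  qed
  show "A \<circ> K \<in> KP p"
  proof (rule KP_closed[OF bdd_ops_comp(1)[OF A Kb]])
    fix e :: real assume "e > 0"
    then show "\<exists>L\<in>KP p. op_norm p ((A \<circ> K) - L) \<le> e" using ex LP_comp_KP[OF _ K] by meson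
  qed
  show "K \<circ> A \<in> KP p"
  proof (rule KP_closed[OF bdd_ops_comp(1)[OF Kb A]])
    fix e :: real assume "e > 0"
    then show "\<exists>L\<in>KP p. op_norm p ((K \<circ> A) - L) \<le> e" using ex KP_comp_LP[OF _ K] by meson
  qed
qed

lemma scalar_op_LP [simp]: "scalar_op p c \<in> LP p"
proof (rule LP_I[OF scalar_op_bdd])
  fix m
  show "\<exists>n\<ge>m. Q_op p n \<circ> scalar_op p c \<circ> P_op p m = (0 :: ('n::finite, 'x::complex_banach) oper) \<and>
    P_op p m \<circ> scalar_op p c \<circ> Q_op p n = (0 :: ('n::finite, 'x::complex_banach) oper)"
    by (rule exI[of _ m])
      (auto simp: Q_op_eq P_op_eq scalar_op_def on_lp_def fun_eq_iff restr_def)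
qed

lemma id_op_LP [simp]: "id_op p \<in> LP p"
  by (simp add: id_op_eq_scalar_op)

lemma zero_LP [simp]: "0 \<in> LP p"
  by (simp add: KP_LP)

text \<open>An element \<open>K\<close> of \<open>\<K>(X,P)\<close> is close to \<open>K P\<^sub>m\<close> and to \<open>P\<^sub>m K\<close> for some \<open>m\<close>. The difference
  is multiplied by operators of bounded norm, so testing on the \<open>P\<^sub>m\<close> suffices.\<close>

lemma P_strongly_convergesI:
  fixes A :: "('n::finite, 'x::complex_banach) oper"
  assumes As: "\<And>n. As n \<in> bdd_ops p" "\<And>n. op_norm p (As n) \<le> c" and A: "A \<in> bdd_ops p"
    and l: "\<And>m. (\<lambda>n. op_norm p (P_op p m \<circ> (As n - A))) \<longlonglongrightarrow> 0"
    and r: "\<And>m. (\<lambda>n. op_norm p ((As n - A) \<circ> P_op p m)) \<longlonglongrightarrow> 0"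
  shows "P_strongly_converges p As A"
  unfolding P_strongly_converges_def
proof (intro conjI allI ballI As A)
  fix K :: "('n, 'x) oper" assume K: "K \<in> KP p"
  note Kb = KP_bdd[OF K]
  define D where "D n = As n - A" for n
  have D: "D n \<in> bdd_ops p" for n unfolding D_def by (intro bdd_ops_minus As A)
  define d where "d = c + op_norm p A + 1"
  have Dd: "op_norm p (D n) \<le> d" for n
    using bdd_ops_minus(2)[OF As(1) A, of n] As(2)[of n] by (simp add: D_def d_def)
  have d: "d > 0" using op_norm_nonneg[OF As(1)[of 0]] As(2)[of 0] op_norm_nonneg[OF A] by (simp add: d_def)
  define k where "k = op_norm p K + 1"
  have k: "k > 0" "op_norm p K \<le> k" using op_norm_nonneg[OF Kb] by (auto simp: k_def)
  have "(\<lambda>n. op_norm p (K \<circ> D n) + op_norm p (D n \<circ> K)) \<longlonglongrightarrow> 0"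
  proof (rule LIMSEQ_I)
    fix e :: real assume e: "e > 0"
    then have "e / (8 * d) > 0" using d by simp
    then obtain m where m: "op_norm p (Q_op p m \<circ> K) \<le> e / (8 * d)" "op_norm p (K \<circ> Q_op p m) \<le> e / (8 * d)"
      by (metis KP_obtain K order_refl)
    have ek: "e / (8 * k) > 0" using e k by simp
    have "\<forall>\<^sub>F n in sequentially. op_norm p (P_op p m \<circ> D n) < e / (8 * k) \<and> op_norm p (D n \<circ> P_op p m) < e / (8 * k)"
      unfolding D_def using order_tendstoD(2)[OF l ek] order_tendstoD(2)[OF r ek] by (rule eventually_conj)
    then obtain N where N: "\<And>n. n \<ge> N \<Longrightarrow> op_norm p (P_op p m \<circ> D n) < e / (8 * k) \<and> op_norm p (D n \<circ> P_op p m) < e / (8 * k)"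
      unfolding eventually_sequentially by blast
    have "norm (op_norm p (K \<circ> D n) + op_norm p (D n \<circ> K) - 0) < e" if n: "n \<ge> N" for n
    proof -
      have 1: "K \<circ> D n = (K \<circ> (P_op p m \<circ> D n)) + ((K \<circ> Q_op p m) \<circ> D n)"
        using comp_split[OF Kb D] by (simp only: comp_assoc)
      have 2: "D n \<circ> K = ((D n \<circ> P_op p m) \<circ> K) + (D n \<circ> (Q_op p m \<circ> K))"
        using comp_split[OF D Kb] by (simp only: comp_assoc)
      have "op_norm p (K \<circ> D n) \<le> op_norm p (K \<circ> (P_op p m \<circ> D n)) + op_norm p ((K \<circ> Q_op p m) \<circ> D n)"
        by (subst 1) (intro bdd_ops_plus bdd_ops_comp Kb D P_op_bdd Q_op_bdd)
      also have "\<dots> \<le> k * (e / (8 * k)) + (e / (8 * d)) * d"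
        using N[OF n] k m Dd by (intro add_mono op_norm_comp_le bdd_ops_comp Kb D P_op_bdd Q_op_bdd) auto
      finally have A1: "op_norm p (K \<circ> D n) \<le> e / 4" using k d by simp
      have "op_norm p (D n \<circ> K) \<le> op_norm p ((D n \<circ> P_op p m) \<circ> K) + op_norm p (D n \<circ> (Q_op p m \<circ> K))"
        by (subst 2) (intro bdd_ops_plus bdd_ops_comp Kb D P_op_bdd Q_op_bdd)
      also have "\<dots> \<le> (e / (8 * k)) * k + d * (e / (8 * d))"
        using N[OF n] k m Dd by (intro add_mono op_norm_comp_le bdd_ops_comp Kb D P_op_bdd Q_op_bdd) auto
      finally have A2: "op_norm p (D n \<circ> K) \<le> e / 4" using k d by simp
      show ?thesis
        using A1 A2 e op_norm_nonneg[OF bdd_ops_comp(1)[OF Kb D[of n]]] op_norm_nonneg[OF bdd_ops_comp(1)[OF D[of n] Kb]]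
        by simp
    qed
    then show "\<exists>N. \<forall>n\<ge>N. norm (op_norm p (K \<circ> D n) + op_norm p (D n \<circ> K) - 0) < e" by blast
  qed
  then show "(\<lambda>n. op_norm p (K \<circ> (As n - A)) + op_norm p ((As n - A) \<circ> K)) \<longlonglongrightarrow> 0"
    by (simp add: D_def)
qed

text \<open>The projection \<open>P\<^sub>m\<close>, which fixes \<open>x\<close>, is itself one of the test operators.\<close>

lemma P_strongly_converges_apply:
  assumes "P_strongly_converges p As A" "x \<in> lp p" "restr (cube m) x = x"
  shows "(\<lambda>n. lp_norm p (As n x - A x)) \<longlonglongrightarrow> 0"
proof -
  have b: "As n \<in> bdd_ops p" "A \<in> bdd_ops p" for n using assms(1) by (auto simp: P_strongly_converges_def)
  have D: "As n - A \<in> bdd_ops p" for n using b by (rule bdd_ops_minus)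
  have lim: "(\<lambda>n. op_norm p (P_op p m \<circ> (As n - A)) + op_norm p ((As n - A) \<circ> P_op p m)) \<longlonglongrightarrow> 0"
    using assms(1) P_op_KP by (auto simp: P_strongly_converges_def)
  have "lp_norm p (As n x - A x) \<le>
      (op_norm p (P_op p m \<circ> (As n - A)) + op_norm p ((As n - A) \<circ> P_op p m)) * lp_norm p x" for n
  proof -
    have "lp_norm p (As n x - A x) = lp_norm p (((As n - A) \<circ> P_op p m) x)"
      using assms(2,3) by (simp add: P_op_apply)
    also have "\<dots> \<le> op_norm p ((As n - A) \<circ> P_op p m) * lp_norm p x"
      by (intro op_norm_bound bdd_ops_comp D assms(2) P_op_bdd)
    also have "\<dots> \<le> (op_norm p (P_op p m \<circ> (As n - A)) + op_norm p ((As n - A) \<circ> P_op p m)) * lp_norm p x"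
      using lp_norm_nonneg[OF assms(2)] op_norm_nonneg[OF bdd_ops_comp(1)[OF P_op_bdd D]]
      by (intro mult_right_mono) auto
    finally show ?thesis .
  qed
  moreover have "0 \<le> lp_norm p (As n x - A x)" for n
    using b by (intro lp_norm_nonneg lp_diff bdd_ops_lp')
  ultimately have le: "norm (lp_norm p (As n x - A x)) \<le>
      (op_norm p (P_op p m \<circ> (As n - A)) + op_norm p ((As n - A) \<circ> P_op p m)) * lp_norm p x" for n
    unfolding real_norm_def by (metis abs_of_nonneg)
  show ?thesis
    by (rule Lim_null_comparison[OF always_eventually[OF allI[OF le]] tendsto_mult_left_zero[OF lim]])
qed

section \<open>Neumann series\<close>

text \<open>The sum \<open>G\<close> of the powers of \<open>S\<close>, formed coordinatewise, is the limit in operator norm of its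
  partial sums, and therefore lies in \<open>\<L>(X,P)\<close>. Telescoping shows that it is a right inverse of
  \<open>I - S\<close>. It is also a left inverse, because \<open>I - S\<close> is injective.\<close>

lemma Neumann_series:
  fixes S :: "('n::finite, 'x::complex_banach) oper"
  assumes S: "S \<in> LP p" and q: "op_norm p S < 1"
  shows "\<exists>G\<in>LP p. (id_op p - S) \<circ> G = id_op p \<and> G \<circ> (id_op p - S) = id_op p"
proof -
  note Sb = LP_bdd[OF S]
  let ?q = "op_norm p S"
  have q0: "0 \<le> ?q" by (rule op_norm_nonneg[OF Sb])
  \<comment> \<open>\<open>R n\<close> is the sum of the tail of the geometric series from the exponent \<open>n\<close> on.\<close>
  define R where "R n = ?q ^ n / (1 - ?q)" for n
  have geo: "summable (\<lambda>k. ?q ^ k * c)" "(\<Sum>k. ?q ^ (k + n) * c) = R n * c" for n c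
  proof -
    show s: "summable (\<lambda>k. ?q ^ k * c)" using q q0 by (intro summable_mult2 summable_geometric) auto
    have "(\<Sum>k. ?q ^ (k + n) * c) = (\<Sum>k. ?q ^ k * (?q ^ n * c))" by (simp add: power_add mult_ac)
    also have "\<dots> = R n * c"
      using q q0 by (simp add: suminf_mult2[symmetric] suminf_geometric summable_geometric R_def)
    finally show "(\<Sum>k. ?q ^ (k + n) * c) = R n * c" .
  qed
  have R0: "R n \<ge> 0" for n using q q0 by (simp add: R_def)
  have Rlim: "R \<longlonglongrightarrow> 0" unfolding R_def using q q0 by (intro tendsto_eq_intros LIMSEQ_realpow_zero) auto
  have pw: "(S ^^ k) x \<in> lp p" "lp_norm p ((S ^^ k) x) \<le> ?q ^ k * lp_norm p x" if "x \<in> lp p" for k x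
  proof (induction k)
    case (Suc k)
    { case 1 show ?case using Suc bdd_ops_lp'[OF Sb] by simp }
    { case 2 show ?case using op_norm_bound'[OF Sb Suc(1) order_refl Suc(2)] by (simp add: mult_ac) }
  qed (use that in auto)
  define G where "G = on_lp p (\<lambda>x i. \<Sum>k. (S ^^ k) x i)"
  define Gn where "Gn n = (\<Sum>k<n. (S ^^ k) \<circ> id_op p)" for n
  have Gn_LP: "Gn n \<in> LP p" for n
  proof -
    have "(S ^^ k) \<circ> id_op p \<in> LP p" for k
    proof (induction k)
      case (Suc k)
      have "(S ^^ Suc k) \<circ> id_op p = S \<circ> ((S ^^ k) \<circ> id_op p)" by (simp add: comp_assoc)
      then show ?case using LP_comp[OF S Suc] by (simp only:)
    qed (simp only: funpow_0 id_op_LP funpow.simps id_comp)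
    then show ?thesis unfolding Gn_def by (induction n) (auto intro: LP_plus)
  qed
  have Gn: "Gn n x = (\<Sum>k<n. (S ^^ k) x)" if "x \<in> lp p" for n x
    using that by (simp add: Gn_def sum_fun_apply id_op_apply)
  have Glp: "G x \<in> lp p" and GGn: "lp_norm p (G x - Gn n x) \<le> R n * lp_norm p x" if x: "x \<in> lp p" for x n
    using lp_series[of "\<lambda>k. (S ^^ k) x" "\<lambda>k. ?q ^ k * lp_norm p x"] pw[OF x] geo
    by (auto simp: G_def on_lp_def x Gn)
  have E: "G x - Gn n x \<in> lp p" if "x \<in> lp p" for x n
    using Glp[OF that] bdd_ops_lp'[OF LP_bdd[OF Gn_LP]] by (rule lp_diff)
  have small: "y = 0" if "y \<in> lp p" "\<And>n. lp_norm p y \<le> R n * c" for y :: "('n, 'x) seqs" and c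
  proof -
    have "lp_norm p y \<le> 0"
      using tendsto_mult_left_zero[OF Rlim, of c] that(2) by (intro LIMSEQ_le_const) auto
    then show ?thesis using lp_norm_nonneg[OF that(1)] lp_norm_eq_0[OF that(1)] by simp
  qed
  have coord: "summable (\<lambda>k. (S ^^ k) x i)" if "x \<in> lp p" for x i
  proof (rule summable_comparison_test'[OF geo(1)[of "lp_norm p x"], of 0])
    show "norm ((S ^^ k) x i) \<le> ?q ^ k * lp_norm p x" for k
      using norm_le_lp_norm[OF pw(1)[OF that]] pw(2)[OF that] by (rule order_trans)
  qed
  have Gb: "G \<in> bdd_ops p"
  proof (rule bdd_opsI)
    fix x y :: "('n, 'x) seqs" and c
    show "x \<notin> lp p \<Longrightarrow> G x = 0" by (simp add: G_def on_lp_def)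
    show "x \<in> lp p \<Longrightarrow> G x \<in> lp p" by (rule Glp)
    show "x \<in> lp p \<Longrightarrow> lp_norm p (G x) \<le> R 0 * lp_norm p x" using GGn[of x 0] by (simp add: Gn)
    show "G (x + y) = G x + G y" if x: "x \<in> lp p" and y: "y \<in> lp p"
    proof -
      have "(S ^^ k) (x + y) = (S ^^ k) x + (S ^^ k) y" for k
        by (induction k) (simp_all only: funpow.simps id_apply comp_apply bdd_ops_add[OF Sb pw(1)[OF x] pw(1)[OF y]])
      then show ?thesis
        using suminf_add[OF coord[OF x] coord[OF y]] x y lp_add(1)[OF x y]
        by (auto simp: G_def on_lp_def fun_eq_iff)
    qed
    show "G (\<lambda>i. c *\<^sub>C x i) = (\<lambda>i. c *\<^sub>C G x i)" if x: "x \<in> lp p"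
    proof -
      have "(S ^^ k) (\<lambda>i. c *\<^sub>C x i) = (\<lambda>i. c *\<^sub>C (S ^^ k) x i)" for k
        by (induction k) (simp_all add: bdd_ops_scaleC[OF Sb pw(1)[OF x]])
      then show ?thesis
        using bounded_linear.suminf[OF bounded_linear_scaleC coord[OF x]] x lp_scaleC(1)[OF x]
        by (auto simp: G_def on_lp_def fun_eq_iff)
    qed
  qed
  have GLP: "G \<in> LP p"
  proof (rule LP_closed[OF Gb])
    fix e :: real assume "e > 0"
    then obtain n where "R n < e"
      using Rlim by (metis (no_types, lifting) eventually_happens' order_tendstoD(2) sequentially_bot)
    moreover have "op_norm p (G - Gn n) \<le> R n" using GGn R0 by (intro op_norm_le) auto
    ultimately show "\<exists>B\<in>LP p. op_norm p (G - B) \<le> e" using Gn_LP by (intro bexI[of _ "Gn n"]) auto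
  qed
  have right: "G x - S (G x) = x" if x: "x \<in> lp p" for x
  proof -
    have "G x - S (G x) - x = 0"
    proof (rule small)
      show "G x - S (G x) - x \<in> lp p" using x Glp bdd_ops_lp'[OF Sb] by (intro lp_diff) auto
      fix n
      note gn = bdd_ops_lp'[OF LP_bdd[OF Gn_LP], of n x]
      have tel: "S (Gn n x) = Gn (Suc n) x - x"
      proof (induction n)
        case 0
        then show ?case using x bdd_ops_0[OF Sb] by (simp add: Gn)
      next
        case (Suc n)
        have "Gn (Suc n) x = Gn n x + (S ^^ n) x" using x by (simp add: Gn)
        then have "S (Gn (Suc n) x) = S (Gn n x) + (S ^^ Suc n) x"
          using bdd_ops_add[OF Sb bdd_ops_lp'[OF LP_bdd[OF Gn_LP]] pw(1)[OF x]] by simp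
        moreover have "Gn (Suc (Suc n)) x = Gn (Suc n) x + (S ^^ Suc n) x" using x by (simp add: Gn)
        ultimately show ?case unfolding Suc by (simp only: diff_add_eq)
      qed
      have split: "G x - S (G x) - x = (G x - Gn (Suc n) x) - S (G x - Gn n x)"
        unfolding bdd_ops_diff[OF Sb Glp[OF x] gn] tel by simp
      have "lp_norm p ((G x - Gn (Suc n) x) - S (G x - Gn n x)) \<le> R (Suc n) * lp_norm p x + ?q * (R n * lp_norm p x)"
        by (intro lp_norm_diff_le op_norm_bound'[OF Sb] bdd_ops_lp'[OF Sb] E GGn x order_refl)
      moreover have "R (Suc n) = ?q * R n" by (simp add: R_def)
      ultimately show "lp_norm p (G x - S (G x) - x) \<le> R n * (2 * ?q * lp_norm p x)"
        unfolding split by (simp add: mult_ac)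
    qed
    then show ?thesis by simp
  qed
  have IS: "id_op p - S \<in> bdd_ops p" using Sb by (intro bdd_ops_minus) auto
  have r: "(id_op p - S) \<circ> G = id_op p"
  proof
    fix x show "((id_op p - S) \<circ> G) x = id_op p x"
    proof (cases "x \<in> lp p")
      case True
      then show ?thesis using right[OF True] Glp by (simp add: id_op_apply)
    next
      case False
      then show ?thesis using bdd_ops_outside[OF bdd_ops_comp(1)[OF IS Gb]] bdd_ops_outside[OF id_op_bdd] by metis
    qed
  qed
  have inj: "y = 0" if y: "y \<in> lp p" "(id_op p - S) y = 0" for y
  proof -
    have "S y = y" using y by (simp add: id_op_apply)
    then have "lp_norm p y \<le> ?q * lp_norm p y" using op_norm_bound[OF Sb y(1)] by simp
    then have "lp_norm p y = 0"
      using mult_strict_right_mono[OF q, of "lp_norm p y"] lp_norm_nonneg[OF y(1)] by linarith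
    then show ?thesis using lp_norm_eq_0 y by blast
  qed
  have l: "G \<circ> (id_op p - S) = id_op p"
  proof
    fix x show "(G \<circ> (id_op p - S)) x = id_op p x"
    proof (cases "x \<in> lp p")
      case True
      let ?y = "(id_op p - S) x"
      have "?y \<in> lp p" by (rule bdd_ops_lp'[OF IS])
      then have "(id_op p - S) (G ?y) = ?y" using right Glp by (simp add: id_op_apply)
      then have "(id_op p - S) (G ?y - x) = 0"
        using bdd_ops_diff[OF IS bdd_ops_lp'[OF Gb] True] by simp
      then show ?thesis using inj[of "G ?y - x"] bdd_ops_lp'[OF Gb] True
        by (simp add: id_op_apply lp_diff del: minus_apply)
    next
      case False
      then show ?thesis using bdd_ops_outside[OF bdd_ops_comp(1)[OF Gb IS]] bdd_ops_outside[OF id_op_bdd] by metis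
    qed
  qed
  show ?thesis using GLP r l by blast
qed

end

section \<open>Norming functionals\<close>

text \<open>The Hahn--Banach theorem is obtained here from the fact that a minimal sublinear functional
  is linear. Tilting a sublinear functional \<open>g\<close> along \<open>y\<close> yields a sublinear functional below
  \<open>g\<close>, and if tilting along every \<open>y\<close> changes nothing, then \<open>g\<close> is additive. A first tilt along
  the given point \<open>u\<close> makes every linear functional below take the prescribed value at \<open>u\<close>.\<close>

locale real_scaling = vector_space s for s :: "real \<Rightarrow> 'v::ab_group_add \<Rightarrow> 'v"
begin

definition sublinear :: "('v \<Rightarrow> real) \<Rightarrow> bool" where
  "sublinear g \<longleftrightarrow> (\<forall>x y. g (x + y) \<le> g x + g y) \<and> (\<forall>t\<ge>0. \<forall>x. g (s t x) \<le> t * g x)"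

definition tilt :: "('v \<Rightarrow> real) \<Rightarrow> 'v \<Rightarrow> 'v \<Rightarrow> real" where
  "tilt g y x = (INF t\<in>{0..}. g (x + s t y) - t * g y)"

lemma sublinear_add: "sublinear g \<Longrightarrow> g (x + y) \<le> g x + g y"
  by (simp add: sublinear_def)

lemma sublinear_0: "sublinear g \<Longrightarrow> g 0 = 0"
  using sublinear_add[of g 0 0] unfolding sublinear_def
  by (metis add_0_right add_cancel_right_right antisym le_add_same_cancel1 mult_zero_left order_refl scale_zero_left)

lemma sublinear_scale:
  assumes "sublinear g" "t \<ge> 0" shows "g (s t x) = t * g x"
proof (cases "t = 0")
  case False
  have h: "g (s c y) \<le> c * g y" if "c \<ge> 0" for c y
    using assms(1) that by (simp add: sublinear_def)
  have "g (s (1 / t) (s t x)) \<le> 1 / t * g (s t x)" "g (s t x) \<le> t * g x"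
    using assms(2) by (intro h; simp)+
  then show ?thesis using False assms by (simp add: field_simps)
qed (simp add: sublinear_0[OF assms(1)])

lemma sublinear_minus: "sublinear g \<Longrightarrow> - g (- x) \<le> g x"
  using sublinear_add[of g x "- x"] sublinear_0[of g] by simp

lemma tilt_bdd_below:
  assumes "sublinear g" shows "bdd_below ((\<lambda>t. g (x + s t y) - t * g y) ` {0..})"
proof (rule bdd_belowI2)
  fix t :: real assume "t \<in> {0..}"
  then have "t * g y = g (s t y)" using sublinear_scale[OF assms] by simp
  also have "\<dots> \<le> g (x + s t y) + g (- x)"
    using sublinear_add[OF assms, of "x + s t y" "- x"] by simp
  finally show "- g (- x) \<le> g (x + s t y) - t * g y" by simp
qed

lemma tilt_le:
  assumes "sublinear g" "t \<ge> 0" shows "tilt g y x \<le> g (x + s t y) - t * g y"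
  unfolding tilt_def using assms by (intro cINF_lower tilt_bdd_below) auto

lemma sublinear_tilt:
  assumes g: "sublinear g" shows "sublinear (tilt g y)"
  unfolding sublinear_def
proof (intro conjI allI impI)
  fix x x'
  have *: "tilt g y (x + x') \<le> (g (x + s t y) - t * g y) + (g (x' + s t' y) - t' * g y)"
    if "t \<ge> 0" "t' \<ge> 0" for t t'
  proof -
    have "tilt g y (x + x') \<le> g (x + x' + s (t + t') y) - (t + t') * g y"
      using tilt_le[OF g] that by simp
    also have "g (x + x' + s (t + t') y) \<le> g (x + s t y) + g (x' + s t' y)"
      using sublinear_add[OF g, of "x + s t y" "x' + s t' y"] by (simp add: scale_left_distrib algebra_simps)
    finally show ?thesis by (simp add: algebra_simps)
  qed
  have "tilt g y (x + x') - (g (x + s t y) - t * g y) \<le> tilt g y x'" if "t \<ge> 0" for t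
    unfolding tilt_def[of g y x'] using *[OF that] by (intro cINF_greatest) (auto simp: algebra_simps)
  then have "tilt g y (x + x') - tilt g y x' \<le> tilt g y x"
    unfolding tilt_def[of g y x] by (intro cINF_greatest) (auto simp: algebra_simps)
  then show "tilt g y (x + x') \<le> tilt g y x + tilt g y x'" by simp
next
  fix c :: real and x assume c: "c \<ge> 0"
  show "tilt g y (s c x) \<le> c * tilt g y x"
  proof (cases "c = 0")
    case True
    then show ?thesis using tilt_le[OF g, of 0 y 0] sublinear_0[OF g] by simp
  next
    case False
    with c have c: "c > 0" by simp
    have "tilt g y (s c x) / c \<le> g (x + s t y) - t * g y" if "t \<ge> 0" for t
    proof -
      have "tilt g y (s c x) \<le> g (s c x + s (c * t) y) - (c * t) * g y"
        using c that by (intro tilt_le g) simp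
      also have "s c x + s (c * t) y = s c (x + s t y)" by (simp add: scale_right_distrib)
      also have "g (s c (x + s t y)) = c * g (x + s t y)" using c by (intro sublinear_scale g) simp
      finally show ?thesis using c by (simp add: field_simps)
    qed
    then have "tilt g y (s c x) / c \<le> tilt g y x"
      unfolding tilt_def[of g y x] by (intro cINF_greatest) auto
    then show ?thesis using c by (simp add: field_simps)
  qed
qed

lemma tilt_le_self: "sublinear g \<Longrightarrow> tilt g y x \<le> g x"
  using tilt_le[of g 0 y x] by simp

text \<open>In a chain, any two functionals have a common lower bound in the chain, namely the smaller
  one; this makes the pointwise infimum subadditive. It is finite because \<open>g x \<ge> - g (- x) \<ge> - q (- x)\<close>.\<close>

lemma sublinear_INF_chain:
  assumes C: "C \<noteq> {}" "\<And>g. g \<in> C \<Longrightarrow> sublinear g \<and> g \<le> q"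
    and chain: "\<And>g h. g \<in> C \<Longrightarrow> h \<in> C \<Longrightarrow> g \<le> h \<or> h \<le> g"
  defines "u \<equiv> \<lambda>x. INF g\<in>C. g x"
  shows "sublinear u" "\<And>g. g \<in> C \<Longrightarrow> u \<le> g"
proof -
  have bdd: "bdd_below ((\<lambda>g. g x) ` C)" for x
  proof (rule bdd_belowI2)
    fix g assume "g \<in> C"
    then have "- g (- x) \<le> g x" "g (- x) \<le> q (- x)" using C(2) sublinear_minus by (auto simp: le_fun_def)
    then show "- q (- x) \<le> g x" by linarith
  qed
  have le: "u x \<le> g x" if "g \<in> C" for g x unfolding u_def using that by (intro cINF_lower bdd)
  then show "\<And>g. g \<in> C \<Longrightarrow> u \<le> g" by (simp add: le_fun_def)
  show "sublinear u" unfolding sublinear_def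
  proof (intro conjI allI impI)
    fix x y
    have *: "u (x + y) \<le> g x + h y" if gh: "g \<in> C" "h \<in> C" for g h
    proof -
      obtain k where k: "k \<in> C" "k \<le> g" "k \<le> h" using chain[OF gh] gh by blast
      have "u (x + y) \<le> k x + k y"
        using le[OF k(1), of "x + y"] sublinear_add[of k x y] C(2)[OF k(1)] by simp
      also have "\<dots> \<le> g x + h y" using k(2,3) by (intro add_mono) (auto simp: le_fun_def)
      finally show ?thesis .
    qed
    have "u (x + y) - g x \<le> u y" if "g \<in> C" for g
      unfolding u_def[of ] using *[OF that] C(1)
      by (intro cINF_greatest) (auto simp: algebra_simps u_def)
    then have "u (x + y) - u y \<le> u x"
      unfolding u_def[of ] using C(1) by (intro cINF_greatest) (auto simp: algebra_simps u_def)
    then show "u (x + y) \<le> u x + u y" by simp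
  next
    fix t :: real and x assume t: "t \<ge> 0"
    have *: "u (s t x) \<le> t * g x" if "g \<in> C" for g
      using le[OF that, of "s t x"] C(2)[OF that] t by (auto simp: sublinear_scale)
    show "u (s t x) \<le> t * u x"
    proof (cases "t = 0")
      case True
      then show ?thesis using * C(1) by auto
    next
      case False
      then have "u (s t x) / t \<le> u x"
        unfolding u_def[of ] using C(1) * t by (intro cINF_greatest) (auto simp: field_simps u_def)
      then show ?thesis using False t by (simp add: field_simps)
    qed
  qed
qed

lemma real_norming_functional:
  assumes q: "sublinear q"
  obtains g where "\<And>x y. g (x + y) = g x + g y" "\<And>t x. g (s t x) = t * g x"
    "\<And>x. g x \<le> q x" "g u = q u"
proof -
  let ?q = "tilt q u"
  let ?A = "{g. sublinear g \<and> g \<le> ?q}"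
  have "\<exists>m\<in>?A. \<forall>a\<in>?A. a \<le> m \<longrightarrow> a = m"
  proof (rule predicate_Zorn)
    show "partial_order_on ?A (relation_of (\<lambda>x y. y \<le> x) ?A)"
      by (rule partial_order_on_relation_ofI) (auto intro: order_trans antisym)
    fix C assume C: "C \<in> Chains (relation_of (\<lambda>x y. y \<le> x) ?A)"
    then have CA: "C \<subseteq> ?A" and ch: "\<And>g h. g \<in> C \<Longrightarrow> h \<in> C \<Longrightarrow> g \<le> h \<or> h \<le> g"
      by (auto simp: Chains_def relation_of_def)
    show "\<exists>u\<in>?A. \<forall>a\<in>C. u \<le> a"
    proof (cases "C = {}")
      case True
      then show ?thesis using sublinear_tilt[OF q] by blast
    next
      case False
      have "sublinear (\<lambda>x. INF g\<in>C. g x)" "\<And>g. g \<in> C \<Longrightarrow> (\<lambda>x. INF g\<in>C. g x) \<le> g"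
        using sublinear_INF_chain[OF False, of ?q] CA ch by blast+
      then show ?thesis using False CA by (intro bexI[of _ "\<lambda>x. INF g\<in>C. g x"]) (auto intro: order_trans)
    qed
  qed
  then obtain g where g: "sublinear g" "g \<le> ?q" and min: "\<And>a. sublinear a \<Longrightarrow> a \<le> ?q \<Longrightarrow> a \<le> g \<Longrightarrow> a = g"
    by blast
  have tilt: "tilt g y = g" for y
  proof (rule min)
    show "sublinear (tilt g y)" by (rule sublinear_tilt[OF g(1)])
    show "tilt g y \<le> g" using tilt_le_self[OF g(1)] by (simp add: le_fun_def)
    with g(2) show "tilt g y \<le> ?q" by order
  qed
  have add: "g (x + y) = g x + g y" for x y
    using sublinear_add[OF g(1), of x y] tilt_le[OF g(1), of 1 y x] by (simp add: tilt)
  have neg: "g (- x) = - g x" for x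
    using add[of x "- x"] sublinear_0[OF g(1)] by simp
  have scale: "g (s t x) = t * g x" for t x
  proof (cases "t \<ge> 0")
    case False
    then have "g (s (- t) x) = - t * g x" using sublinear_scale[OF g(1), of "- t" x] by simp
    then show ?thesis by (simp add: neg)
  qed (simp add: sublinear_scale[OF g(1)])
  have le: "g x \<le> q x" for x
    using g(2) tilt_le_self[OF q, of u x] by (auto simp: le_fun_def intro: order_trans)
  have "g (- u) \<le> - q u"
    using g(2) tilt_le[OF q, of 1 u "- u"] sublinear_0[OF q] by (auto simp: le_fun_def intro: order_trans)
  then have "g u = q u" using le[of u] by (simp add: neg)
  then show ?thesis using that add scale le by blast
qed

end

text \<open>The complex functional with real part \<open>g\<close>. Rotating \<open>x\<close> so that its value becomes
  nonnegative turns the bound on the real part into a bound on the modulus.\<close>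

lemma norming_functional:
  fixes s :: "complex \<Rightarrow> 'v::ab_group_add \<Rightarrow> 'v" and q :: "'v \<Rightarrow> real"
  assumes "vector_space s"
    and q: "\<And>x y. q (x + y) \<le> q x + q y" "\<And>c x. q (s c x) = cmod c * q x"
  obtains f :: "'v \<Rightarrow> complex" where "\<And>x y. f (x + y) = f x + f y" "\<And>c x. f (s c x) = c * f x"
    "\<And>x. cmod (f x) \<le> q x" "f u = complex_of_real (q u)"
proof -
  interpret V: vector_space s by fact
  interpret R: real_scaling "\<lambda>t. s (complex_of_real t)"
    by unfold_locales (simp_all add: V.scale_right_distrib V.scale_left_distrib)
  have "R.sublinear q" unfolding R.sublinear_def using q by simp
  then obtain g where g: "\<And>x y. g (x + y) = g x + g y" "\<And>t x. g (s (complex_of_real t) x) = t * g x"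
    "\<And>x. g x \<le> q x" "g u = q u" by (rule R.real_norming_functional[where u=u]) blast
  define f where "f x = Complex (g x) (- g (s \<i> x))" for x
  have add: "f (x + y) = f x + f y" for x y
    by (simp add: f_def V.scale_right_distrib g(1) complex_eq_iff)
  have neg: "g (- x) = - g x" for x
    using g(2)[of "- 1" x] by simp
  have scale: "f (s c x) = c * f x" for c x
  proof -
    have "s c x = s (complex_of_real (Re c)) x + s (complex_of_real (Im c)) (s \<i> x)"
      by (subst complex_eq) (simp add: V.scale_left_distrib mult.commute)
    then have 1: "g (s c x) = Re c * g x + Im c * g (s \<i> x)" by (simp only: g(1,2))
    have "s \<i> (s c x) = s (complex_of_real (Re c)) (s \<i> x) + s (complex_of_real (Im c)) (- x)"
      by (subst complex_eq) (simp add: V.scale_left_distrib V.scale_right_distrib algebra_simps)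
    then have 2: "g (s \<i> (s c x)) = Re c * g (s \<i> x) - Im c * g x"
      by (simp only: g(1,2) neg mult_minus_right add_uminus_conv_diff)
    show ?thesis using 1 2 by (simp add: f_def complex_eq_iff)
  qed
  have bound: "cmod (f x) \<le> q x" for x
  proof (cases "f x = 0")
    case True
    then have "g x = 0" by (simp add: f_def complex_eq_iff)
    then show ?thesis using True g(3)[of x] by simp
  next
    case False
    define c where "c = complex_of_real (cmod (f x)) / f x"
    have c: "cmod c = 1" "c * f x = complex_of_real (cmod (f x))" using False by (auto simp: c_def norm_divide)
    have "cmod (f x) = Re (f (s c x))" using c by (simp add: scale)
    also have "\<dots> = g (s c x)" by (simp add: f_def)
    also have "\<dots> \<le> q x" using g(3)[of "s c x"] q(2)[of c x] c by simp
    finally show ?thesis .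
  qed
  have "f u = complex_of_real (q u)"
  proof -
    have re: "Re (f u) = q u" by (simp add: f_def g(4))
    have "(Re (f u))\<^sup>2 + (Im (f u))\<^sup>2 \<le> (q u)\<^sup>2"
      using bound[of u] by (metis cmod_power2 norm_ge_zero power_mono)
    then have "Im (f u) = 0" using re by simp
    then show ?thesis using re by (simp add: complex_eq_iff)
  qed
  then show ?thesis using that add scale bound by blast
qed

section \<open>Invertibility modulo \<open>\<K>(X,P)\<close>\<close>

lemma LP_ring_simps [simp]:
  "carrier (LP_ring p) = LP p" "mult (LP_ring p) A B = A \<circ> B" "one (LP_ring p) = id_op p"
  "zero (LP_ring p) = 0" "add (LP_ring p) A B = A + B"
  by (auto simp: LP_ring_def)

context lp_exponent
begin

lemma ring_LP_ring: "ring (LP_ring p :: ('n::finite, 'x::complex_banach) oper ring)"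
proof (rule ringI)
  let ?R = "LP_ring p :: ('n, 'x) oper ring"
  show "abelian_group ?R"
  proof (rule abelian_groupI)
    fix A :: "('n, 'x) oper" assume "A \<in> carrier ?R"
    then show "\<exists>B\<in>carrier ?R. B \<oplus>\<^bsub>?R\<^esub> A = \<zero>\<^bsub>?R\<^esub>"
      by (intro bexI[of _ "- A"]) (auto simp: LP_neg)
  qed (auto simp: LP_plus add_ac)
  show "Group.monoid ?R"
    by (rule monoidI) (auto simp: LP_comp comp_assoc LP_bdd)
  fix A B C :: "('n, 'x) oper"
  assume "A \<in> carrier ?R" "B \<in> carrier ?R" "C \<in> carrier ?R"
  then show "(A \<oplus>\<^bsub>?R\<^esub> B) \<otimes>\<^bsub>?R\<^esub> C = A \<otimes>\<^bsub>?R\<^esub> C \<oplus>\<^bsub>?R\<^esub> B \<otimes>\<^bsub>?R\<^esub> C"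
    "C \<otimes>\<^bsub>?R\<^esub> (A \<oplus>\<^bsub>?R\<^esub> B) = C \<otimes>\<^bsub>?R\<^esub> A \<oplus>\<^bsub>?R\<^esub> C \<otimes>\<^bsub>?R\<^esub> B"
    by (simp_all add: comp_plus_left comp_plus_right LP_bdd)
qed

lemma ideal_KP: "ideal (KP p) (LP_ring p :: ('n::finite, 'x::complex_banach) oper ring)"
proof (rule idealI[OF ring_LP_ring])
  let ?R = "LP_ring p :: ('n, 'x) oper ring"
  interpret R: ring ?R by (rule ring_LP_ring)
  show "subgroup (KP p) (add_monoid ?R)"
  proof
    fix K :: "('n, 'x) oper" assume K: "K \<in> KP p"
    have "inv\<^bsub>add_monoid ?R\<^esub> K = - K"
      using R.minus_equality[of "- K" K] K by (simp add: KP_LP LP_neg a_inv_def)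
    then show "inv\<^bsub>add_monoid ?R\<^esub> K \<in> KP p" using K by (simp add: KP_neg)
  qed (auto simp: KP_LP KP_plus)
qed (auto simp: LP_comp_KP KP_comp_LP)

lemma mem_coset: "B \<in> coset p A \<longleftrightarrow> B - A \<in> KP p"
proof
  assume "B - A \<in> KP p"
  then show "B \<in> coset p A" by (auto simp: coset_def a_r_coset_def' intro!: bexI[of _ "B - A"])
qed (auto simp: coset_def a_r_coset_def')

lemma coset_eq_iff: "coset p A = coset p B \<longleftrightarrow> A - B \<in> KP p"
proof
  have "A \<in> coset p A" by (simp add: mem_coset)
  moreover assume "coset p A = coset p B"
  ultimately show "A - B \<in> KP p" by (simp add: mem_coset)
next
  assume K: "A - B \<in> KP p"
  have "C - A \<in> KP p \<longleftrightarrow> C - B \<in> KP p" for C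
    using KP_plus[OF _ K, of "C - A"] KP_minus[OF _ K, of "C - B"] by auto
  then show "coset p A = coset p B" by (auto simp: mem_coset)
qed

lemma LP_mod_KP_simps:
  "carrier (LP_mod_KP p) = coset p ` LP p" "one (LP_mod_KP p) = coset p (id_op p)"
  by (auto simp: LP_mod_KP_def FactRing_def A_RCOSETS_def' coset_def)

lemma coset_mult:
  assumes "A \<in> LP p" "B \<in> LP p"
  shows "mult (LP_mod_KP p) (coset p A) (coset p B) = coset p (A \<circ> B)"
  using ideal.rcoset_mult_add[OF ideal_KP, of A B] assms
  by (simp add: LP_mod_KP_def FactRing_def coset_def)

lemma monoid_LP_mod_KP: "Group.monoid (LP_mod_KP p :: ('n::finite, 'x::complex_banach) oper set ring)"
  unfolding LP_mod_KP_def using ideal.quotient_is_ring[OF ideal_KP] ring.is_monoid by blast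

lemma coset_UnitsI:
  assumes "B \<in> LP p" "C \<in> LP p" "(B \<circ> C) - id_op p \<in> KP p" "(C \<circ> B) - id_op p \<in> KP p"
  shows "coset p B \<in> Units (LP_mod_KP p)"
  using assms unfolding Units_def
  by (auto simp: LP_mod_KP_simps coset_mult coset_eq_iff intro!: bexI[of _ C])

lemma coset_UnitsE:
  assumes "coset p B \<in> Units (LP_mod_KP p)" "B \<in> LP p"
  obtains C where "C \<in> LP p" "inv\<^bsub>LP_mod_KP p\<^esub> (coset p B) = coset p C"
    "(B \<circ> C) - id_op p \<in> KP p" "(C \<circ> B) - id_op p \<in> KP p"
proof -
  note M = monoid_LP_mod_KP
  have "inv\<^bsub>LP_mod_KP p\<^esub> (coset p B) \<in> carrier (LP_mod_KP p)"
    by (rule monoid.Units_inv_closed[OF M assms(1)])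
  then obtain C where C: "C \<in> LP p" "inv\<^bsub>LP_mod_KP p\<^esub> (coset p B) = coset p C"
    by (auto simp: LP_mod_KP_simps)
  have "coset p (B \<circ> C) = coset p (id_op p)" "coset p (C \<circ> B) = coset p (id_op p)"
    using monoid.Units_r_inv[OF M assms(1)] monoid.Units_l_inv[OF M assms(1)] C assms(2)
    by (simp_all add: coset_mult LP_mod_KP_simps)
  then show ?thesis using that C by (simp add: coset_eq_iff)
qed

lemma quot_norm_coset_le:
  assumes "C \<in> LP p" "D \<in> coset p C" shows "quot_norm p (coset p C) \<le> op_norm p D"
  unfolding quot_norm_def
proof (rule cINF_lower[OF _ assms(2)])
  have "0 \<le> op_norm p B" if "B \<in> coset p C" for B
  proof -
    have "(B - C) + C \<in> LP p" using LP_plus[OF KP_LP assms(1), of "B - C"] that by (simp add: mem_coset)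
    then show ?thesis by (intro op_norm_nonneg LP_bdd) simp
  qed
  then show "bdd_below (op_norm p ` coset p C)" by (rule bdd_belowI2)
qed

text \<open>With a representative \<open>C\<close> of the inverse of the coset of \<open>B\<close> that satisfies
  \<open>\<parallel>C\<parallel> \<parallel>T\<parallel> < 1\<close>, the operator \<open>B + T\<close> agrees modulo \<open>\<K>(X,P)\<close> with the product
  \<open>B (I + C T)\<close>, whose second factor is invertible.\<close>

lemma small_perturbation_invertible:
  fixes B :: "('n::finite, 'x::complex_banach) oper"
  assumes B: "B \<in> LP p" "coset p B \<in> Units (LP_mod_KP p)"
    and n: "quot_norm p (inv\<^bsub>LP_mod_KP p\<^esub> (coset p B)) \<le> 1 / \<epsilon>" and \<epsilon>: "\<epsilon> > 0"
    and T: "T \<in> LP p" "op_norm p T < \<epsilon>"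
  shows "coset p (B + T) \<in> Units (LP_mod_KP p)"
proof -
  note bnd = LP_bdd[OF B(1)] LP_bdd[OF T(1)]
  obtain C where C: "C \<in> LP p" "inv\<^bsub>LP_mod_KP p\<^esub> (coset p B) = coset p C" "(B \<circ> C) - id_op p \<in> KP p"
    by (rule coset_UnitsE[OF B(2,1)])
  have T0: "op_norm p T \<ge> 0" by (rule op_norm_nonneg[OF bnd(2)])
  have "\<exists>D\<in>coset p C. op_norm p D * op_norm p T < 1"
  proof (cases "op_norm p T = 0")
    case True
    then show ?thesis by (intro bexI[of _ C]) (auto simp: mem_coset)
  next
    case False
    then have "1 / \<epsilon> < 1 / op_norm p T" using T T0 by (intro divide_strict_left_mono) auto
    then have "(INF D\<in>coset p C. op_norm p D) < 1 / op_norm p T"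
      using n unfolding C(2) quot_norm_def by simp
    moreover have "coset p C \<noteq> {}" using mem_coset[of C C] by auto
    ultimately obtain D where "D \<in> coset p C" "op_norm p D < 1 / op_norm p T"
      using cInf_lessD[of "op_norm p ` coset p C"] by auto
    then show ?thesis using False T0 by (intro bexI[of _ D]) (auto simp: field_simps)
  qed
  then obtain D where D: "D - C \<in> KP p" "op_norm p D * op_norm p T < 1" by (auto simp: mem_coset)
  have DL: "D \<in> LP p" using LP_plus[OF KP_LP[OF D(1)] C(1)] by simp
  note Db = LP_bdd[OF DL]
  define S where "S = - (D \<circ> T)"
  have SL: "S \<in> LP p" unfolding S_def by (intro LP_neg LP_comp DL T(1))
  have "op_norm p S < 1"
    unfolding S_def bdd_ops_neg(2)[OF bdd_ops_comp(1)[OF Db bnd(2)]]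
    using bdd_ops_comp(2)[OF Db bnd(2)] D(2) by simp
  then obtain G where G: "G \<in> LP p" "(id_op p - S) \<circ> G = id_op p" "G \<circ> (id_op p - S) = id_op p"
    using Neumann_series[OF SL] by blast
  have IL: "id_op p - S \<in> LP p" by (intro LP_minus id_op_LP SL)
  have "coset p (id_op p - S) \<in> Units (LP_mod_KP p)"
    using coset_UnitsI[OF IL G(1)] G(2,3) by simp
  then have "mult (LP_mod_KP p) (coset p B) (coset p (id_op p - S)) \<in> Units (LP_mod_KP p)"
    using B(2) monoid.Units_m_closed[OF monoid_LP_mod_KP] by blast
  moreover have "coset p (B \<circ> (id_op p - S)) = coset p (B + T)"
    unfolding coset_eq_iff
  proof -
    have BD: "(B \<circ> D) - id_op p \<in> KP p"
    proof -
      have eq: "(B \<circ> D) - id_op p = ((B \<circ> C) - id_op p) + (B \<circ> (D - C))"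
        unfolding comp_minus_right[OF bnd(1) Db LP_bdd[OF C(1)]] by simp
      show ?thesis unfolding eq by (rule KP_plus[OF C(3) LP_comp_KP[OF B(1) D(1)]])
    qed
    have DTb: "D \<circ> T \<in> bdd_ops p" using Db bnd(2) by (rule bdd_ops_comp)
    have "B \<circ> (id_op p - S) = B + (B \<circ> (D \<circ> T))"
      unfolding S_def using comp_plus_right[OF bnd(1) id_op_bdd DTb] bnd(1) by simp
    moreover have "((B \<circ> D) - id_op p) \<circ> T = (B \<circ> (D \<circ> T)) - T"
      using comp_minus_left[of "B \<circ> D" "id_op p" T] bnd(2) by (simp add: comp_assoc)
    ultimately have "(B \<circ> (id_op p - S)) - (B + T) = ((B \<circ> D) - id_op p) \<circ> T" by simp
    then show "(B \<circ> (id_op p - S)) - (B + T) \<in> KP p" using KP_comp_LP[OF T(1) BD] by simp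
  qed
  ultimately show ?thesis by (simp add: coset_mult[OF B(1) IL])
qed

text \<open>A large inverse in the quotient makes \<open>B\<close> small on sequences arbitrarily far out. For a
  representative \<open>C\<close> of the inverse, \<open>C Q\<^sub>n\<close> represents it too, so it has a large norm for every
  \<open>n\<close>. It sends some \<open>x\<close> far out to a much larger \<open>C x\<close>, which \<open>B\<close> sends back to \<open>x\<close> up to a
  small error; and \<open>C x\<close> is essentially far out, because \<open>P\<^sub>m C\<close> belongs to \<open>\<K>(X,P)\<close>.\<close>

lemma almost_kernel_at_infinity:
  fixes B :: "('n::finite, 'x::complex_banach) oper"
  assumes B: "B \<in> LP p" "coset p B \<in> Units (LP_mod_KP p)"
    and n: "1 / \<epsilon> < quot_norm p (inv\<^bsub>LP_mod_KP p\<^esub> (coset p B))" and \<epsilon>: "\<epsilon> > 0"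
  obtains \<epsilon>' where "0 < \<epsilon>'" "\<epsilon>' < \<epsilon>"
    "\<And>m. \<exists>z\<in>lp p. restr (- cube m) z = z \<and> lp_norm p (B z) < \<epsilon>' * lp_norm p z"
proof -
  note Bb = LP_bdd[OF B(1)]
  obtain C where C: "C \<in> LP p" "inv\<^bsub>LP_mod_KP p\<^esub> (coset p B) = coset p C" "(B \<circ> C) - id_op p \<in> KP p"
    by (rule coset_UnitsE[OF B(2,1)])
  note Cb = LP_bdd[OF C(1)]
  obtain \<rho> where \<rho>: "1 / \<epsilon> < \<rho>" "\<rho> < quot_norm p (coset p C)" using dense[OF n] C(2) by auto
  have \<rho>0: "\<rho> > 0" using \<rho>(1) \<epsilon> by (meson divide_pos_pos less_trans zero_less_one)
  have "1 / \<rho> < \<epsilon>" using \<rho>(1) \<rho>0 \<epsilon> by (simp add: field_simps)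
  then obtain \<epsilon>' where \<epsilon>': "1 / \<rho> < \<epsilon>'" "\<epsilon>' < \<epsilon>" using dense by blast
  have \<epsilon>'0: "\<epsilon>' > 0" using \<epsilon>'(1) \<rho>0 by (meson divide_pos_pos less_trans zero_less_one)
  have \<epsilon>'\<rho>: "\<epsilon>' * \<rho> > 1" using \<epsilon>' \<rho>0 by (simp add: field_simps)
  define b where "b = op_norm p B"
  have b0: "b \<ge> 0" unfolding b_def by (rule op_norm_nonneg[OF Bb])
  \<comment> \<open>The tolerance is chosen so that \<open>1 + \<delta> + b \<delta> < \<epsilon>' (\<rho> - \<delta>)\<close>.\<close>
  define \<delta> where "\<delta> = (\<epsilon>' * \<rho> - 1) / (2 * (1 + b + \<epsilon>'))"
  have \<delta>0: "\<delta> > 0" unfolding \<delta>_def using \<epsilon>'\<rho> b0 \<epsilon>'0 by (intro divide_pos_pos) auto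
  have "\<delta> * (2 * (1 + b + \<epsilon>')) = \<epsilon>' * \<rho> - 1" unfolding \<delta>_def using b0 \<epsilon>'0 by simp
  then have \<delta>: "1 + \<delta> + b * \<delta> < \<epsilon>' * (\<rho> - \<delta>)"
    using \<epsilon>'\<rho> by (simp add: algebra_simps)
  have ex: "\<exists>z\<in>lp p. restr (- cube m) z = z \<and> lp_norm p (B z) < \<epsilon>' * lp_norm p z" for m
  proof -
    define K where "K = (B \<circ> C) - id_op p"
    have K: "K \<in> KP p" unfolding K_def by (rule C(3))
    have PC: "P_op p m \<circ> C \<in> KP p" by (rule KP_comp_LP[OF C(1) P_op_KP])
    obtain k1 where k1: "\<And>n. n \<ge> k1 \<Longrightarrow> op_norm p (K \<circ> Q_op p n) \<le> \<delta>" by (rule KP_obtain[OF K \<delta>0]) blast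
    obtain k2 where k2: "\<And>n. n \<ge> k2 \<Longrightarrow> op_norm p ((P_op p m \<circ> C) \<circ> Q_op p n) \<le> \<delta>"
      by (rule KP_obtain[OF PC \<delta>0]) blast
    define k where "k = max k1 k2"
    have CQb: "C \<circ> Q_op p k \<in> bdd_ops p" using Cb by (intro bdd_ops_comp) auto
    have "C \<circ> P_op p k \<in> KP p" by (rule LP_comp_KP[OF C(1) P_op_KP])
    moreover have "(C \<circ> Q_op p k) - C = - (C \<circ> P_op p k)"
      unfolding Q_op_def comp_minus_right[OF Cb id_op_bdd P_op_bdd] using Cb by simp
    ultimately have "C \<circ> Q_op p k \<in> coset p C" by (simp add: mem_coset KP_neg)
    then have "\<rho> < op_norm p (C \<circ> Q_op p k)"
      using quot_norm_coset_le[OF C(1)] \<rho>(2) by fastforce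
    then obtain x0 where x0: "x0 \<in> lp p" "lp_norm p ((C \<circ> Q_op p k) x0) > \<rho> * lp_norm p x0"
      using op_norm_le[of \<rho> "C \<circ> Q_op p k"] \<rho>0 by (meson less_imp_le not_le)
    define x where "x = Q_op p k x0"
    have x: "x \<in> lp p" "Q_op p k x = x"
      using fun_cong[OF Q_op_Q_op(1)[OF order_refl, of k], of x0] bdd_ops_lp'[OF Q_op_bdd]
      by (auto simp: x_def)
    have "lp_norm p x \<le> lp_norm p x0" using x0(1) lp_restr(2)[OF x0(1)] by (simp add: x_def Q_op_apply)
    then have "\<rho> * lp_norm p x \<le> \<rho> * lp_norm p x0" using \<rho>0 by (intro mult_left_mono) auto
    then have Cx: "lp_norm p (C x) > \<rho> * lp_norm p x" using x0(2) unfolding x_def comp_apply by linarith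
    have x_pos: "lp_norm p x > 0"
    proof (rule ccontr)
      assume "\<not> lp_norm p x > 0"
      then have "lp_norm p x = 0" using lp_norm_nonneg[OF x(1)] by simp
      then show False using lp_norm_eq_0[OF x(1)] Cx bdd_ops_0[OF Cb] by simp
    qed
    define y where "y = C x"
    have y: "y \<in> lp p" unfolding y_def by (rule bdd_ops_lp'[OF Cb])
    have Py: "P_op p m y \<in> lp p" "lp_norm p (P_op p m y) \<le> \<delta> * lp_norm p x"
    proof -
      have "P_op p m y = ((P_op p m \<circ> C) \<circ> Q_op p k) x" by (simp add: y_def x(2))
      then show "lp_norm p (P_op p m y) \<le> \<delta> * lp_norm p x"
        using op_norm_bound'[OF bdd_ops_comp(1)[OF KP_bdd[OF PC] Q_op_bdd] x(1) k2[of k] order_refl]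
        by (simp add: k_def)
    qed (simp add: bdd_ops_lp'[OF P_op_bdd])
    have By: "lp_norm p (B y) \<le> lp_norm p x + \<delta> * lp_norm p x"
    proof -
      have "B y = x + (K \<circ> Q_op p k) x" by (simp add: K_def x y_def id_op_apply)
      then show ?thesis
        using x(1) op_norm_bound'[OF bdd_ops_comp(1)[OF KP_bdd[OF K] Q_op_bdd] x(1) k1[of k] order_refl]
        by (auto simp: k_def intro!: lp_norm_add_le bdd_ops_lp'[OF KP_bdd[OF K]] simp del: plus_fun_apply)
    qed
    define z where "z = y - P_op p m y"
    have z: "z \<in> lp p" unfolding z_def using y Py(1) by (rule lp_diff)
    have zr: "restr (- cube m) z = z"
      using y by (auto simp: z_def restr_def P_op_apply fun_eq_iff)
    have "lp_norm p (B z) \<le> (lp_norm p x + \<delta> * lp_norm p x) + b * (\<delta> * lp_norm p x)"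
      unfolding z_def bdd_ops_diff[OF Bb y Py(1)]
      by (intro lp_norm_diff_le bdd_ops_lp'[OF Bb] By op_norm_bound'[OF Bb Py(1) _ Py(2)]) (simp add: b_def)
    also have "\<dots> = (1 + \<delta> + b * \<delta>) * lp_norm p x" by (simp add: algebra_simps)
    also have "\<dots> < (\<epsilon>' * (\<rho> - \<delta>)) * lp_norm p x" using \<delta> x_pos by (rule mult_strict_right_mono)
    also have "\<dots> \<le> \<epsilon>' * lp_norm p z"
    proof -
      have "lp_norm p z \<ge> (\<rho> - \<delta>) * lp_norm p x"
        using lp_norm_diff_ge[OF y Py(1)] Py(2) Cx unfolding z_def y_def[symmetric] by (simp add: left_diff_distrib)
      then show ?thesis using \<epsilon>'0 by (simp add: mult.assoc)
    qed
    finally show ?thesis using z zr by blast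
  qed
  show ?thesis using that[OF \<epsilon>'0 \<epsilon>'(2) ex] .
qed

section \<open>Band operators\<close>

lemma linfty_coeffsD:
  assumes "a \<in> linfty_coeffs"
  shows "bounded_linear (a i)" "a i (c *\<^sub>C \<xi>) = c *\<^sub>C a i \<xi>"
    "norm (a i \<xi>) \<le> (SUP i. onorm (a i)) * norm \<xi>"
proof -
  show bl: "bounded_linear (a i)" and "a i (c *\<^sub>C \<xi>) = c *\<^sub>C a i \<xi>"
    using assms by (auto simp: linfty_coeffs_def bdd_clinear_def)
  have "norm (a i \<xi>) \<le> onorm (a i) * norm \<xi>" by (rule onorm[OF bl])
  also have "\<dots> \<le> (SUP i. onorm (a i)) * norm \<xi>"
    using assms by (intro mult_right_mono cSUP_upper) (auto simp: linfty_coeffs_def)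
  finally show "norm (a i \<xi>) \<le> (SUP i. onorm (a i)) * norm \<xi>" .
qed

lemma linfty_coeffs_bound_nonneg:
  assumes "a \<in> linfty_coeffs" shows "0 \<le> (SUP i. onorm (a i))"
proof -
  have "0 \<le> onorm (a 0)" by (rule onorm_pos_le[OF linfty_coeffsD(1)[OF assms]])
  also have "\<dots> \<le> (SUP i. onorm (a i))"
    using assms by (intro cSUP_upper) (auto simp: linfty_coeffs_def)
  finally show ?thesis .
qed

lemma lp_dominated:
  assumes "x \<in> lp p" "c \<ge> 0" "\<And>i. norm (y i) \<le> c * norm (x i)"
  shows "y \<in> lp p" "lp_norm p y \<le> c * lp_norm p x"
  using lp_solid[OF lp_scaleC(1)[OF assms(1)], of y "complex_of_real c"] assms(2,3)
    lp_scaleC(2)[OF assms(1), of "complex_of_real c"]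
  by (auto simp: norm_scaleC)

lemma mult_op_bdd:
  assumes "a \<in> linfty_coeffs" shows "mult_op p a \<in> bdd_ops p"
proof (rule bdd_opsI[where C="SUP i. onorm (a i)"])
  fix x y :: "('a, 'b) seqs" and c
  note a = linfty_coeffsD[OF assms]
  show "x \<notin> lp p \<Longrightarrow> mult_op p a x = 0" by (simp add: mult_op_def on_lp_def)
  have *: "mult_op p a x \<in> lp p \<and> lp_norm p (mult_op p a x) \<le> (SUP i. onorm (a i)) * lp_norm p x" if "x \<in> lp p"
    using lp_dominated[OF that linfty_coeffs_bound_nonneg[OF assms], of "\<lambda>i. a i (x i)"] a(3) that
    by (simp add: mult_op_def on_lp_def)
  show "x \<in> lp p \<Longrightarrow> mult_op p a x \<in> lp p" using * by blast
  show "x \<in> lp p \<Longrightarrow> lp_norm p (mult_op p a x) \<le> (SUP i. onorm (a i)) * lp_norm p x" using * by blast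
  show "x \<in> lp p \<Longrightarrow> y \<in> lp p \<Longrightarrow> mult_op p a (x + y) = mult_op p a x + mult_op p a y"
    using lp_add(1)[of x y] by (auto simp: mult_op_def on_lp_def fun_eq_iff linear_add[OF bounded_linear.linear[OF a(1)]])
  show "x \<in> lp p \<Longrightarrow> mult_op p a (\<lambda>i. c *\<^sub>C x i) = (\<lambda>i. c *\<^sub>C mult_op p a x i)"
    using lp_scaleC(1)[of x c] by (auto simp: mult_op_def on_lp_def fun_eq_iff a(2))
qed

lemma bdd_ops_sum:
  assumes "\<And>\<alpha>. \<alpha> \<in> S \<Longrightarrow> f \<alpha> \<in> bdd_ops p" shows "(\<Sum>\<alpha>\<in>S. f \<alpha>) \<in> bdd_ops p"
  using assms
proof (induction S rule: infinite_finite_induct)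
  case (insert \<alpha> S)
  then show ?case using bdd_ops_plus(1)[of "f \<alpha>" "sum f S"] by (subst sum.insert) auto
qed auto

lemma band_ops_bdd: "A \<in> band_ops p \<Longrightarrow> A \<in> bdd_ops p"
  by (auto simp: band_ops_def intro!: bdd_ops_sum bdd_ops_comp mult_op_bdd)

lemma band_op_apply:
  assumes "x \<in> lp p"
  shows "(\<Sum>\<alpha>\<in>S. mult_op p (a \<alpha>) \<circ> shift_op p \<alpha>) x i = (\<Sum>\<alpha>\<in>S. a \<alpha> i (x (i - \<alpha>)))"
  using assms by (simp add: sum_fun_apply mult_op_def on_lp_def shift_op_apply lp_shift)

lemma band_dominated_approx:
  assumes "A \<in> band_ops p \<or> A \<in> band_dominated_ops p" "e > 0"
  obtains B where "B \<in> band_ops p" "op_norm p (A - B) < e"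
proof (cases "A \<in> band_ops p")
  case True
  then show ?thesis using that[of A] assms(2) by simp
next
  case False
  then show ?thesis using assms that by (auto simp: band_dominated_ops_def)
qed

end

section \<open>Localisation\<close>

definition ball_at :: "int ^ 'n::finite \<Rightarrow> nat \<Rightarrow> (int ^ 'n) set" where
  "ball_at k m = {i. mag (i - k) \<le> int m}"

lemma ball_at_eq: "ball_at k m = (\<lambda>j. j + k) ` cube m"
  by (auto simp: ball_at_def cube_def image_def intro: exI[of _ "_ - k"])

lemma finite_ball_at [simp]: "finite (ball_at k m)"
  by (simp add: ball_at_eq)

lemma dist_ball_at: "i \<in> ball_at k m \<Longrightarrow> i \<in> ball_at l n \<Longrightarrow> mag (k - l) \<le> int m + int n"
  using mag_triangle[of "k - i" "i - l"] by (simp add: ball_at_def mag_commute[of k i])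

text \<open>A Lipschitz cutoff: its commutator with a band operator is of order \<open>1 / D\<close>. A sharp
  cutoff would not do for the supremum norm.\<close>

definition bump :: "nat \<Rightarrow> int ^ 'n::finite \<Rightarrow> real" where
  "bump D i = max 0 (1 - real_of_int (mag i) / real D)"

definition cut :: "nat \<Rightarrow> int ^ 'n::finite \<Rightarrow> ('n, 'x::complex_banach) seqs \<Rightarrow> ('n, 'x) seqs" where
  "cut D k y = (\<lambda>i. bump D (i - k) *\<^sub>R y i)"

lemma bump_bounds: "0 \<le> bump D i" "bump D i \<le> 1"
  by (auto simp: bump_def)

lemma bump_0 [simp]: "bump D 0 = 1"
  by (simp add: bump_def)

lemma bump_outside: "D > 0 \<Longrightarrow> mag i \<ge> int D \<Longrightarrow> bump D i = 0"
  by (simp add: bump_def field_simps)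

lemma bump_Lipschitz: "\<bar>bump D i - bump D j\<bar> \<le> real_of_int (mag (i - j)) / real D"
proof -
  have "mag i \<le> mag (i - j) + mag j" "mag j \<le> mag (i - j) + mag i"
    using mag_triangle[of "i - j" j] mag_triangle[of "j - i" i] by (simp_all add: mag_commute[of i j])
  then have "real_of_int (mag i) / real D \<le> real_of_int (mag (i - j)) / real D + real_of_int (mag j) / real D"
    "real_of_int (mag j) / real D \<le> real_of_int (mag (i - j)) / real D + real_of_int (mag i) / real D"
    by (metis add_divide_distrib divide_right_mono of_int_add of_int_le_iff of_nat_0_le_iff)+
  then show ?thesis by (auto simp: bump_def max_def)
qed

lemma norm_cut: "norm (cut D k y i) = bump D (i - k) * norm (y i)"
  using bump_bounds(1)[of D "i - k"] by (simp add: cut_def)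

context lp_exponent
begin

lemma cut_lp:
  assumes "y \<in> lp p" shows "cut D k y \<in> lp p" "lp_norm p (cut D k y) \<le> lp_norm p y"
proof -
  have "norm (cut D k y i) \<le> norm (y i)" for i
    unfolding norm_cut by (intro mult_left_le_one_le bump_bounds norm_ge_zero)
  then show "cut D k y \<in> lp p" "lp_norm p (cut D k y) \<le> lp_norm p y" using lp_solid[OF assms] by auto
qed

text \<open>The \<open>\<alpha>\<close>-th diagonal contributes, at the point \<open>i\<close>, the factor
  \<open>bump D (i - \<alpha> - k) - bump D (i - k)\<close>. It is of order \<open>1 / D\<close> and vanishes when \<open>i - \<alpha>\<close> is far
  from \<open>k\<close>, so that only the part of \<open>y\<close> near \<open>k\<close> enters. The radius of that part exceeds \<open>D\<close> by
  the band width \<open>M\<close>.\<close>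

lemma band_commutator:
  assumes "A \<in> band_ops p"
  obtains \<kappa> M where "\<kappa> \<ge> 0"
    "\<And>D k y. D > 0 \<Longrightarrow> y \<in> lp p \<Longrightarrow>
      lp_norm p (A (cut D k y) - cut D k (A y)) \<le> \<kappa> / real D * lp_norm p (restr (ball_at k (D + M)) y)"
proof -
  obtain S a where S: "finite S" "\<forall>\<alpha>\<in>S. a \<alpha> \<in> linfty_coeffs"
    and A: "A = (\<Sum>\<alpha>\<in>S. mult_op p (a \<alpha>) \<circ> shift_op p \<alpha>)"
    using assms by (auto simp: band_ops_def)
  obtain M where M: "S \<subseteq> cube M" using finite_imp_subset_cube[OF S(1)] by blast
  define c where "c \<alpha> = (SUP i. onorm (a \<alpha> i))" for \<alpha>
  have c0: "c \<alpha> \<ge> 0" if "\<alpha> \<in> S" for \<alpha>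
    unfolding c_def using linfty_coeffs_bound_nonneg S(2) that by blast
  define \<kappa> where "\<kappa> = (\<Sum>\<alpha>\<in>S. c \<alpha> * real M)"
  have "lp_norm p (A (cut D k y) - cut D k (A y)) \<le> \<kappa> / real D * lp_norm p (restr (ball_at k (D + M)) y)"
    if D: "D > 0" and y: "y \<in> lp p" for D k y
  proof -
    let ?\<chi> = "restr (ball_at k (D + M)) y"
    define d where "d \<alpha> i = (bump D (i - \<alpha> - k) - bump D (i - k)) *\<^sub>R a \<alpha> i (y (i - \<alpha>))" for \<alpha> i
    have \<chi>: "?\<chi> \<in> lp p" by (rule lp_restr(1)[OF y])
    have d: "d \<alpha> \<in> lp p \<and> lp_norm p (d \<alpha>) \<le> (c \<alpha> * real M / real D) * lp_norm p ?\<chi>" if \<alpha>: "\<alpha> \<in> S" for \<alpha>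
    proof -
      have m\<alpha>: "mag \<alpha> \<le> int M" using \<alpha> M by (auto simp: cube_def)
      have "norm (d \<alpha> i) \<le> (c \<alpha> * real M / real D) * norm (?\<chi> (i - \<alpha>))" for i
      proof (cases "i - \<alpha> \<in> ball_at k (D + M)")
        case True
        have "\<bar>bump D (i - \<alpha> - k) - bump D (i - k)\<bar> \<le> real_of_int (mag (i - \<alpha> - k - (i - k))) / real D"
          by (rule bump_Lipschitz)
        also have "i - \<alpha> - k - (i - k) = - \<alpha>" by simp
        also have "real_of_int (mag (- \<alpha>)) / real D \<le> real M / real D"
          using m\<alpha> by (intro divide_right_mono) simp_all
        finally have 1: "\<bar>bump D (i - \<alpha> - k) - bump D (i - k)\<bar> \<le> real M / real D" .
        have 2: "norm (a \<alpha> i (y (i - \<alpha>))) \<le> c \<alpha> * norm (y (i - \<alpha>))"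
          unfolding c_def using linfty_coeffsD(3) S(2) \<alpha> by blast
        have "norm (d \<alpha> i) \<le> (real M / real D) * (c \<alpha> * norm (y (i - \<alpha>)))"
          unfolding d_def norm_scaleR by (intro mult_mono 1 2) auto
        then show ?thesis using True by (simp add: restr_def mult_ac)
      next
        case False
        have "mag (i - \<alpha> - k) \<le> mag (i - k) + mag \<alpha>"
          using mag_triangle_diff[of "i - k" \<alpha>] by (simp add: algebra_simps)
        then have "mag (i - \<alpha> - k) \<ge> int D" "mag (i - k) \<ge> int D"
          using False m\<alpha> by (auto simp: ball_at_def)
        then have "d \<alpha> i = 0" unfolding d_def by (simp add: bump_outside[OF D])
        then show ?thesis using False by (simp add: restr_def)
      qed
      then show ?thesis
        using lp_dominated[OF lp_shift(1)[OF \<chi>, of \<alpha>], of "c \<alpha> * real M / real D" "d \<alpha>"] c0[OF \<alpha>]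
        by (simp add: lp_shift(2)[OF \<chi>])
    qed
    have "A (cut D k y) - cut D k (A y) = (\<Sum>\<alpha>\<in>S. d \<alpha>)"
    proof
      fix i
      have "a \<alpha> i (bump D (i - \<alpha> - k) *\<^sub>R y (i - \<alpha>)) = bump D (i - \<alpha> - k) *\<^sub>R a \<alpha> i (y (i - \<alpha>))" if "\<alpha> \<in> S" for \<alpha>
        using linear_scale[OF bounded_linear.linear[OF linfty_coeffsD(1)]] S(2) that by blast
      then have "A (cut D k y) i = (\<Sum>\<alpha>\<in>S. bump D (i - \<alpha> - k) *\<^sub>R a \<alpha> i (y (i - \<alpha>)))"
        unfolding A band_op_apply[OF cut_lp(1)[OF y]] by (intro sum.cong) (auto simp: cut_def)
      moreover have "cut D k (A y) i = (\<Sum>\<alpha>\<in>S. bump D (i - k) *\<^sub>R a \<alpha> i (y (i - \<alpha>)))"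
        unfolding A by (simp add: cut_def band_op_apply[OF y] scaleR_sum_right)
      ultimately show "(A (cut D k y) - cut D k (A y)) i = (\<Sum>\<alpha>\<in>S. d \<alpha>) i"
        by (simp add: sum_fun_apply d_def sum_subtractf scaleR_left_diff_distrib)
    qed
    then have "lp_norm p (A (cut D k y) - cut D k (A y)) \<le> (\<Sum>\<alpha>\<in>S. lp_norm p (d \<alpha>))"
      using lp_sum(2)[of S d] d by simp
    also have "\<dots> \<le> (\<Sum>\<alpha>\<in>S. (c \<alpha> * real M / real D) * lp_norm p ?\<chi>)" using d by (intro sum_mono) blast
    also have "\<dots> = \<kappa> / real D * lp_norm p ?\<chi>"
      by (simp add: \<kappa>_def sum_divide_distrib sum_distrib_right)
    finally show ?thesis .
  qed
  moreover have "\<kappa> \<ge> 0" unfolding \<kappa>_def using c0 by (intro sum_nonneg) auto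
  ultimately show ?thesis using that by blast
qed

text \<open>Interchanging the sums over \<open>k\<close> and over the coordinates, each \<open>\<parallel>z\<^sub>i\<parallel>\<^sup>r\<close> is counted with the
  total weight of the cutoffs at \<open>i\<close>. That weight is at most \<open>\<Sum>\<psi>\<^sup>r\<close>, with equality when \<open>J\<close>
  contains all the centres whose cutoffs reach \<open>i\<close>.\<close>

lemma sum_translates:
  fixes z :: "('n::finite, 'x::complex_banach) seqs"
  assumes fin: "p \<noteq> 0" "p \<noteq> \<infinity>" and z: "z \<in> lp p" and J: "finite J"
    and \<psi>: "\<And>j. 0 \<le> \<psi> j" "\<And>j. j \<notin> cube R \<Longrightarrow> \<psi> j = 0"
  shows "(\<Sum>k\<in>J. lp_norm p (\<lambda>i. \<psi> (i - k) *\<^sub>R z i) powr r) \<le> (\<Sum>j\<in>cube R. \<psi> j powr r) * lp_norm p z powr r"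
    "restr (cube n) z = z \<Longrightarrow> cube (n + R) \<subseteq> J \<Longrightarrow>
      (\<Sum>k\<in>J. lp_norm p (\<lambda>i. \<psi> (i - k) *\<^sub>R z i) powr r) = (\<Sum>j\<in>cube R. \<psi> j powr r) * lp_norm p z powr r"
proof -
  let ?c = "\<Sum>j\<in>cube R. \<psi> j powr r"
  define U where "U = cube n \<union> (\<Union>k\<in>J. ball_at k R)"
  have U: "finite U" using J by (simp add: U_def)
  have N: "lp_norm p (\<lambda>i. \<psi> (i - k) *\<^sub>R z i) powr r = (\<Sum>i\<in>U. \<psi> (i - k) powr r * norm (z i) powr r)"
    if "k \<in> J" for k
  proof -
    have "(\<lambda>i. \<psi> (i - k) *\<^sub>R z i) = restr U (\<lambda>i. \<psi> (i - k) *\<^sub>R z i)"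
    proof
      fix i
      have "i - k \<in> cube R \<Longrightarrow> i \<in> U" using that by (auto simp: U_def ball_at_def cube_def)
      then show "\<psi> (i - k) *\<^sub>R z i = restr U (\<lambda>i. \<psi> (i - k) *\<^sub>R z i) i"
        using \<psi>(2)[of "i - k"] by (auto simp: restr_def)
    qed
    then have "lp_norm p (\<lambda>i. \<psi> (i - k) *\<^sub>R z i) powr r = (\<Sum>i\<in>U. norm (\<psi> (i - k) *\<^sub>R z i) powr r)"
      using lp_norm_restr_finite[OF fin U] by metis
    then show ?thesis using \<psi>(1) by (simp add: powr_mult)
  qed
  have swap: "(\<Sum>k\<in>J. lp_norm p (\<lambda>i. \<psi> (i - k) *\<^sub>R z i) powr r) =
      (\<Sum>i\<in>U. (\<Sum>k\<in>J. \<psi> (i - k) powr r) * norm (z i) powr r)"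
    using N by (simp add: sum_distrib_right sum.swap[of _ U])
  have re: "(\<Sum>k\<in>J. \<psi> (i - k) powr r) = (\<Sum>j\<in>(\<lambda>k. i - k) ` J. \<psi> j powr r)" for i
    by (subst sum.reindex) (auto simp: inj_on_def)
  have inner: "(\<Sum>k\<in>J. \<psi> (i - k) powr r) \<le> ?c" for i
  proof -
    have "(\<Sum>j\<in>(\<lambda>k. i - k) ` J. \<psi> j powr r) = (\<Sum>j\<in>(\<lambda>k. i - k) ` J \<inter> cube R. \<psi> j powr r)"
      using J \<psi>(2) by (intro sum.mono_neutral_right) auto
    also have "\<dots> \<le> ?c" by (intro sum_mono2) auto
    finally show ?thesis by (simp add: re)
  qed
  have "(\<Sum>k\<in>J. lp_norm p (\<lambda>i. \<psi> (i - k) *\<^sub>R z i) powr r) \<le> (\<Sum>i\<in>U. ?c * norm (z i) powr r)"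
    unfolding swap using inner by (intro sum_mono mult_right_mono) auto
  also have "\<dots> = ?c * (\<Sum>i\<in>U. norm (z i) powr r)" by (simp add: sum_distrib_left)
  also have "\<dots> \<le> ?c * lp_norm p z powr r"
    using finite_exponent_iff[OF fin, of z "lp_norm p z"] z U
    by (intro mult_left_mono) (auto intro: sum_nonneg)
  finally show "(\<Sum>k\<in>J. lp_norm p (\<lambda>i. \<psi> (i - k) *\<^sub>R z i) powr r) \<le> ?c * lp_norm p z powr r" .
  assume zn: "restr (cube n) z = z" and Jn: "cube (n + R) \<subseteq> J"
  have zU: "restr U z = z" using zn by (auto simp: restr_def fun_eq_iff U_def) metis
  have "(\<Sum>k\<in>J. \<psi> (i - k) powr r) = ?c" if i: "i \<in> cube n" for i
  proof -
    have "cube R \<subseteq> (\<lambda>k. i - k) ` J"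
    proof
      fix j :: "int ^ 'n" assume "j \<in> cube R"
      then have "i - j \<in> cube (n + R)"
        using i mag_triangle_diff[of i j] by (auto simp: cube_def)
      then show "j \<in> (\<lambda>k. i - k) ` J" using Jn by (intro image_eqI[of _ _ "i - j"]) auto
    qed
    then show ?thesis unfolding re using J \<psi>(2) by (intro sum.mono_neutral_right) auto
  qed
  then have "(\<Sum>i\<in>U. (\<Sum>k\<in>J. \<psi> (i - k) powr r) * norm (z i) powr r) = (\<Sum>i\<in>U. ?c * norm (z i) powr r)"
    using zn by (intro sum.cong) (auto simp: restr_def fun_eq_iff, metis norm_zero powr_0)
  also have "\<dots> = ?c * lp_norm p z powr r"
    using lp_norm_restr_finite[OF fin U, of z] zU by (simp add: sum_distrib_left)
  finally show "(\<Sum>k\<in>J. lp_norm p (\<lambda>i. \<psi> (i - k) *\<^sub>R z i) powr r) = ?c * lp_norm p z powr r"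
    unfolding swap .
qed

lemma lp_norm_tail:
  assumes fin: "p \<noteq> 0" "p \<noteq> \<infinity>" and x: "x \<in> lp p" and e: "e > 0"
  obtains n where "lp_norm p (restr (- cube n) x) \<le> e"
proof -
  note iff = finite_exponent_iff[OF fin]
  have sm: "(\<lambda>i. norm (x i) powr r) summable_on UNIV" using x fin by (simp add: lp_def r_def)
  let ?s = "\<Sum>\<^sub>\<infinity>i. norm (x i) powr r"
  have "\<exists>F. finite F \<and> ?s - e powr r < (\<Sum>i\<in>F. norm (x i) powr r)"
  proof (rule ccontr)
    assume "\<not> ?thesis"
    then have "?s \<le> ?s - e powr r" by (intro infsum_le_finite_sums sm) (auto simp: not_less)
    then show False using e by simp
  qed
  then obtain F where F: "finite F" "?s - e powr r < (\<Sum>i\<in>F. norm (x i) powr r)" by blast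
  obtain n where n: "F \<subseteq> cube n" using finite_imp_subset_cube[OF F(1)] by blast
  have "(\<Sum>i\<in>G. norm (restr (- cube n) x i) powr r) \<le> e powr r" if G: "finite G" for G
  proof -
    have "(\<Sum>i\<in>G. norm (restr (- cube n) x i) powr r) = (\<Sum>i\<in>G - cube n. norm (restr (- cube n) x i) powr r)"
      using G by (intro sum.mono_neutral_right) (auto simp: restr_def)
    also have "\<dots> = (\<Sum>i\<in>G - cube n. norm (x i) powr r)" by (intro sum.cong) (auto simp: restr_def)
    also have "\<dots> + (\<Sum>i\<in>F. norm (x i) powr r) = (\<Sum>i\<in>(G - cube n) \<union> F. norm (x i) powr r)"
      using F(1) G n by (subst sum.union_disjoint) auto
    also have "\<dots> \<le> ?s" using F(1) G by (intro finite_sum_le_infsum sm) auto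
    finally show ?thesis using F(2) by linarith
  qed
  then have "restr (- cube n) x \<in> lp p \<and> lp_norm p (restr (- cube n) x) \<le> e"
    using iff less_imp_le[OF e] by blast
  then show ?thesis using that by blast
qed

text \<open>Both commuting \<open>B\<close> with the cutoffs and comparing \<open>y\<close> with its pieces costs a factor that
  tends to \<open>1\<close> as \<open>D\<close> grows. For the supremum norm it suffices to centre the cutoff where \<open>y\<close> is
  nearly maximal; for a finite exponent the estimate holds for the \<open>r\<close>-th powers averaged over
  all centres, hence for some centre.\<close>

lemma localisation:
  fixes B :: "('n::finite, 'x::complex_banach) oper"
  assumes B: "B \<in> bdd_ops p" and \<kappa>: "\<kappa> \<ge> 0"
    and comm: "\<And>D k y. D > 0 \<Longrightarrow> y \<in> lp p \<Longrightarrow>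
      lp_norm p (B (cut D k y) - cut D k (B y)) \<le> \<kappa> / real D * lp_norm p (restr (ball_at k (D + M)) y)"
    and eps: "0 < \<epsilon>1" "\<epsilon>1 < \<epsilon>2"
  obtains D where "D > 0"
    "\<forall>y\<in>lp p. lp_norm p (B y) < \<epsilon>1 * lp_norm p y \<longrightarrow>
      (\<exists>k. \<exists>v\<in>lp p. (\<forall>i. i \<notin> ball_at k D \<or> y i = 0 \<longrightarrow> v i = 0) \<and> lp_norm p (B v) < \<epsilon>2 * lp_norm p v)"
proof -
  \<comment> \<open>\<open>g\<close> bounds the \<open>r\<close>-th root of the ratio of the weights of a ball and of the cutoff.\<close>
  define g :: real where "g = 2 * 3 ^ CARD('n)"
  have g1: "g \<ge> 1" unfolding g_def using one_le_power[of "3::real" "CARD('n)"] by linarith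
  \<comment> \<open>With \<open>D = 2 d\<close> and \<open>d > M\<close>, the cutoff is at least \<open>1 / 2\<close> on the ball of radius \<open>d\<close>, and the
    ball of radius \<open>D + M\<close> has at most \<open>3 ^ CARD('n)\<close> times as many points.\<close>
  obtain d0 :: nat where d0: "real d0 \<ge> \<kappa> * g / (\<epsilon>2 - \<epsilon>1)" using real_arch_simple by blast
  define d where "d = d0 + M + 1"
  define D where "D = 2 * d"
  have D: "D > 0" by (simp add: D_def d_def)
  have \<kappa>D: "\<kappa> / real D * g \<le> (\<epsilon>2 - \<epsilon>1) / 2"
  proof -
    have "\<kappa> * g \<le> real d0 * (\<epsilon>2 - \<epsilon>1)" using d0 eps by (simp add: divide_le_eq)
    also have "\<dots> \<le> real d * (\<epsilon>2 - \<epsilon>1)" using eps by (intro mult_right_mono) (auto simp: d_def)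
    finally show ?thesis using D by (simp add: D_def field_simps)
  qed
  have dec: "lp_norm p (B (cut D k y)) \<le> lp_norm p (cut D k (B y)) + \<kappa> / real D * lp_norm p (restr (ball_at k (D + M)) y)"
    if y: "y \<in> lp p" for k y
  proof -
    have "B (cut D k y) = cut D k (B y) + (B (cut D k y) - cut D k (B y))" by simp
    moreover have "lp_norm p \<dots> \<le> lp_norm p (cut D k (B y)) + \<kappa> / real D * lp_norm p (restr (ball_at k (D + M)) y)"
      using y by (intro lp_norm_add_le comm[OF D y] lp_diff cut_lp bdd_ops_lp'[OF B] order_refl)
    ultimately show ?thesis by metis
  qed
  have cut_supp: "\<forall>i. i \<notin> ball_at k D \<or> y i = 0 \<longrightarrow> cut D k y i = 0" for k and y :: "('n, 'x) seqs"
    by (auto simp: cut_def ball_at_def bump_outside[OF D])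
  have main: "\<exists>k. \<exists>v\<in>lp p. (\<forall>i. i \<notin> ball_at k D \<or> y i = 0 \<longrightarrow> v i = 0) \<and> lp_norm p (B v) < \<epsilon>2 * lp_norm p v"
    if y: "y \<in> lp p" and small: "lp_norm p (B y) < \<epsilon>1 * lp_norm p y" for y
  proof (cases "p = 0 \<or> p = \<infinity>")
    case True
    have ypos: "lp_norm p y > 0"
      using small eps(1) lp_norm_nonneg[OF y] lp_norm_nonneg[OF bdd_ops_lp'[OF B, of y]]
      by (metis less_le_not_le mult_zero_right order_le_less order_trans)
    \<comment> \<open>Half of the gap between \<open>\<epsilon>1\<close> and \<open>\<epsilon>2\<close> pays for the commutator, half for the choice of \<open>k\<close>.\<close>
    define \<epsilon> where "\<epsilon> = (\<epsilon>1 + \<epsilon>2) / 2"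
    have "\<exists>k. norm (y k) > \<epsilon> / \<epsilon>2 * lp_norm p y"
    proof (rule ccontr)
      assume "\<not> ?thesis"
      then have le: "\<forall>k. norm (y k) \<le> \<epsilon> / \<epsilon>2 * lp_norm p y" by (auto simp: not_less)
      then have "bounded (range y)" unfolding bounded_iff by blast
      then have "lp_norm p y \<le> \<epsilon> / \<epsilon>2 * lp_norm p y" using sup_exponent_le_iff[OF True] le by blast
      moreover have "\<epsilon> / \<epsilon>2 < 1" using eps by (simp add: \<epsilon>_def field_simps)
      ultimately show False using mult_strict_right_mono[OF _ ypos] by fastforce
    qed
    then obtain k where k: "norm (y k) > \<epsilon> / \<epsilon>2 * lp_norm p y" by blast
    have "lp_norm p (B (cut D k y)) \<le> lp_norm p (B y) + (\<kappa> / real D * g) * lp_norm p y"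
    proof -
      have "\<kappa> / real D * lp_norm p (restr (ball_at k (D + M)) y) \<le> (\<kappa> / real D * g) * lp_norm p y"
      proof (rule mult_mono)
        have "\<kappa> / real D \<ge> 0" using \<kappa> by simp
        then show "\<kappa> / real D \<le> \<kappa> / real D * g" "0 \<le> \<kappa> / real D * g"
          using g1 mult_left_mono[of 1 g "\<kappa> / real D"] by auto
      qed (use lp_restr[OF y, of "ball_at k (D + M)"] lp_norm_nonneg in auto)
      then show ?thesis using dec[OF y, of k] cut_lp(2)[OF bdd_ops_lp'[OF B, of y], of D k] by linarith
    qed
    also have "\<dots> < \<epsilon>1 * lp_norm p y + (\<epsilon>2 - \<epsilon>1) / 2 * lp_norm p y"
      using small \<kappa>D lp_norm_nonneg[OF y] by (intro add_less_le_mono mult_right_mono)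
    also have "\<dots> = \<epsilon>2 * (\<epsilon> / \<epsilon>2 * lp_norm p y)" using eps by (simp add: \<epsilon>_def field_simps)
    also have "\<dots> \<le> \<epsilon>2 * lp_norm p (cut D k y)"
      using k norm_le_lp_norm[OF cut_lp(1)[OF y], of D k k] eps by (intro mult_left_mono) (auto simp: norm_cut)
    finally show ?thesis using cut_lp(1)[OF y] cut_supp by blast
  next
    case False
    then have fin: "p \<noteq> 0" "p \<noteq> \<infinity>" by auto
    note r1 = r_ge_1[OF fin]
    define c where "c = (\<Sum>j\<in>(cube D :: (int ^ 'n) set). bump D j powr r)"
    let ?card = "real (card (cube (D + M) :: (int ^ 'n) set))"
    have card: "?card \<le> g powr r * c"
    proof -
      have half: "bump D j \<ge> 1 / 2" if "j \<in> cube d" for j :: "int ^ 'n"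
        using that by (simp add: bump_def D_def cube_def d_def field_simps le_max_iff_disj)
      have "real (card (cube d :: (int ^ 'n) set)) * (1/2) powr r = (\<Sum>j\<in>(cube d :: (int ^ 'n) set). (1/2) powr r)" by simp
      also have "\<dots> \<le> (\<Sum>j\<in>(cube d :: (int ^ 'n) set). bump D j powr r)"
        using half r1 by (intro sum_mono powr_mono2) auto
      also have "\<dots> \<le> c" unfolding c_def by (intro sum_mono2 cube_mono) (auto simp: D_def)
      finally have c: "real (card (cube d :: (int ^ 'n) set)) \<le> 2 powr r * c"
        by (simp add: powr_divide field_simps)
      have "(2 * (D + M) + 1) ^ CARD('n) \<le> (3 * (2 * d + 1)) ^ CARD('n)"
        by (intro power_mono) (auto simp: D_def d_def)
      then have "real ((2 * (D + M) + 1) ^ CARD('n)) \<le> real ((3 * (2 * d + 1)) ^ CARD('n))"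
        by (simp only: of_nat_le_iff)
      also have "\<dots> = 3 ^ CARD('n) * real ((2 * d + 1) ^ CARD('n))"
        by (simp only: power_mult_distrib of_nat_mult of_nat_power of_nat_numeral)
      finally have "?card \<le> 3 ^ CARD('n) * real (card (cube d :: (int ^ 'n) set))"
        by (simp only: card_cube)
      also have "\<dots> \<le> 3 ^ CARD('n) * (2 powr r * c)" using c by (intro mult_left_mono) auto
      also have "\<dots> \<le> (3 ^ CARD('n)) powr r * (2 powr r * c)"
        using r1 powr_mono[of 1 r "3 ^ CARD('n)"] by (intro mult_right_mono) (auto simp: c_def intro!: sum_nonneg mult_nonneg_nonneg)
      also have "\<dots> = g powr r * c" by (simp add: g_def powr_mult)
      finally show ?thesis .
    qed
    have cpos: "c > 0"
    proof -
      have "0 < ?card" by (simp add: card_cube)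
      then have "0 < g powr r * c" using card by linarith
      then show ?thesis using g1 by (simp add: zero_less_mult_iff)
    qed
    \<comment> \<open>Truncation keeps the strict inequality and makes the average over the centres finite.\<close>
    obtain n where n: "lp_norm p (B (restr (cube n) y)) < \<epsilon>1 * lp_norm p (restr (cube n) y)"
    proof -
      define b where "b = op_norm p B"
      have b: "b \<ge> 0" unfolding b_def by (rule op_norm_nonneg[OF B])
      define e where "e = (\<epsilon>1 * lp_norm p y - lp_norm p (B y)) / 2 / (b + \<epsilon>1)"
      have e: "e > 0" unfolding e_def using small b eps by (intro divide_pos_pos) auto
      have e': "(b + \<epsilon>1) * e < \<epsilon>1 * lp_norm p y - lp_norm p (B y)"
      proof -
        have "b + \<epsilon>1 \<noteq> 0" using b eps by simp
        then have "(b + \<epsilon>1) * e = (\<epsilon>1 * lp_norm p y - lp_norm p (B y)) / 2"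
          unfolding e_def by (rule nonzero_mult_div_cancel_left[of "b + \<epsilon>1", unfolded times_divide_eq_right[symmetric]])
        then show ?thesis using small by simp
      qed
      obtain n where n: "lp_norm p (restr (- cube n) y) \<le> e" by (rule lp_norm_tail[OF fin y e])
      have yn: "restr (cube n) y = y - restr (- cube n) y" by (auto simp: restr_def)
      note q = lp_restr(1)[OF y, of "- cube n"]
      have "lp_norm p (B (restr (cube n) y)) \<le> lp_norm p (B y) + b * e"
        unfolding yn bdd_ops_diff[OF B y q]
        by (intro lp_norm_diff_le bdd_ops_lp'[OF B] op_norm_bound'[OF B q _ n]) (auto simp: b_def)
      moreover have "lp_norm p y - e \<le> lp_norm p (restr (cube n) y)"
        unfolding yn using lp_norm_diff_ge[OF y q] n by linarith
      then have "\<epsilon>1 * lp_norm p y - \<epsilon>1 * e \<le> \<epsilon>1 * lp_norm p (restr (cube n) y)"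
        using eps by (metis mult_left_mono order_less_imp_le right_diff_distrib)
      ultimately have "lp_norm p (B (restr (cube n) y)) < \<epsilon>1 * lp_norm p (restr (cube n) y)"
        using e' by (simp add: distrib_right)
      then show ?thesis using that by blast
    qed
    have some: "\<exists>k. lp_norm p (B (cut D k v)) < \<epsilon>2 * lp_norm p (cut D k v)"
      if v: "v \<in> lp p" "restr (cube n) v = v" "lp_norm p (B v) < \<epsilon>1 * lp_norm p v" for v and n
    proof (rule ccontr)
      assume "\<not> ?thesis"
      then have ge: "\<epsilon>2 * lp_norm p (cut D k v) \<le> lp_norm p (B (cut D k v))" for k by (auto simp: not_less)
      define J where "J = (cube (n + D) :: (int ^ 'n) set)"
      have J: "finite J" by (simp add: J_def)
      note Bv = bdd_ops_lp'[OF B, of v]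
      let ?a = "c powr (1 / r) * lp_norm p (B v)" and ?b = "\<kappa> / real D * (g * c powr (1 / r) * lp_norm p v)"
      have cr: "(c powr (1 / r)) powr r = c" using r1 cpos by (simp add: powr_powr)
      have bump_supp: "j \<notin> cube D \<Longrightarrow> bump D j = 0" for j :: "int ^ 'n"
        by (simp add: cube_def bump_outside[OF D])
      have 1: "(\<Sum>k\<in>J. lp_norm p (cut D k v) powr r) = c * lp_norm p v powr r"
        unfolding cut_def c_def
        by (rule sum_translates(2)[OF fin v(1) J bump_bounds(1) bump_supp v(2)]) (simp_all add: J_def)
      have 2: "(\<Sum>k\<in>J. lp_norm p (cut D k (B v)) powr r) \<le> ?a powr r"
        unfolding cut_def powr_mult cr unfolding c_def
        by (rule sum_translates(1)[OF fin Bv J bump_bounds(1) bump_supp])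
      have 3: "(\<Sum>k\<in>J. (\<kappa> / real D * lp_norm p (restr (ball_at k (D + M)) v)) powr r) \<le> ?b powr r"
      proof -
        define \<psi> where "\<psi> j = (if j \<in> cube (D + M) then 1 else 0 :: real)" for j :: "int ^ 'n"
        have "restr (ball_at k (D + M)) v = (\<lambda>i. \<psi> (i - k) *\<^sub>R v i)" for k
          by (auto simp: restr_def \<psi>_def ball_at_def cube_def)
        then have "(\<Sum>k\<in>J. lp_norm p (restr (ball_at k (D + M)) v) powr r) \<le>
            (\<Sum>j\<in>cube (D + M). \<psi> j powr r) * lp_norm p v powr r"
          using sum_translates(1)[OF fin v(1) J, of \<psi> "D + M"] by (simp add: \<psi>_def)
        also have "(\<Sum>j\<in>cube (D + M). \<psi> j powr r) = ?card" by (simp add: \<psi>_def)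
        also have "?card * lp_norm p v powr r \<le> (g powr r * c) * lp_norm p v powr r"
          using card by (intro mult_right_mono) auto
        finally have "(\<Sum>k\<in>J. lp_norm p (restr (ball_at k (D + M)) v) powr r) \<le> (g powr r * c) * lp_norm p v powr r" .
        then have "(\<kappa> / real D) powr r * (\<Sum>k\<in>J. lp_norm p (restr (ball_at k (D + M)) v) powr r) \<le>
            (\<kappa> / real D) powr r * ((g powr r * c) * lp_norm p v powr r)"
          by (intro mult_left_mono) auto
        then show ?thesis by (simp only: powr_mult cr sum_distrib_left)
      qed
      have vn: "lp_norm p v \<ge> 0" "lp_norm p (B v) \<ge> 0" using lp_norm_nonneg v(1) Bv by auto
      have ab: "?a \<ge> 0" "?b \<ge> 0" using vn \<kappa> g1 by auto
      have "(\<epsilon>2 * (c powr (1 / r) * lp_norm p v)) powr r = (\<Sum>k\<in>J. (\<epsilon>2 * lp_norm p (cut D k v)) powr r)"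
        using 1 by (simp add: powr_mult cr sum_distrib_left[symmetric])
      also have "\<dots> \<le> (\<Sum>k\<in>J. (lp_norm p (cut D k (B v)) + \<kappa> / real D * lp_norm p (restr (ball_at k (D + M)) v)) powr r)"
        using ge dec[OF v(1)] r1 eps lp_norm_nonneg[OF cut_lp(1)[OF v(1)]]
        by (intro sum_mono powr_mono2) (auto intro: order_trans)
      also have "\<dots> \<le> (?a + ?b) powr r"
        using \<kappa> lp_norm_nonneg[OF cut_lp(1)[OF Bv]] lp_norm_nonneg[OF lp_restr(1)[OF v(1)]]
        by (intro Minkowski_sum r1 ab J 2 3) auto
      finally have "\<epsilon>2 * (c powr (1 / r) * lp_norm p v) \<le> ?a + ?b"
        using powr_less_mono2[of r "?a + ?b" "\<epsilon>2 * (c powr (1 / r) * lp_norm p v)"] r1 ab by fastforce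
      then have "c powr (1 / r) * (\<epsilon>2 * lp_norm p v) \<le> c powr (1 / r) * (lp_norm p (B v) + (\<kappa> / real D * g) * lp_norm p v)"
        by (simp add: algebra_simps)
      then have "\<epsilon>2 * lp_norm p v \<le> lp_norm p (B v) + (\<kappa> / real D * g) * lp_norm p v"
        using cpos by (simp add: mult_le_cancel_left)
      also have "\<dots> < \<epsilon>1 * lp_norm p v + ((\<epsilon>2 - \<epsilon>1) / 2) * lp_norm p v"
        using v(3) \<kappa>D vn by (intro add_less_le_mono mult_right_mono)
      also have "\<dots> \<le> \<epsilon>1 * lp_norm p v + (\<epsilon>2 - \<epsilon>1) * lp_norm p v"
        using eps vn(1) by (intro add_left_mono mult_right_mono) auto
      also have "\<dots> = \<epsilon>2 * lp_norm p v" by (simp add: left_diff_distrib)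
      finally show False by simp
    qed
    define v where "v = restr (cube n) y"
    have v: "v \<in> lp p" "restr (cube n) v = v" "lp_norm p (B v) < \<epsilon>1 * lp_norm p v" "\<And>i. y i = 0 \<Longrightarrow> v i = 0"
      using lp_restr(1)[OF y] n by (auto simp: v_def) (auto simp: restr_def)
    obtain k where "lp_norm p (B (cut D k v)) < \<epsilon>2 * lp_norm p (cut D k v)" using some[OF v(1-3)] by blast
    then show ?thesis using cut_lp(1)[OF v(1)] cut_supp[where y=v] v(4) by blast
  qed
  show ?thesis using that[OF D] main by blast
qed

text \<open>Localisation is applied to a band operator close to \<open>A\<close>. The diameter \<open>D\<close> that it yields is
  fixed before the distance \<open>m\<close> from the origin is chosen.\<close>

lemma localised_almost_kernel:
  fixes A :: "('n::finite, 'x::complex_banach) oper"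
  assumes A: "A \<in> bdd_ops p" "A \<in> band_ops p \<or> A \<in> band_dominated_ops p"
    and eps: "0 < \<epsilon>'" "\<epsilon>' < \<epsilon>"
    and ex: "\<And>m. \<exists>z\<in>lp p. restr (- cube m) z = z \<and>
      lp_norm p ((A - scalar_op p \<mu>) z) < \<epsilon>' * lp_norm p z"
  obtains D \<epsilon>2 where "0 < \<epsilon>2" "\<epsilon>2 < \<epsilon>"
    "\<And>m. \<exists>k. int m \<le> mag k \<and> (\<exists>z\<in>lp p. restr (ball_at k D) z = z \<and> lp_norm p z = 1 \<and>
      lp_norm p ((A - scalar_op p \<mu>) z) < \<epsilon>2)"
proof -
  \<comment> \<open>A quarter of the gap each for passing to the band operator, for localisation and for passing
    back, and one to keep the last inequality strict.\<close>
  define \<delta> where "\<delta> = (\<epsilon> - \<epsilon>') / 4"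
  have \<delta>: "\<delta> > 0" using eps by (simp add: \<delta>_def)
  obtain A' where A': "A' \<in> band_ops p" "op_norm p (A - A') < \<delta>"
    using band_dominated_approx[OF A(2) \<delta>] .
  note A'b = band_ops_bdd[OF A'(1)]
  define B where "B = A - scalar_op p \<mu>"
  define B' where "B' = A' - scalar_op p \<mu>"
  have Bb: "B \<in> bdd_ops p" "B' \<in> bdd_ops p"
    unfolding B_def B'_def by (intro bdd_ops_minus A(1) A'b scalar_op_bdd)+
  have db: "A - A' \<in> bdd_ops p" by (rule bdd_ops_minus(1)[OF A(1) A'b])
  have diff: "B z = B' z + (A - A') z" "B' z = B z - (A - A') z" for z
    by (auto simp: B_def B'_def)
  have dN: "lp_norm p ((A - A') z) \<le> \<delta> * lp_norm p z" if "z \<in> lp p" for z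
    using op_norm_bound'[OF db that less_imp_le[OF A'(2)] order_refl] .
  obtain \<kappa> M where \<kappa>: "\<kappa> \<ge> 0" and comm: "\<And>D k y. D > 0 \<Longrightarrow> y \<in> lp p \<Longrightarrow>
      lp_norm p (A' (cut D k y) - cut D k (A' y)) \<le> \<kappa> / real D * lp_norm p (restr (ball_at k (D + M)) y)"
    using band_commutator[OF A'(1)] by blast
  have comm': "lp_norm p (B' (cut D k y) - cut D k (B' y)) \<le> \<kappa> / real D * lp_norm p (restr (ball_at k (D + M)) y)"
    if "D > 0" and y: "y \<in> lp p" for D k y
  proof -
    have "c *\<^sub>C (t *\<^sub>R x) = t *\<^sub>R (c *\<^sub>C x)" for c t and x :: 'x
      by (rule linear_scale[OF bounded_linear.linear[OF bounded_linear_scaleC]])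
    then have "B' (cut D k y) - cut D k (B' y) = A' (cut D k y) - cut D k (A' y)"
      using y by (auto simp: B'_def cut_def scalar_op_apply cut_lp[unfolded cut_def] scaleR_diff_right fun_eq_iff)
    then show ?thesis using comm[OF that] by simp
  qed
  have e1: "0 < \<epsilon>' + \<delta>" "\<epsilon>' + \<delta> < \<epsilon>' + 2 * \<delta>" using eps \<delta> by auto
  obtain D where D: "D > 0" "\<forall>y\<in>lp p. lp_norm p (B' y) < (\<epsilon>' + \<delta>) * lp_norm p y \<longrightarrow>
      (\<exists>k. \<exists>v\<in>lp p. (\<forall>i. i \<notin> ball_at k D \<or> y i = 0 \<longrightarrow> v i = 0) \<and> lp_norm p (B' v) < (\<epsilon>' + 2 * \<delta>) * lp_norm p v)"
    by (rule localisation[OF Bb(2) \<kappa> comm' e1]) blast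
  have "\<exists>k. int m \<le> mag k \<and> (\<exists>z\<in>lp p. restr (ball_at k D) z = z \<and> lp_norm p z = 1 \<and>
      lp_norm p (B z) < \<epsilon>' + 3 * \<delta>)" for m
  proof -
    obtain y where y: "y \<in> lp p" "restr (- cube (m + D)) y = y" "lp_norm p (B y) < \<epsilon>' * lp_norm p y"
      using ex[of "m + D"] unfolding B_def by blast
    have "lp_norm p (B' y) \<le> lp_norm p (B y) + \<delta> * lp_norm p y"
      unfolding diff(2)[of y] by (intro lp_norm_diff_le bdd_ops_lp'[OF Bb(1)] bdd_ops_lp'[OF db] dN y(1) order_refl)
    then have "lp_norm p (B' y) < (\<epsilon>' + \<delta>) * lp_norm p y" using y(3) by (simp add: distrib_right)
    then obtain k v where v: "v \<in> lp p" "\<forall>i. i \<notin> ball_at k D \<or> y i = 0 \<longrightarrow> v i = 0"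
      "lp_norm p (B' v) < (\<epsilon>' + 2 * \<delta>) * lp_norm p v"
      using D(2) y(1) by blast
    have "lp_norm p (B v) \<le> lp_norm p (B' v) + \<delta> * lp_norm p v"
      unfolding diff(1)[of v] by (intro lp_norm_add_le bdd_ops_lp'[OF Bb(2)] bdd_ops_lp'[OF db] dN v(1) order_refl)
    then have Bv: "lp_norm p (B v) < (\<epsilon>' + 3 * \<delta>) * lp_norm p v" using v(3) by (simp add: algebra_simps)
    have Nv: "lp_norm p v > 0"
      using Bv lp_norm_nonneg[OF v(1)] lp_norm_nonneg[OF bdd_ops_lp'[OF Bb(1), of v]] eps \<delta>
      by (cases "lp_norm p v = 0") auto
    have "v \<noteq> 0" using Nv by auto
    then obtain i where i: "v i \<noteq> 0" by (auto simp: fun_eq_iff)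
    then have "i \<in> ball_at k D" "y i \<noteq> 0" using v(2) by blast+
    moreover have "y i = 0" if "mag i \<le> int (m + D)"
      using fun_cong[OF y(2), of i] that by (simp add: restr_def cube_def)
    ultimately have "mag (i - k) \<le> int D" "mag i > int (m + D)"
      using not_le by (auto simp: ball_at_def)
    then have mk: "int m \<le> mag k" using mag_triangle[of "i - k" k] by simp
    define c where "c = complex_of_real (1 / lp_norm p v)"
    have c: "cmod c * lp_norm p v = 1" using Nv by (simp add: c_def norm_divide)
    define z where "z = (\<lambda>i. c *\<^sub>C v i)"
    have z: "z \<in> lp p" "lp_norm p z = 1" unfolding z_def using lp_scaleC[OF v(1), of c] c by auto
    have "restr (ball_at k D) z = z" using v(2) by (auto simp: z_def restr_def fun_eq_iff)
    moreover have "lp_norm p (B z) = cmod c * lp_norm p (B v)"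
      unfolding z_def bdd_ops_scaleC[OF Bb(1) v(1)] by (rule lp_scaleC(2)[OF bdd_ops_lp'[OF Bb(1)]])
    then have "lp_norm p (B z) < \<epsilon>' + 3 * \<delta>"
      using Bv Nv by (simp add: c_def norm_divide pos_divide_less_eq)
    ultimately show ?thesis using mk z by blast
  qed
  moreover have "0 < \<epsilon>' + 3 * \<delta>" "\<epsilon>' + 3 * \<delta> < \<epsilon>" using eps \<delta> by (auto simp: \<delta>_def field_simps)
  ultimately show ?thesis using that[of "\<epsilon>' + 3 * \<delta>" D] unfolding B_def by blast
qed

end

section \<open>Block diagonal operators with rank-one blocks\<close>

text \<open>For a functional \<open>f\<close> that depends only on the coordinates in \<open>cube D\<close>, the operator
  \<open>block_op w\<close> below is the sum of the operators \<open>V\<^bsub>g n\<^esub> (w \<otimes> f) V\<^bsub>- g n\<^esub>\<close>, the \<open>n\<close>-th one being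
  cut off to the ball of radius \<open>R n\<close> about \<open>g n\<close>. The radii tend to infinity, so that the cutoff
  disappears in the limit. In this way one and the same \<open>w\<close>, of possibly infinite support, serves
  for all blocks.\<close>

locale rank_one_blocks = lp_exponent p for p :: ennreal +
  fixes f :: "('n::finite, 'x::complex_banach) seqs \<Rightarrow> complex" and D :: nat
    and g :: "nat \<Rightarrow> int ^ 'n" and R :: "nat \<Rightarrow> nat"
  assumes f_add: "f (x + y) = f x + f y"
    and f_scale: "f (\<lambda>i. c *\<^sub>C x i) = c * f x"
    and f_bound: "cmod (f x) \<le> lp_norm p (restr (cube D) x)"
    and disjoint: "m \<noteq> n \<Longrightarrow> ball_at (g m) (R m) \<inter> ball_at (g n) (R n) = {}"
    and radius: "D \<le> R n" "n \<le> R n"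
begin

abbreviation block :: "nat \<Rightarrow> (int ^ 'n) set" where
  "block n \<equiv> ball_at (g n) (R n)"

text \<open>The description operator picks the only block that contains \<open>i\<close>.\<close>

definition block_op :: "('n, 'x) seqs \<Rightarrow> ('n, 'x) oper" where
  "block_op w = on_lp p (\<lambda>x i. if \<exists>n. i \<in> block n
     then f (\<lambda>j. x (j + g (THE n. i \<in> block n))) *\<^sub>C w (i - g (THE n. i \<in> block n)) else 0)"

lemma the_block: "i \<in> block n \<Longrightarrow> (THE n. i \<in> block n) = n"
  using disjoint by (intro the_equality) blast+

lemma block_op_in: "x \<in> lp p \<Longrightarrow> i \<in> block n \<Longrightarrow> block_op w x i = f (\<lambda>j. x (j + g n)) *\<^sub>C w (i - g n)"
  using the_block[of i n] by (auto simp: block_op_def on_lp_def)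

lemma block_op_out: "x \<in> lp p \<Longrightarrow> (\<And>n. i \<notin> block n) \<Longrightarrow> block_op w x i = 0"
  by (simp add: block_op_def on_lp_def)

lemma f_0: "f 0 = 0" "f (\<lambda>i. 0) = 0"
proof -
  show f0: "f 0 = 0" using f_add[of 0 0] by simp
  show "f (\<lambda>i. 0) = 0" using f0 unfolding zero_fun_def .
qed

lemma f_eq_0: "(\<And>j. j \<in> cube D \<Longrightarrow> x j = 0) \<Longrightarrow> f x = 0"
proof -
  assume "\<And>j. j \<in> cube D \<Longrightarrow> x j = 0"
  then have "restr (cube D) x = (\<lambda>i. 0)" by (auto simp: restr_def)
  then show "f x = 0" using f_bound[of x] by simp
qed

lemma f_cong: "(\<And>j. j \<in> cube D \<Longrightarrow> x j = y j) \<Longrightarrow> f x = f y"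
  using f_add[of "x - y" y] f_eq_0[of "x - y"] by simp

lemma f_sum: "f (\<Sum>a\<in>S. h a) = (\<Sum>a\<in>S. f (h a))"
proof (induction S rule: infinite_finite_induct)
  case (insert a S)
  show ?case unfolding sum.insert[OF insert.hyps] f_add insert.IH ..
qed (simp_all add: f_0)

lemma f_bound_lp: "x \<in> lp p \<Longrightarrow> cmod (f x) \<le> lp_norm p x"
  using f_bound[of x] lp_restr(2)[of x "cube D"] by linarith

lemma block_op_norm_aux:
  assumes x: "x \<in> lp p" and w: "w \<in> lp p"
  shows "block_op w x \<in> lp p \<and> lp_norm p (block_op w x) \<le> lp_norm p w * lp_norm p x"
proof (rule lp_norm_disjoint_blocks[OF x lp_norm_nonneg[OF w], where C=block])
  fix n
  let ?x = "\<lambda>j. x (j + g n)"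
  have xs: "?x \<in> lp p" using lp_shift(1)[OF x, of "- g n"] by simp
  have "restr (block n) (block_op w x) = restr (block n) (\<lambda>i. f ?x *\<^sub>C w (i - g n))"
    using block_op_in[OF x] by (auto simp: restr_def)
  then have "lp_norm p (restr (block n) (block_op w x)) = lp_norm p (restr (block n) (\<lambda>i. f ?x *\<^sub>C w (i - g n)))"
    by (simp only:)
  also have "\<dots> \<le> lp_norm p (\<lambda>i. f ?x *\<^sub>C w (i - g n))"
    by (intro lp_restr lp_scaleC lp_shift w)
  also have "\<dots> = cmod (f ?x) * lp_norm p w"
    using lp_scaleC(2)[OF lp_shift(1)[OF w]] lp_shift(2)[OF w] by simp
  also have "\<dots> \<le> lp_norm p (restr (block n) x) * lp_norm p w"
  proof (rule mult_right_mono[OF _ lp_norm_nonneg[OF w]])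
    have "cmod (f ?x) \<le> lp_norm p (restr (cube D) ?x)" by (rule f_bound)
    also have "restr (cube D) ?x = (\<lambda>j. restr (ball_at (g n) D) x (j - - g n))"
      by (auto simp: restr_def ball_at_def cube_def)
    also have "lp_norm p \<dots> = lp_norm p (restr (ball_at (g n) D) x)"
      by (intro lp_shift lp_restr x)
    also have "\<dots> \<le> lp_norm p (restr (block n) x)"
      using radius(1)[of n] by (intro lp_solid(2)[OF lp_restr(1)[OF x]]) (auto simp: restr_def ball_at_def)
    finally show "cmod (f ?x) \<le> lp_norm p (restr (block n) x)" .
  qed
  finally show "lp_norm p (restr (block n) (block_op w x)) \<le> lp_norm p w * lp_norm p (restr (block n) x)"
    by (simp add: mult.commute)
next
  show "finite (block n)" for n by simp
  show "block m \<inter> block n = {}" if "m \<noteq> n" for m n using that by (rule disjoint)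
  show "block_op w x i = 0" if "i \<notin> (\<Union>n. block n)" for i using that by (intro block_op_out[OF x]) auto
qed

lemma block_op_bdd:
  assumes w: "w \<in> lp p" shows "block_op w \<in> bdd_ops p" "op_norm p (block_op w) \<le> lp_norm p w"
proof -
  show "op_norm p (block_op w) \<le> lp_norm p w"
    using block_op_norm_aux[OF _ w] lp_norm_nonneg[OF w] by (intro op_norm_le) auto
  show "block_op w \<in> bdd_ops p"
  proof (rule bdd_opsI[where C="lp_norm p w"])
    fix x y :: "('n, 'x) seqs" and c
    show "x \<notin> lp p \<Longrightarrow> block_op w x = 0" by (simp add: block_op_def on_lp_def)
    show "x \<in> lp p \<Longrightarrow> block_op w x \<in> lp p" using block_op_norm_aux w by blast
    show "x \<in> lp p \<Longrightarrow> lp_norm p (block_op w x) \<le> lp_norm p w * lp_norm p x" using block_op_norm_aux w by blast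
    show "block_op w (x + y) = block_op w x + block_op w y" if x: "x \<in> lp p" and y: "y \<in> lp p"
    proof
      fix i
      have "(\<lambda>j. (x + y) (j + g n)) = (\<lambda>j. x (j + g n)) + (\<lambda>j. y (j + g n))" for n by auto
      then show "block_op w (x + y) i = (block_op w x + block_op w y) i"
        using block_op_in[OF lp_add(1)[OF x y]] block_op_out[OF lp_add(1)[OF x y]]
          block_op_in[OF x] block_op_in[OF y] block_op_out[OF x] block_op_out[OF y]
        by (cases "\<exists>n. i \<in> block n") (auto simp: f_add scaleC_add_left simp del: plus_fun_apply simp: plus_fun_apply[of "block_op w x"])
    qed
    show "block_op w (\<lambda>i. c *\<^sub>C x i) = (\<lambda>i. c *\<^sub>C block_op w x i)" if x: "x \<in> lp p"
    proof
      fix i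
      show "block_op w (\<lambda>i. c *\<^sub>C x i) i = c *\<^sub>C block_op w x i"
        using block_op_in[OF lp_scaleC(1)[OF x]] block_op_out[OF lp_scaleC(1)[OF x]]
          block_op_in[OF x] block_op_out[OF x]
        by (cases "\<exists>n. i \<in> block n") (auto simp: f_scale scaleC_scaleC)
    qed
  qed
qed

lemma block_op_minus:
  assumes "v \<in> lp p" "w \<in> lp p" shows "block_op v - block_op w = block_op (v - w)"
proof
  fix x
  show "(block_op v - block_op w) x = block_op (v - w) x"
  proof (cases "x \<in> lp p")
    case True
    show ?thesis
    proof
      fix i show "(block_op v - block_op w) x i = block_op (v - w) x i"
        using block_op_in[OF True] block_op_out[OF True]
        by (cases "\<exists>n. i \<in> block n") (auto simp: scaleC_diff_right)
    qed
  qed (simp add: block_op_def on_lp_def fun_eq_iff)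
qed

text \<open>The functionals of the other blocks vanish on \<open>x\<close>, because they read coordinates in their own
  blocks only.\<close>

lemma block_op_single_block:
  assumes x: "x \<in> lp p" "restr (block n) x = x"
  shows "block_op w x = (\<lambda>i. f (\<lambda>j. x (j + g n)) *\<^sub>C restr (cube (R n)) w (i - g n))"
proof
  fix i
  have iff: "i \<in> block n \<longleftrightarrow> i - g n \<in> cube (R n)" for i by (simp add: ball_at_def cube_def)
  show "block_op w x i = f (\<lambda>j. x (j + g n)) *\<^sub>C restr (cube (R n)) w (i - g n)"
  proof (cases "i \<in> block n")
    case True
    then show ?thesis using block_op_in[OF x(1) True] iff[of i] by (simp add: restr_def)
  next
    case False
    have "block_op w x i = 0"
    proof (cases "\<exists>m. i \<in> block m")
      case True
      then obtain m where m: "i \<in> block m" by blast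
      then have mn: "m \<noteq> n" using False by blast
      have "f (\<lambda>j. x (j + g m)) = 0"
      proof (rule f_eq_0)
        fix j :: "int ^ 'n" assume "j \<in> cube D"
        then have "j + g m \<in> block m" using radius(1)[of m] by (auto simp: ball_at_def cube_def)
        then have "j + g m \<notin> block n" using disjoint[OF mn] by blast
        then show "x (j + g m) = 0" using fun_cong[OF x(2), of "j + g m"] by (simp add: restr_def)
      qed
      then show ?thesis using block_op_in[OF x(1) m] by simp
    next
      case False
      then show ?thesis using block_op_out[OF x(1)] by blast
    qed
    then show ?thesis using False iff by (simp add: restr_def)
  qed
qed

text \<open>Only finitely many blocks meet a given window, since the blocks are disjoint.\<close>

lemma block_op_LP:
  assumes w: "w \<in> lp p" shows "block_op w \<in> LP p"
proof (rule LP_I[OF block_op_bdd(1)[OF w]])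
  fix m
  have fin: "finite {n. block n \<inter> cube m \<noteq> {}}" by (intro finite_blocks_meeting disjoint) auto
  obtain n' where "(\<Union>k\<in>{n. block n \<inter> cube m \<noteq> {}}. block k) \<subseteq> cube n'"
    using finite_imp_subset_cube[of "\<Union>k\<in>{n. block n \<inter> cube m \<noteq> {}}. block k"] fin by auto
  then obtain n where mn: "m \<le> n" and n: "(\<Union>k\<in>{n. block n \<inter> cube m \<noteq> {}}. block k) \<subseteq> cube n"
    using cube_mono[of n' "max m n'"] by (meson max.cobounded1 max.cobounded2 order_trans)
  have vanish: "f (\<lambda>j. x (j + g k)) = 0" if "\<And>i. i \<in> block k \<Longrightarrow> x i = 0" for x k
  proof (rule f_eq_0)
    fix j :: "int ^ 'n" assume "j \<in> cube D"
    then have "j + g k \<in> block k" using radius(1)[of k] by (auto simp: ball_at_def cube_def)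
    then show "x (j + g k) = 0" by (rule that)
  qed
  show "\<exists>n\<ge>m. Q_op p n \<circ> block_op w \<circ> P_op p m = 0 \<and> P_op p m \<circ> block_op w \<circ> Q_op p n = 0"
  proof (intro exI[of _ n] conjI ext mn)
    fix x i
    note b = block_op_bdd(1)[OF w]
    show "(Q_op p n \<circ> block_op w \<circ> P_op p m) x i = 0 x i"
    proof (cases "x \<in> lp p \<and> i \<notin> cube n")
      case True
      then have x: "x \<in> lp p" "restr (cube m) x \<in> lp p" using lp_restr(1) by auto
      have "block_op w (restr (cube m) x) i = 0"
      proof (cases "\<exists>k. i \<in> block k")
        case T: True
        then obtain k where k: "i \<in> block k" by blast
        then have "block k \<inter> cube m = {}" using n True by blast
        then have "f (\<lambda>j. restr (cube m) x (j + g k)) = 0" by (intro vanish) (auto simp: restr_def)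
        then show ?thesis using block_op_in[OF x(2) k] by simp
      next
        case False
        then show ?thesis using block_op_out[OF x(2)] by blast
      qed
      then show ?thesis using x bdd_ops_lp'[OF b] True by (simp add: P_op_apply Q_op_apply restr_def)
    next
      case False
      have "x \<notin> lp p \<Longrightarrow> ?thesis"
        by (simp del: comp_apply add: bdd_ops_outside[OF bdd_ops_comp(1)[OF bdd_ops_comp(1)[OF Q_op_bdd b] P_op_bdd]])
      moreover have "x \<in> lp p \<Longrightarrow> i \<in> cube n \<Longrightarrow> ?thesis"
        using bdd_ops_lp'[OF b] by (simp add: Q_op_apply restr_def)
      ultimately show ?thesis using False by blast
    qed
    show "(P_op p m \<circ> block_op w \<circ> Q_op p n) x i = 0 x i"
    proof (cases "x \<in> lp p \<and> i \<in> cube m")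
      case True
      then have x: "x \<in> lp p" "restr (- cube n) x \<in> lp p" using lp_restr(1) by auto
      have "block_op w (restr (- cube n) x) i = 0"
      proof (cases "\<exists>k. i \<in> block k")
        case T: True
        then obtain k where k: "i \<in> block k" by blast
        then have "block k \<subseteq> cube n" using n True by blast
        then have "f (\<lambda>j. restr (- cube n) x (j + g k)) = 0" by (intro vanish) (auto simp: restr_def)
        then show ?thesis using block_op_in[OF x(2) k] by simp
      next
        case False
        then show ?thesis using block_op_out[OF x(2)] by blast
      qed
      then show ?thesis using x bdd_ops_lp'[OF b] True by (simp add: P_op_apply Q_op_apply restr_def)
    next
      case False
      have "x \<notin> lp p \<Longrightarrow> ?thesis"
        by (simp del: comp_apply add: bdd_ops_outside[OF bdd_ops_comp(1)[OF bdd_ops_comp(1)[OF P_op_bdd b] Q_op_bdd]])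
      moreover have "x \<in> lp p \<Longrightarrow> i \<notin> cube m \<Longrightarrow> ?thesis"
        using bdd_ops_lp'[OF b] by (simp add: P_op_apply restr_def)
      ultimately show ?thesis using False by blast
    qed
  qed
qed

text \<open>In a block about \<open>g n\<close>, the coefficient of the \<open>\<alpha>\<close>-th diagonal at \<open>i\<close> applies \<open>f\<close> to the
  single coordinate \<open>i - \<alpha>\<close>, moved to \<open>i - \<alpha> - g n\<close>, and multiplies the result by \<open>w (i - g n)\<close>.
  It vanishes unless \<open>i - g n\<close> lies in \<open>cube M\<close> and \<open>i - \<alpha> - g n\<close> in \<open>cube D\<close>, which confines
  \<open>\<alpha>\<close> to \<open>cube (M + D)\<close>.\<close>

lemma block_op_band:
  assumes w: "w \<in> lp p" "restr (cube M) w = w" shows "block_op w \<in> band_ops p"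
proof -
  define sing where "sing j \<xi> = (\<lambda>i. if i = j then \<xi> else 0)" for j :: "int ^ 'n" and \<xi> :: 'x
  define S where "S = (cube (M + D) :: (int ^ 'n) set)"
  define a where "a \<alpha> i \<xi> = (if \<exists>n. i \<in> block n then
      f (sing (i - \<alpha> - g (THE n. i \<in> block n)) \<xi>) *\<^sub>C w (i - g (THE n. i \<in> block n)) else 0)" for \<alpha> i \<xi>
  have a_in: "a \<alpha> i \<xi> = f (sing (i - \<alpha> - g n) \<xi>) *\<^sub>C w (i - g n)" if "i \<in> block n" for \<alpha> i \<xi> n
    unfolding a_def using the_block[OF that] that by auto
  have a_out: "a \<alpha> i \<xi> = 0" if "\<And>n. i \<notin> block n" for \<alpha> i \<xi>
    unfolding a_def using that by simp
  have sing_add: "sing j (\<xi> + \<eta>) = sing j \<xi> + sing j \<eta>" for j \<xi> \<eta> by (auto simp: sing_def)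
  have sing_scale: "sing j (c *\<^sub>C \<xi>) = (\<lambda>i. c *\<^sub>C sing j \<xi> i)" for j c \<xi> by (auto simp: sing_def)
  have f_sing: "cmod (f (sing j \<xi>)) \<le> norm \<xi>" for j \<xi>
  proof -
    have "sing j \<xi> \<in> lp p" unfolding sing_def by (rule finite_support_lp) (auto elim!: finite_subset[rotated])
    then show ?thesis using f_bound_lp[of "sing j \<xi>"] lp_norm_single[of j \<xi>] unfolding sing_def by linarith
  qed
  have a_add: "a \<alpha> i (\<xi> + \<eta>) = a \<alpha> i \<xi> + a \<alpha> i \<eta>" for \<alpha> i \<xi> \<eta>
    by (cases "\<exists>n. i \<in> block n") (auto simp: a_in a_out sing_add f_add scaleC_add_left)
  have a_scale: "a \<alpha> i (c *\<^sub>C \<xi>) = c *\<^sub>C a \<alpha> i \<xi>" for \<alpha> i c \<xi>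
    by (cases "\<exists>n. i \<in> block n") (auto simp: a_in a_out sing_scale f_scale scaleC_scaleC)
  have a_norm: "norm (a \<alpha> i \<xi>) \<le> norm \<xi> * lp_norm p w" for \<alpha> i \<xi>
  proof (cases "\<exists>n. i \<in> block n")
    case True
    then obtain n where n: "i \<in> block n" by blast
    show ?thesis unfolding a_in[OF n] norm_scaleC
      by (intro mult_mono f_sing norm_le_lp_norm w) auto
  qed (simp add: a_out lp_norm_nonneg w)
  have bl: "bounded_linear (a \<alpha> i)" for \<alpha> i
    by (rule bounded_linear_intro[where K="lp_norm p w"])
      (auto simp: a_add a_norm a_scale simp flip: scaleC_of_real)
  have coeffs: "a \<alpha> \<in> linfty_coeffs" for \<alpha>
  proof -
    have "onorm (a \<alpha> i) \<le> lp_norm p w" for i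
      by (rule onorm_bound[OF lp_norm_nonneg[OF w(1)]]) (use a_norm in \<open>simp add: mult.commute\<close>)
    then have "bdd_above (range (\<lambda>i. onorm (a \<alpha> i)))" by (rule bdd_aboveI2)
    then show ?thesis using bl a_scale by (simp add: linfty_coeffs_def bdd_clinear_def)
  qed
  have "block_op w = (\<Sum>\<alpha>\<in>S. mult_op p (a \<alpha>) \<circ> shift_op p \<alpha>)" (is "_ = ?B")
  proof (intro ext)
    fix x i
    have Bb: "?B \<in> bdd_ops p" by (intro bdd_ops_sum bdd_ops_comp mult_op_bdd coeffs shift_op_bdd)
    show "block_op w x i = ?B x i"
    proof (cases "x \<in> lp p")
      case True
      show ?thesis
      proof (cases "\<exists>n. i \<in> block n")
        case T: True
        then obtain n where n: "i \<in> block n" by blast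
        define l where "l = i - g n"
        have "?B x i = (\<Sum>\<alpha>\<in>S. f (sing (l - \<alpha>) (x (i - \<alpha>)))) *\<^sub>C w l"
          unfolding band_op_apply[OF True] by (simp add: a_in[OF n] scaleC_sum_left l_def algebra_simps)
        also have "\<dots> = f (\<lambda>j. x (j + g n)) *\<^sub>C w l"
        proof (cases "w l = 0")
          case False
          then have l: "mag l \<le> int M" using fun_cong[OF w(2), of l] by (auto simp: restr_def cube_def split: if_splits)
          have "(\<Sum>\<alpha>\<in>S. f (sing (l - \<alpha>) (x (i - \<alpha>)))) = (\<Sum>j\<in>(\<lambda>\<alpha>. l - \<alpha>) ` S. f (sing j (x (j + g n))))"
            by (subst sum.reindex) (auto simp: inj_on_def l_def algebra_simps)
          also have "\<dots> = (\<Sum>j\<in>cube D. f (sing j (x (j + g n))))"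
          proof (rule sum.mono_neutral_right)
            show "cube D \<subseteq> (\<lambda>\<alpha>. l - \<alpha>) ` S"
            proof
              fix j :: "int ^ 'n" assume "j \<in> cube D"
              then have "l - j \<in> S" using l mag_triangle_diff[of l j] by (auto simp: S_def cube_def)
              then show "j \<in> (\<lambda>\<alpha>. l - \<alpha>) ` S" by (intro image_eqI[of _ _ "l - j"]) auto
            qed
            show "\<forall>j\<in>(\<lambda>\<alpha>. l - \<alpha>) ` S - cube D. f (sing j (x (j + g n))) = 0"
              by (intro ballI f_eq_0) (auto simp: sing_def)
          qed (simp add: S_def)
          also have "\<dots> = f (\<Sum>j\<in>cube D. sing j (x (j + g n)))" by (simp add: f_sum)
          also have "\<dots> = f (\<lambda>j. x (j + g n))"
            by (rule f_cong) (simp add: sum_fun_apply sing_def)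
          finally show ?thesis by simp
        qed simp
        finally show ?thesis using block_op_in[OF True n] by (simp add: l_def)
      next
        case False
        then show ?thesis using block_op_out[OF True] by (simp add: band_op_apply[OF True] a_out)
      qed
    next
      case False
      then show ?thesis using bdd_ops_outside[OF Bb False] bdd_ops_outside[OF block_op_bdd(1)[OF w(1)] False] by metis
    qed
  qed
  moreover have "finite S" by (simp add: S_def)
  ultimately show ?thesis using coeffs unfolding band_ops_def by blast
qed

lemma block_op_band_dominated:
  assumes w: "w \<in> lp p" and tail: "\<And>e. e > 0 \<Longrightarrow> \<exists>M. lp_norm p (restr (- cube M) w) < e"
  shows "block_op w \<in> band_dominated_ops p"
  unfolding band_dominated_ops_def
proof (intro CollectI conjI allI impI block_op_bdd w)
  fix e :: real assume "e > 0"
  then obtain M where M: "lp_norm p (restr (- cube M) w) < e" using tail by blast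
  let ?v = "restr (cube M) w"
  have v: "?v \<in> lp p" "restr (cube M) ?v = ?v" using lp_restr(1)[OF w] by (auto simp: restr_def)
  have "w - ?v = restr (- cube M) w" by (auto simp: restr_def)
  then have "op_norm p (block_op w - block_op ?v) \<le> lp_norm p (restr (- cube M) w)"
    unfolding block_op_minus[OF w v(1)] using block_op_bdd(2)[OF lp_diff(1)[OF w v(1)]] by simp
  then show "\<exists>B\<in>band_ops p. op_norm p (block_op w - B) < e"
    using M block_op_band[OF v] by (intro bexI[of _ "block_op ?v"]) auto
qed

end

section \<open>Limit operators of block diagonal operators\<close>

lemma tends_to_infinity_iff: "tends_to_infinity h \<longleftrightarrow> (\<forall>m. \<forall>\<^sub>F n in sequentially. m \<le> mag (h n))"
  unfolding tends_to_infinity_def mag_def[symmetric] by (simp add: filterlim_at_top)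

lemma tends_to_infinity_subseq:
  assumes "tends_to_infinity h" "strict_mono \<phi>" shows "tends_to_infinity (h \<circ> \<phi>)"
  using assms unfolding tends_to_infinity_def comp_def
  by (rule filterlim_compose[OF _ filterlim_subseq])

context lp_exponent
begin

definition conj_shift :: "int ^ 'n \<Rightarrow> ('n::finite, 'x::complex_banach) oper \<Rightarrow> ('n, 'x) oper" where
  "conj_shift k A = shift_op p (- k) \<circ> A \<circ> shift_op p k"

lemma conj_shift_bdd:
  assumes "A \<in> bdd_ops p"
  shows "conj_shift k A \<in> bdd_ops p" "op_norm p (conj_shift k A) \<le> op_norm p A"
proof -
  show "conj_shift k A \<in> bdd_ops p" unfolding conj_shift_def by (intro bdd_ops_comp assms shift_op_bdd)
  have "op_norm p (shift_op p k) \<le> 1" for k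
    by (rule op_norm_le) (auto simp: lp_norm_shift_op)
  then have "op_norm p (conj_shift k A) \<le> 1 * op_norm p A * 1"
    unfolding conj_shift_def by (intro op_norm_comp_le bdd_ops_comp assms shift_op_bdd order_refl)
  then show "op_norm p (conj_shift k A) \<le> op_norm p A" by simp
qed

lemma conj_shift_apply:
  assumes "A \<in> bdd_ops p" "x \<in> lp p"
  shows "conj_shift k A x i = A (\<lambda>j. x (j - k)) (i + k)"
  using assms by (simp add: conj_shift_def shift_op_apply lp_shift bdd_ops_lp')

lemma is_limit_opI:
  assumes "tends_to_infinity h" "A \<in> bdd_ops p" "L \<in> bdd_ops p"
    and "\<And>m. (\<lambda>n. op_norm p (P_op p m \<circ> (conj_shift (h n) A - L))) \<longlonglongrightarrow> 0"
    and "\<And>m. (\<lambda>n. op_norm p ((conj_shift (h n) A - L) \<circ> P_op p m)) \<longlonglongrightarrow> 0"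
  shows "is_limit_op p A h L"
  unfolding is_limit_op_def conj_shift_def[symmetric]
  using assms conj_shift_bdd[OF assms(2)] by (auto intro!: P_strongly_convergesI)

lemma op_norm_comp_P_op_le:
  assumes "A \<in> bdd_ops p" "c \<ge> 0"
    and "\<And>x. x \<in> lp p \<Longrightarrow> restr (cube m) x = x \<Longrightarrow> lp_norm p (A x) \<le> c * lp_norm p x"
  shows "op_norm p (A \<circ> P_op p m) \<le> c"
proof (rule op_norm_le[OF assms(2)])
  fix x :: "('a, 'b) seqs" assume x: "x \<in> lp p"
  have "lp_norm p (A (restr (cube m) x)) \<le> c * lp_norm p (restr (cube m) x)"
    by (intro assms lp_restr x) (auto simp: restr_def)
  also have "\<dots> \<le> c * lp_norm p x" by (intro mult_left_mono lp_restr x assms(2))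
  finally show "lp_norm p ((A \<circ> P_op p m) x) \<le> c * lp_norm p x" using x by (simp add: P_op_apply)
qed

lemma op_norm_P_op_comp_le:
  assumes "A \<in> bdd_ops p" "c \<ge> 0"
    and "\<And>x. x \<in> lp p \<Longrightarrow> lp_norm p (restr (cube m) (A x)) \<le> c * lp_norm p x"
  shows "op_norm p (P_op p m \<circ> A) \<le> c"
  using assms bdd_ops_lp'[OF assms(1)] by (intro op_norm_le) (auto simp: P_op_apply)

lemma restr_tail_mono:
  assumes "w \<in> lp p" "M \<le> M'"
  shows "lp_norm p (restr (- cube M') w) \<le> lp_norm p (restr (- cube M) w)"
  using cube_mono[OF assms(2)] by (intro lp_solid(2)[OF lp_restr(1)[OF assms(1)]]) (auto simp: restr_def)

end

context rank_one_blocks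
begin

definition rank_one :: "('n, 'x) seqs \<Rightarrow> ('n, 'x) oper" where
  "rank_one w = on_lp p (\<lambda>x i. f x *\<^sub>C w i)"

lemma rank_one_bdd:
  assumes w: "w \<in> lp p" shows "rank_one w \<in> bdd_ops p"
proof (rule bdd_opsI[where C="lp_norm p w"])
  fix x y :: "('n, 'x) seqs" and c
  show "x \<notin> lp p \<Longrightarrow> rank_one w x = 0" by (simp add: rank_one_def on_lp_def)
  show "x \<in> lp p \<Longrightarrow> rank_one w x \<in> lp p" by (simp add: rank_one_def on_lp_def lp_scaleC w)
  show "x \<in> lp p \<Longrightarrow> y \<in> lp p \<Longrightarrow> rank_one w (x + y) = rank_one w x + rank_one w y"
    using lp_add(1)[of x y] by (auto simp: rank_one_def on_lp_def f_add scaleC_add_left fun_eq_iff)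
  show "x \<in> lp p \<Longrightarrow> rank_one w (\<lambda>i. c *\<^sub>C x i) = (\<lambda>i. c *\<^sub>C rank_one w x i)"
    using lp_scaleC(1)[of x c] by (auto simp: rank_one_def on_lp_def f_scale scaleC_scaleC fun_eq_iff)
  show "lp_norm p (rank_one w x) \<le> lp_norm p w * lp_norm p x" if "x \<in> lp p"
    using mult_right_mono[OF f_bound_lp[OF that] lp_norm_nonneg[OF w]] that
    by (simp add: rank_one_def on_lp_def lp_scaleC[OF w] mult.commute)
qed

text \<open>Let \<open>k j\<close> be at the fixed displacement \<open>t\<close> from the centre of the \<open>\<nu> j\<close>-th block. As that block
  grows, a fixed window about \<open>k j\<close> eventually lies inside it. Then the output in the window is
  exactly that of the limit. The image of a sequence supported in the window differs from the
  limit by what is cut off from \<open>w\<close>.\<close>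

lemma limit_op_near_blocks:
  assumes w: "w \<in> lp p" and tail: "\<And>e. e > 0 \<Longrightarrow> \<exists>M. lp_norm p (restr (- cube M) w) < e"
    and k: "tends_to_infinity k" "\<And>j. k j = g (\<nu> j) + t" and \<nu>: "filterlim \<nu> at_top sequentially"
  shows "is_limit_op p (block_op w) k (conj_shift t (rank_one w))"
proof (rule is_limit_opI[OF k(1) block_op_bdd(1)[OF w] conj_shift_bdd(1)[OF rank_one_bdd[OF w]]])
  let ?L = "conj_shift t (rank_one w)"
  have bd: "conj_shift (k j) (block_op w) - ?L \<in> bdd_ops p" for j
    by (intro bdd_ops_minus conj_shift_bdd block_op_bdd rank_one_bdd w)
  have A: "conj_shift (k j) (block_op w) x i = block_op w (\<lambda>j'. x (j' - k j)) (i + k j)" if "x \<in> lp p" for x i j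
    by (rule conj_shift_apply[OF block_op_bdd(1)[OF w] that])
  have L: "?L x i = f (\<lambda>j. x (j - t)) *\<^sub>C w (i + t)" if "x \<in> lp p" for x i
    unfolding conj_shift_apply[OF rank_one_bdd[OF w] that]
    using lp_shift(1)[OF that, of t] by (simp add: rank_one_def on_lp_def)
  have sh: "(\<lambda>j'. x (j' + g (\<nu> j) - k j)) = (\<lambda>j. x (j - t))" for x :: "('n, 'x) seqs" and j
    by (simp add: k(2) algebra_simps)
  fix m
  have far: "\<forall>\<^sub>F j in sequentially. m + nat (mag t) + M \<le> \<nu> j" for M
    using \<nu> by (simp add: filterlim_at_top)
  have inblock: "i + k j \<in> block (\<nu> j)" if "mag i \<le> int m" "m + nat (mag t) \<le> \<nu> j" for i j
    using that radius(2)[of "\<nu> j"] mag_triangle[of i t] by (simp add: ball_at_def k(2) algebra_simps)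
  have "op_norm p (P_op p m \<circ> (conj_shift (k j) (block_op w) - ?L)) \<le> 0" if j: "m + nat (mag t) \<le> \<nu> j" for j
  proof (rule op_norm_P_op_comp_le[OF bd order_refl])
    fix x :: "('n, 'x) seqs" assume x: "x \<in> lp p"
    have "restr (cube m) ((conj_shift (k j) (block_op w) - ?L) x) = 0"
    proof
      fix i
      have "(conj_shift (k j) (block_op w) - ?L) x i = 0" if "i \<in> cube m"
        using block_op_in[OF lp_shift(1)[OF x, of "k j"] inblock[OF _ j], of i] that
        by (simp add: cube_def A[OF x] L[OF x] sh) (simp add: k(2) algebra_simps)
      then show "restr (cube m) ((conj_shift (k j) (block_op w) - ?L) x) i = 0 i" by (simp add: restr_def)
    qed
    then show "lp_norm p (restr (cube m) ((conj_shift (k j) (block_op w) - ?L) x)) \<le> 0 * lp_norm p x" by simp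
  qed
  then have "op_norm p (P_op p m \<circ> (conj_shift (k j) (block_op w) - ?L)) = 0" if j: "m + nat (mag t) \<le> \<nu> j" for j
    using op_norm_nonneg[OF bdd_ops_comp(1)[OF P_op_bdd bd]] j by (intro antisym)
  then show "(\<lambda>j. op_norm p (P_op p m \<circ> (conj_shift (k j) (block_op w) - ?L))) \<longlonglongrightarrow> 0"
    using far[of 0] by (intro tendsto_eventually) (auto elim: eventually_mono)
  have "\<forall>\<^sub>F j in sequentially. norm (op_norm p ((conj_shift (k j) (block_op w) - ?L) \<circ> P_op p m)) < e" if e: "e > 0" for e
  proof -
    obtain M where M: "lp_norm p (restr (- cube M) w) < e" using tail[OF e] by blast
    have "op_norm p ((conj_shift (k j) (block_op w) - ?L) \<circ> P_op p m) \<le> lp_norm p (restr (- cube M) w)"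
      if j: "m + nat (mag t) + M \<le> \<nu> j" for j
    proof (rule op_norm_comp_P_op_le[OF bd lp_norm_nonneg[OF lp_restr(1)[OF w]]])
      fix x :: "('n, 'x) seqs" assume x: "x \<in> lp p" "restr (cube m) x = x"
      let ?x = "\<lambda>i. x (i - k j)" and ?c = "f (\<lambda>j. x (j - t))"
      have xs: "?x \<in> lp p" by (rule lp_shift(1)[OF x(1)])
      have "restr (block (\<nu> j)) ?x = ?x"
      proof
        fix i
        show "restr (block (\<nu> j)) ?x i = ?x i"
          using inblock[of "i - k j" j] j fun_cong[OF x(2), of "i - k j"]
          by (auto simp: restr_def cube_def split: if_splits)
      qed
      then have img: "block_op w ?x = (\<lambda>i. ?c *\<^sub>C restr (cube (R (\<nu> j))) w (i - g (\<nu> j)))"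
        using block_op_single_block[OF xs] sh by simp
      have "(conj_shift (k j) (block_op w) - ?L) x =
          - (\<lambda>i. ?c *\<^sub>C restr (- cube (R (\<nu> j))) w (i - - t))"
      proof
        fix i
        have "conj_shift (k j) (block_op w) x i = ?c *\<^sub>C restr (cube (R (\<nu> j))) w (i + k j - g (\<nu> j))"
          unfolding A[OF x(1)] img ..
        also have "i + k j - g (\<nu> j) = i + t" by (simp add: k(2))
        finally show "(conj_shift (k j) (block_op w) - ?L) x i =
            (- (\<lambda>i. ?c *\<^sub>C restr (- cube (R (\<nu> j))) w (i - - t))) i"
          by (simp add: L[OF x(1)] restr_def)
      qed
      moreover have "lp_norm p \<dots> = cmod ?c * lp_norm p (restr (- cube (R (\<nu> j))) w)"
        using lp_scaleC[OF lp_shift(1)[OF lp_restr(1)[OF w]]] lp_shift(2)[OF lp_restr(1)[OF w]] lp_uminus(2) by metis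
      moreover have "cmod ?c \<le> lp_norm p x"
        using f_bound_lp[OF lp_shift(1)[OF x(1)], of t] lp_shift(2)[OF x(1), of t] by simp
      moreover have "lp_norm p (restr (- cube (R (\<nu> j))) w) \<le> lp_norm p (restr (- cube M) w)"
        using j radius(2)[of "\<nu> j"] by (intro restr_tail_mono w) simp
      ultimately show "lp_norm p ((conj_shift (k j) (block_op w) - ?L) x) \<le> lp_norm p (restr (- cube M) w) * lp_norm p x"
        using lp_norm_nonneg[OF lp_restr(1)[OF w]] lp_norm_nonneg[OF x(1)]
        by (simp add: mult.commute[of "lp_norm p (restr (- cube M) w)"] mult_mono)
    qed
    then show ?thesis
      using far[of M] M op_norm_nonneg[OF bdd_ops_comp(1)[OF bd P_op_bdd]]
      by (auto elim!: eventually_mono) (meson le_less_trans)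
  qed
  then show "(\<lambda>j. op_norm p ((conj_shift (k j) (block_op w) - ?L) \<circ> P_op p m)) \<longlonglongrightarrow> 0"
    unfolding tendsto_iff dist_real_def by simp
qed

text \<open>If the distance of \<open>k j\<close> from all centres tends to infinity, then the functionals eventually
  vanish on the sequences supported in a window about \<open>k j\<close>, and in such a window only tails of
  translates of \<open>w\<close> appear as output.\<close>

lemma limit_op_off_blocks:
  assumes w: "w \<in> lp p" and tail: "\<And>e. e > 0 \<Longrightarrow> \<exists>M. lp_norm p (restr (- cube M) w) < e"
    and k: "tends_to_infinity k" "\<And>m. \<forall>\<^sub>F j in sequentially. \<forall>n. int m < mag (k j - g n)"
  shows "is_limit_op p (block_op w) k 0"
proof (rule is_limit_opI[OF k(1) block_op_bdd(1)[OF w] bdd_ops_zero])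
  have A: "conj_shift (k j) (block_op v) x i = block_op v (\<lambda>j'. x (j' - k j)) (i + k j)"
    if "x \<in> lp p" "v \<in> lp p" for x i j v
    by (rule conj_shift_apply[OF block_op_bdd(1)[OF that(2)] that(1)])
  have bd: "conj_shift (k j) (block_op w) \<in> bdd_ops p" for j
    by (intro conj_shift_bdd block_op_bdd w)
  fix m
  have "op_norm p (conj_shift (k j) (block_op w) \<circ> P_op p m) \<le> 0" if j: "\<forall>n. int (m + D) < mag (k j - g n)" for j
  proof (rule op_norm_comp_P_op_le[OF bd order_refl])
    fix x :: "('n, 'x) seqs" assume x: "x \<in> lp p" "restr (cube m) x = x"
    let ?x = "\<lambda>i. x (i - k j)"
    have xs: "?x \<in> lp p" by (rule lp_shift(1)[OF x(1)])
    have f0: "f (\<lambda>j'. ?x (j' + g n)) = 0" for n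
    proof (rule f_eq_0)
      fix i :: "int ^ 'n" assume "i \<in> cube D"
      have "mag (k j - g n) \<le> mag (i + g n - k j) + mag i"
        using mag_triangle_diff[of i "i + g n - k j"] by (simp add: algebra_simps)
      then have "mag (i + g n - k j) > int m" using \<open>i \<in> cube D\<close> j[rule_format, of n] by (simp add: cube_def)
      then show "?x (i + g n) = 0" using fun_cong[OF x(2), of "i + g n - k j"] by (simp add: restr_def cube_def)
    qed
    have "block_op w ?x i = 0" for i
      using block_op_in[OF xs] block_op_out[OF xs] f0 by (cases "\<exists>n. i \<in> block n") auto
    then have "conj_shift (k j) (block_op w) x = 0" using A[OF x(1) w] by (auto simp: fun_eq_iff)
    then show "lp_norm p (conj_shift (k j) (block_op w) x) \<le> 0 * lp_norm p x" by simp
  qed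
  then have "op_norm p (conj_shift (k j) (block_op w) \<circ> P_op p m) = 0" if j: "\<forall>n. int (m + D) < mag (k j - g n)" for j
    using op_norm_nonneg[OF bdd_ops_comp(1)[OF bd P_op_bdd]] j by (intro antisym)
  then show "(\<lambda>j. op_norm p ((conj_shift (k j) (block_op w) - 0) \<circ> P_op p m)) \<longlonglongrightarrow> 0"
    using k(2)[of "m + D"] by (intro tendsto_eventually) (auto elim: eventually_mono)
  have "\<forall>\<^sub>F j in sequentially. norm (op_norm p (P_op p m \<circ> conj_shift (k j) (block_op w))) < e" if e: "e > 0" for e
  proof -
    obtain M where M: "lp_norm p (restr (- cube M) w) < e" using tail[OF e] by blast
    let ?v = "restr (- cube M) w"
    have v: "?v \<in> lp p" by (rule lp_restr(1)[OF w])
    have "op_norm p (P_op p m \<circ> conj_shift (k j) (block_op w)) \<le> lp_norm p ?v"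
      if j: "\<forall>n. int (m + M) < mag (k j - g n)" for j
    proof (rule op_norm_P_op_comp_le[OF bd lp_norm_nonneg[OF v]])
      fix x :: "('n, 'x) seqs" assume x: "x \<in> lp p"
      let ?x = "\<lambda>i. x (i - k j)"
      have xs: "?x \<in> lp p" by (rule lp_shift(1)[OF x])
      have cb: "conj_shift (k j) (block_op ?v) \<in> bdd_ops p" by (intro conj_shift_bdd block_op_bdd v)
      have "block_op w ?x (i + k j) = block_op ?v ?x (i + k j)" if "i \<in> cube m" for i
      proof (cases "\<exists>n. i + k j \<in> block n")
        case True
        then obtain n where n: "i + k j \<in> block n" by blast
        have "mag (k j - g n) \<le> mag (i + k j - g n) + mag i"
          using mag_triangle_diff[of "i + k j - g n" i] by (simp add: algebra_simps)
        then have "i + k j - g n \<in> - cube M" using j[rule_format, of n] that by (simp add: cube_def)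
        then show ?thesis by (simp add: block_op_in[OF xs n] restr_def)
      next
        case False
        then show ?thesis using block_op_out[OF xs] by simp
      qed
      then have "restr (cube m) (conj_shift (k j) (block_op w) x) = restr (cube m) (conj_shift (k j) (block_op ?v) x)"
        unfolding A[OF x w, symmetric] A[OF x v, symmetric]
        by (auto simp: restr_def[of "cube m"])
      then have "lp_norm p (restr (cube m) (conj_shift (k j) (block_op w) x)) =
          lp_norm p (restr (cube m) (conj_shift (k j) (block_op ?v) x))" by (simp only:)
      also have "\<dots> \<le> lp_norm p (conj_shift (k j) (block_op ?v) x)"
        by (intro lp_restr bdd_ops_lp'[OF cb])
      also have "\<dots> \<le> lp_norm p ?v * lp_norm p x"
        using conj_shift_bdd(2)[OF block_op_bdd(1)[OF v]] block_op_bdd(2)[OF v]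
        by (intro op_norm_bound'[OF cb x] order_refl) (rule order_trans)
      finally show "lp_norm p (restr (cube m) (conj_shift (k j) (block_op w) x)) \<le> lp_norm p ?v * lp_norm p x" .
    qed
    then show ?thesis
      using k(2)[of "m + M"] M op_norm_nonneg[OF bdd_ops_comp(1)[OF P_op_bdd bd]]
      by (auto elim!: eventually_mono) (meson le_less_trans)
  qed
  then show "(\<lambda>j. op_norm p (P_op p m \<circ> (conj_shift (k j) (block_op w) - 0))) \<longlonglongrightarrow> 0"
    unfolding tendsto_iff dist_real_def by simp
qed

text \<open>Either the distance to the centres tends to infinity, or it stays bounded along a subsequence.
  In the second case only finitely many displacements occur, and one of them occurs infinitely
  often.\<close>

lemma block_op_rich:
  assumes w: "w \<in> lp p" and tail: "\<And>e. e > 0 \<Longrightarrow> \<exists>M. lp_norm p (restr (- cube M) w) < e"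
  shows "rich p (block_op w)"
  unfolding rich_def
proof (intro conjI allI impI block_op_LP[OF w])
  fix k :: "nat \<Rightarrow> int ^ 'n" assume k: "tends_to_infinity k"
  show "\<exists>r. strict_mono r \<and> (\<exists>B. is_limit_op p (block_op w) (k \<circ> r) B)"
  proof (cases "\<forall>m. \<forall>\<^sub>F j in sequentially. \<forall>n. int m < mag (k j - g n)")
    case True
    then have "is_limit_op p (block_op w) (k \<circ> id) 0" using limit_op_off_blocks[OF w tail k] by simp
    then show ?thesis using strict_mono_id by blast
  next
    case False
    then obtain \<rho> where "\<not> (\<forall>\<^sub>F j in sequentially. \<forall>n. int \<rho> < mag (k j - g n))" by blast
    then have inf: "infinite {j. \<exists>n. mag (k j - g n) \<le> int \<rho>}"
      by (simp add: cofinite_eq_sequentially[symmetric] eventually_cofinite not_less)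
    have union: "{j. \<exists>n. mag (k j - g n) \<le> int \<rho>} = (\<Union>t\<in>cube \<rho>. {j. \<exists>n. k j = g n + t})"
    proof (intro equalityI subsetI)
      fix j assume "j \<in> {j. \<exists>n. mag (k j - g n) \<le> int \<rho>}"
      then obtain n where "mag (k j - g n) \<le> int \<rho>" by blast
      then show "j \<in> (\<Union>t\<in>cube \<rho>. {j. \<exists>n. k j = g n + t})"
        by (intro UN_I[of "k j - g n"]) (auto simp: cube_def intro!: exI[of _ n])
    next
      fix j assume "j \<in> (\<Union>t\<in>cube \<rho>. {j. \<exists>n. k j = g n + t})"
      then obtain t n where "t \<in> cube \<rho>" "k j = g n + t" by blast
      then have "mag (k j - g n) \<le> int \<rho>" by (simp add: cube_def)
      then show "j \<in> {j. \<exists>n. mag (k j - g n) \<le> int \<rho>}" by blast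
    qed
    have "\<exists>t. infinite {j. \<exists>n. k j = g n + t}"
    proof (rule ccontr)
      assume "\<not> ?thesis"
      then have "finite {j. \<exists>n. k j = g n + t}" for t unfolding not_ex not_not by (rule spec)
      then have "finite (\<Union>t\<in>cube \<rho>. {j. \<exists>n. k j = g n + t})" by (rule finite_UN_I[OF finite_cube])
      then show False using inf unfolding union by (rule notE[rotated])
    qed
    then obtain t where t: "infinite {j. \<exists>n. k j = g n + t}" by (rule exE)
    define J where "J = {j. \<exists>n. k j = g n + t}"
    have J: "infinite J" unfolding J_def by (rule t)
    define \<phi> where "\<phi> = enumerate J"
    have \<phi>: "strict_mono \<phi>" unfolding \<phi>_def by (rule strict_mono_enumerate[OF J])
    have "\<phi> j \<in> J" for j unfolding \<phi>_def by (rule enumerate_in_set[OF J])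
    then have "\<exists>n. k (\<phi> j) = g n + t" for j by (auto simp: J_def)
    then obtain \<nu> where \<nu>: "\<And>j. k (\<phi> j) = g (\<nu> j) + t" by metis
    have k\<phi>: "tends_to_infinity (k \<circ> \<phi>)" by (rule tends_to_infinity_subseq[OF k \<phi>])
    have "\<forall>\<^sub>F j in sequentially. m \<le> \<nu> j" for m
    proof -
      define b where "b = (\<Sum>n<m. mag (g n)) + mag t + 1"
      have "\<forall>\<^sub>F j in sequentially. b \<le> mag ((k \<circ> \<phi>) j)" using k\<phi> by (simp add: tends_to_infinity_iff)
      then show ?thesis
      proof (rule eventually_mono)
        fix j assume j: "b \<le> mag ((k \<circ> \<phi>) j)"
        show "m \<le> \<nu> j"
        proof (rule ccontr)
          assume "\<not> m \<le> \<nu> j"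
          then have "mag (g (\<nu> j)) \<le> (\<Sum>n<m. mag (g n))" by (intro member_le_sum) auto
          then show False using j mag_triangle[of "g (\<nu> j)" t] by (simp add: b_def \<nu>)
        qed
      qed
    qed
    then have "filterlim \<nu> at_top sequentially" by (simp add: filterlim_at_top)
    then have "is_limit_op p (block_op w) (k \<circ> \<phi>) (conj_shift t (rank_one w))"
      using limit_op_near_blocks[OF w tail k\<phi>] \<nu> by simp
    then show ?thesis using \<phi> by blast
  qed
qed

end

section \<open>Construction of the perturbation\<close>

lemma sparse_subsequence:
  fixes h :: "nat \<Rightarrow> int ^ 'n::finite"
  assumes "tends_to_infinity h"
  obtains s where "strict_mono s"
    "\<And>m n. m \<noteq> n \<Longrightarrow> ball_at (h (s m)) (m + D) \<inter> ball_at (h (s n)) (n + D) = {}"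
proof -
  have far: "\<exists>y>x. mag (h y) \<ge> c" for x :: nat and c
  proof -
    have "\<forall>\<^sub>F n in sequentially. c \<le> mag (h n) \<and> x < n"
      using assms eventually_gt_at_top[of x] by (intro eventually_conj) (auto simp: tends_to_infinity_iff)
    then show ?thesis using eventually_happens' sequentially_bot by blast
  qed
  have "\<exists>s. \<forall>n. s n < s (Suc n) \<and> mag (h (s (Suc n))) \<ge> mag (h (s n)) + 2 * int (Suc n + D) + 1"
    using dependent_nat_choice[of "\<lambda>_ _. True" "\<lambda>n x y. x < y \<and> mag (h y) \<ge> mag (h x) + 2 * int (Suc n + D) + 1"] far
    by blast
  then obtain s where s: "\<And>n. s n < s (Suc n)"
    "\<And>n. mag (h (s (Suc n))) \<ge> mag (h (s n)) + 2 * int (Suc n + D) + 1" by blast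
  have gap: "mag (h (s n)) \<ge> mag (h (s m)) + 2 * int (n + D) + 1" if "m < n" for m n
    using that
  proof (induction n rule: less_Suc_induct)
    case (1 n)
    show ?case by (rule s(2))
  next
    case (2 l m n)
    then show ?case by linarith
  qed
  have disj: "ball_at (h (s m)) (m + D) \<inter> ball_at (h (s n)) (n + D) = {}" if "m < n" for m n
  proof (rule ccontr)
    assume "\<not> ?thesis"
    then have "mag (h (s n) - h (s m)) \<le> int (n + D) + int (m + D)" using dist_ball_at by blast
    moreover have "mag (h (s n)) \<le> mag (h (s n) - h (s m)) + mag (h (s m))"
      using mag_triangle[of "h (s n) - h (s m)" "h (s m)"] by simp
    moreover have "int m < int n" using that by simp
    ultimately show False using gap[OF that] unfolding of_nat_add by presburger
  qed
  have "strict_mono s" using s(1) by (simp add: strict_mono_Suc_iff)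
  then show ?thesis using that disj by (metis inf_commute linorder_neqE_nat)
qed

context lp_exponent
begin

lemma decay_of_limit:
  assumes w: "w \<in> lp p" and y: "\<And>n. y n \<in> lp p" "(\<lambda>n. lp_norm p (y n - w)) \<longlonglongrightarrow> 0"
    and dec: "\<And>n e. e > 0 \<Longrightarrow> \<exists>M. lp_norm p (restr (- cube M) (y n)) < e" and e: "e > 0"
  shows "\<exists>M. lp_norm p (restr (- cube M) w) < e"
proof -
  obtain n where n: "lp_norm p (y n - w) < e / 2"
    using order_tendstoD(2)[OF y(2) half_gt_zero[OF e]] eventually_happens' sequentially_bot by blast
  obtain M where M: "lp_norm p (restr (- cube M) (y n)) < e / 2" using dec[OF half_gt_zero[OF e]] by blast
  have "restr (- cube M) w = restr (- cube M) (y n) - restr (- cube M) (y n - w)"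
    by (auto simp: restr_def)
  moreover have "lp_norm p \<dots> \<le> lp_norm p (restr (- cube M) (y n)) + lp_norm p (y n - w)"
    by (intro lp_norm_diff_le lp_restr lp_diff y w order_refl)
  ultimately show ?thesis using n M by (intro exI[of _ M]) (simp only:)
qed

text \<open>The translate of \<open>u\<close> lives in some window \<open>cube m\<close>, and \<open>A P\<^sub>m\<close> belongs to \<open>\<K>(X,P)\<close>.\<close>

lemma decay_of_shifted_image:
  assumes A: "A \<in> LP p" and u: "u \<in> lp p" "restr (cube D) u = u" and e: "e > 0"
  shows "\<exists>M. lp_norm p (restr (- cube M) (conj_shift k A u)) < e"
proof -
  note Ab = LP_bdd[OF A]
  let ?v = "\<lambda>j. u (j - k)"
  have v: "?v \<in> lp p" by (rule lp_shift(1)[OF u(1)])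
  obtain m where m: "ball_at k D \<subseteq> cube m" using finite_imp_subset_cube[OF finite_ball_at] by blast
  have vm: "restr (cube m) ?v = ?v"
  proof
    fix i
    have "i - k \<notin> cube D \<Longrightarrow> u (i - k) = 0" using fun_cong[OF u(2), of "i - k"] by (simp add: restr_def)
    then show "restr (cube m) ?v i = ?v i" using m by (auto simp: restr_def ball_at_def cube_def)
  qed
  have "A \<circ> P_op p m \<in> KP p" by (rule LP_comp_KP[OF A P_op_KP])
  moreover define d where "d = e / (2 * (lp_norm p u + 1))"
  have d: "d > 0" "d * lp_norm p u < e"
    using e lp_norm_nonneg[OF u(1)] by (auto simp: d_def field_simps intro: add_nonneg_pos)
  ultimately obtain n where n: "op_norm p (Q_op p n \<circ> (A \<circ> P_op p m)) \<le> d" using KP_iff by blast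
  have "lp_norm p (restr (- cube n) (A ?v)) = lp_norm p ((Q_op p n \<circ> (A \<circ> P_op p m)) ?v)"
    using v vm bdd_ops_lp'[OF Ab] by (simp add: P_op_apply Q_op_apply)
  also have "\<dots> \<le> d * lp_norm p u"
    using lp_shift(2)[OF u(1), of k]
    by (intro op_norm_bound'[OF bdd_ops_comp(1)[OF Q_op_bdd bdd_ops_comp(1)[OF Ab P_op_bdd]] v n]) simp
  finally have tail: "lp_norm p (restr (- cube n) (A ?v)) < e" using d(2) by linarith
  have "lp_norm p (restr (- cube (n + nat (mag k))) (conj_shift k A u)) \<le>
      lp_norm p (\<lambda>i. restr (- cube n) (A ?v) (i - - k))"
  proof (rule lp_solid(2)[OF lp_shift(1)[OF lp_restr(1)[OF bdd_ops_lp'[OF Ab]]]])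
    fix i
    have "i + k \<notin> cube n" if "i \<notin> cube (n + nat (mag k))"
      using that mag_triangle_diff[of "i + k" k] by (simp add: cube_def)
    then show "norm (restr (- cube (n + nat (mag k))) (conj_shift k A u) i) \<le> norm (restr (- cube n) (A ?v) (i - - k))"
      by (auto simp: restr_def conj_shift_apply[OF Ab u(1)])
  qed
  also have "\<dots> = lp_norm p (restr (- cube n) (A ?v))"
    by (rule lp_shift(2)[OF lp_restr(1)[OF bdd_ops_lp'[OF Ab]]])
  finally show ?thesis using tail by (intro exI[of _ "n + nat (mag k)"]) linarith
qed

lemma band_image_support:
  assumes "A \<in> band_ops p"
  obtains M where "\<And>u k i. u \<in> lp p \<Longrightarrow> restr (cube D) u = u \<Longrightarrow> i \<notin> cube (D + M) \<Longrightarrow> conj_shift k A u i = 0"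
proof -
  obtain S a where S: "finite S" and A: "A = (\<Sum>\<alpha>\<in>S. mult_op p (a \<alpha>) \<circ> shift_op p \<alpha>)"
    and a: "\<forall>\<alpha>\<in>S. a \<alpha> \<in> linfty_coeffs"
    using assms by (auto simp: band_ops_def)
  obtain M where M: "S \<subseteq> cube M" using finite_imp_subset_cube[OF S] by blast
  have "conj_shift k A u i = 0" if u: "u \<in> lp p" "restr (cube D) u = u" and i: "i \<notin> cube (D + M)" for u k i
  proof -
    have "a \<alpha> (i + k) (u (i + k - \<alpha> - k)) = 0" if \<alpha>: "\<alpha> \<in> S" for \<alpha>
    proof -
      have "mag \<alpha> \<le> int M" using M \<alpha> by (auto simp: cube_def)
      then have "i - \<alpha> \<notin> cube D" using i mag_triangle[of "i - \<alpha>" \<alpha>] by (simp add: cube_def)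
      then have "u (i - \<alpha>) = 0" using fun_cong[OF u(2), of "i - \<alpha>"] by (simp add: restr_def)
      moreover have "i + k - \<alpha> - k = i - \<alpha>" by simp
      moreover have "linear (a \<alpha> (i + k))" using a \<alpha> linfty_coeffsD(1) bounded_linear.linear by blast
      ultimately show ?thesis by (metis linear_0)
    qed
    then show ?thesis
      unfolding conj_shift_apply[OF band_ops_bdd[OF assms] u(1)]
      unfolding A band_op_apply[OF lp_shift(1)[OF u(1)]] by (intro sum.neutral ballI)
  qed
  then show ?thesis using that by blast
qed

lemma norming_functional_on_cube:
  fixes u :: "('n::finite, 'x::complex_banach) seqs"
  assumes "lp_norm p u = 1" "restr (cube D) u = u"
  obtains f :: "('n, 'x) seqs \<Rightarrow> complex" where "\<And>x y. f (x + y) = f x + f y"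
    "\<And>c x. f (\<lambda>i. c *\<^sub>C x i) = c * f x" "\<And>x. cmod (f x) \<le> lp_norm p (restr (cube D) x)" "f u = 1"
proof -
  let ?s = "\<lambda>(c::complex) (x::('n, 'x) seqs) i. c *\<^sub>C x i"
  let ?q = "\<lambda>x::('n, 'x) seqs. lp_norm p (restr (cube D) x)"
  have V: "vector_space ?s"
    by unfold_locales (auto simp: scaleC_add_right scaleC_add_left scaleC_scaleC fun_eq_iff)
  have fin: "restr (cube D) x \<in> lp p" for x :: "('n, 'x) seqs" by (rule restr_finite_lp) simp
  have "restr (cube D) (x + y) = restr (cube D) x + restr (cube D) y" for x y :: "('n, 'x) seqs"
    by (auto simp: restr_def)
  then have add: "?q (x + y) \<le> ?q x + ?q y" for x y using lp_add(2)[OF fin fin, of x y] by (simp only:)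
  have "restr (cube D) (?s c x) = ?s c (restr (cube D) x)" for c x by (auto simp: restr_def)
  then have scale: "?q (?s c x) = cmod c * ?q x" for c x using lp_scaleC(2)[OF fin, of c x] by (simp only:)
  obtain f where f: "\<And>x y. f (x + y) = f x + f y" "\<And>c x. f (?s c x) = c * f x" "\<And>x. cmod (f x) \<le> ?q x"
    "f u = complex_of_real (?q u)"
    using norming_functional[where s="?s" and q="?q" and u=u, OF V add scale] by blast
  show ?thesis using that[OF f(1-3)] f(4) assms by simp
qed

text \<open>The sequences \<open>z m\<close> lie at points \<open>k m\<close> that tend to infinity. A subsequence of \<open>k\<close> defines the
  limit operator. Far enough along it, the shifted \<open>A\<close> and \<open>L\<close> differ in norm by less than
  \<open>\<epsilon> - \<epsilon>2\<close> on \<open>cube D\<close>, into which the \<open>z m\<close> are moved.\<close>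

lemma almost_kernel_of_limit_op:
  fixes A :: "('n::finite, 'x::complex_banach) oper"
  assumes rich: "rich p A" and band: "A \<in> band_ops p \<or> A \<in> band_dominated_ops p"
    and \<epsilon>: "\<epsilon> > 0"
    and unit: "coset p (A - scalar_op p \<mu>) \<in> Units (LP_mod_KP p)"
    and n: "1 / \<epsilon> < quot_norm p (inv\<^bsub>LP_mod_KP p\<^esub> (coset p (A - scalar_op p \<mu>)))"
  obtains h L D u where "is_limit_op p A h L" "u \<in> lp p" "restr (cube D) u = u" "lp_norm p u = 1"
    "lp_norm p (L u - scalar_op p \<mu> u) < \<epsilon>"
proof -
  have A: "A \<in> LP p" using rich by (simp add: rich_def)
  note Ab = LP_bdd[OF A]
  have B: "A - scalar_op p \<mu> \<in> LP p" by (intro LP_minus A scalar_op_LP)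
  note Bb = LP_bdd[OF B]
  obtain \<epsilon>' where \<epsilon>': "0 < \<epsilon>'" "\<epsilon>' < \<epsilon>"
    "\<And>m. \<exists>z\<in>lp p. restr (- cube m) z = z \<and> lp_norm p ((A - scalar_op p \<mu>) z) < \<epsilon>' * lp_norm p z"
    by (rule almost_kernel_at_infinity[OF B unit n \<epsilon>]) blast
  obtain D \<epsilon>2 where \<epsilon>2: "0 < \<epsilon>2" "\<epsilon>2 < \<epsilon>"
    and loc: "\<And>m. \<exists>k. int m \<le> mag k \<and> (\<exists>z\<in>lp p. restr (ball_at k D) z = z \<and> lp_norm p z = 1 \<and>
      lp_norm p ((A - scalar_op p \<mu>) z) < \<epsilon>2)"
    by (rule localised_almost_kernel[OF Ab band \<epsilon>']) blast
  obtain k z where k: "\<And>m. int m \<le> mag (k m)" and z: "\<And>m. z m \<in> lp p" "\<And>m. restr (ball_at (k m) D) (z m) = z m"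
    "\<And>m. lp_norm p (z m) = 1" "\<And>m. lp_norm p ((A - scalar_op p \<mu>) (z m)) < \<epsilon>2"
    using loc by metis
  have "tends_to_infinity k"
    unfolding tends_to_infinity_iff
  proof
    fix c
    show "\<forall>\<^sub>F m in sequentially. c \<le> mag (k m)"
      using eventually_ge_at_top[of "nat c"]
    proof (rule eventually_mono)
      fix m assume "nat c \<le> m"
      then show "c \<le> mag (k m)" using k[of m] by linarith
    qed
  qed
  then obtain \<phi> L where \<phi>: "is_limit_op p A (k \<circ> \<phi>) L" using rich unfolding rich_def by blast
  define h where "h = k \<circ> \<phi>"
  have conv: "P_strongly_converges p (\<lambda>n. conj_shift (h n) A) L"
    using \<phi> by (simp add: is_limit_op_def h_def conj_shift_def)
  have L: "L \<in> bdd_ops p" using conv by (simp add: P_strongly_converges_def)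
  have D: "conj_shift (h n) A - L \<in> bdd_ops p" for n by (intro bdd_ops_minus conj_shift_bdd Ab L)
  have "(\<lambda>n. op_norm p (P_op p D \<circ> (conj_shift (h n) A - L)) + op_norm p ((conj_shift (h n) A - L) \<circ> P_op p D)) \<longlonglongrightarrow> 0"
    using conv P_op_KP by (auto simp: P_strongly_converges_def)
  then have "\<forall>\<^sub>F n in sequentially. op_norm p (P_op p D \<circ> (conj_shift (h n) A - L)) +
      op_norm p ((conj_shift (h n) A - L) \<circ> P_op p D) < \<epsilon> - \<epsilon>2"
    by (rule order_tendstoD(2)) (use \<epsilon>2 in simp)
  from eventually_happens'[OF sequentially_bot this] obtain n where
    "op_norm p (P_op p D \<circ> (conj_shift (h n) A - L)) + op_norm p ((conj_shift (h n) A - L) \<circ> P_op p D) < \<epsilon> - \<epsilon>2"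
    by (rule exE)
  then have close: "op_norm p ((conj_shift (h n) A - L) \<circ> P_op p D) < \<epsilon> - \<epsilon>2"
    using op_norm_nonneg[OF bdd_ops_comp(1)[OF P_op_bdd D[of n], of D]] by linarith
  define u where "u = (\<lambda>i. z (\<phi> n) (i - - h n))"
  have u: "u \<in> lp p" "lp_norm p u = 1" unfolding u_def by (rule lp_shift(1)[OF z(1)], simp only: lp_shift(2)[OF z(1)] z(3))
  have uD: "restr (cube D) u = u"
  proof
    fix i
    show "restr (cube D) u i = u i"
      using fun_cong[OF z(2), of "\<phi> n" "i + h n"] by (auto simp: u_def restr_def ball_at_def cube_def h_def)
  qed
  have move: "conj_shift (h n) A u - scalar_op p \<mu> u = (\<lambda>i. (A - scalar_op p \<mu>) (z (\<phi> n)) (i - - h n))"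
    using u(1) z(1) by (auto simp: conj_shift_apply[OF Ab] scalar_op_apply fun_eq_iff) (auto simp: u_def)
  have "lp_norm p (conj_shift (h n) A u - scalar_op p \<mu> u) < \<epsilon>2"
    unfolding move lp_shift(2)[OF bdd_ops_lp'[OF Bb]] by (rule z(4))
  moreover have "lp_norm p ((conj_shift (h n) A - L) u) \<le> (\<epsilon> - \<epsilon>2) * 1"
    using op_norm_bound'[OF bdd_ops_comp(1)[OF D P_op_bdd] u(1) less_imp_le[OF close], of 1] u(2) uD
    by (simp add: P_op_apply[OF u(1)])
  moreover have "L u - scalar_op p \<mu> u = (conj_shift (h n) A u - scalar_op p \<mu> u) - (conj_shift (h n) A - L) u"
    by auto
  moreover have "lp_norm p \<dots> \<le> lp_norm p (conj_shift (h n) A u - scalar_op p \<mu> u) + lp_norm p ((conj_shift (h n) A - L) u)"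
    by (intro lp_diff bdd_ops_lp'[OF D] bdd_ops_lp'[OF scalar_op_bdd] bdd_ops_lp'[OF conj_shift_bdd(1)[OF Ab]])
  ultimately have "lp_norm p (L u - scalar_op p \<mu> u) < \<epsilon>" by (simp only: mult_1_right)
  then show ?thesis using that[OF _ u(1) uD u(2)] \<phi> by blast
qed

text \<open>A left inverse \<open>C\<close> modulo \<open>\<K>(X,P)\<close> would give \<open>x\<^sub>n = C B x\<^sub>n - K x\<^sub>n\<close> with \<open>K\<close> in \<open>\<K>(X,P)\<close>,
  and both terms become small.\<close>

lemma singular_sequence_not_invertible:
  assumes B: "B \<in> LP p" and x: "\<And>n. x n \<in> lp p" "\<And>n. lp_norm p (x n) = 1"
    and inf: "\<And>m. \<forall>\<^sub>F n in sequentially. restr (- cube m) (x n) = x n"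
    and lim: "(\<lambda>n. lp_norm p (B (x n))) \<longlonglongrightarrow> 0"
  shows "coset p B \<notin> Units (LP_mod_KP p)"
proof
  assume "coset p B \<in> Units (LP_mod_KP p)"
  then obtain C where C: "C \<in> LP p" "(C \<circ> B) - id_op p \<in> KP p" using coset_UnitsE[OF _ B] by metis
  note Cb = LP_bdd[OF C(1)]
  define K where "K = (C \<circ> B) - id_op p"
  have K: "K \<in> KP p" unfolding K_def by (rule C(2))
  note Kb = KP_bdd[OF K]
  obtain m where m: "op_norm p (K \<circ> Q_op p m) \<le> 1 / 4" using K[unfolded KP_iff] by (meson zero_less_divide_1_iff zero_less_numeral)
  have "(\<lambda>n. op_norm p C * lp_norm p (B (x n))) \<longlonglongrightarrow> op_norm p C * 0" by (intro tendsto_mult tendsto_const lim)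
  then have "\<forall>\<^sub>F n in sequentially. op_norm p C * lp_norm p (B (x n)) < 1 / 4"
    by (rule order_tendstoD(2)) simp
  then have "\<forall>\<^sub>F n in sequentially. op_norm p C * lp_norm p (B (x n)) < 1 / 4 \<and> restr (- cube m) (x n) = x n"
    using inf by (rule eventually_conj)
  then obtain n where n: "op_norm p C * lp_norm p (B (x n)) < 1 / 4" "restr (- cube m) (x n) = x n"
    using eventually_happens' sequentially_bot by blast
  have "x n = C (B (x n)) - K (x n)" using x(1) by (simp add: K_def id_op_apply)
  moreover have "lp_norm p (C (B (x n)) - K (x n)) \<le> op_norm p C * lp_norm p (B (x n)) + 1 / 4 * 1"
  proof (intro lp_norm_diff_le bdd_ops_lp'[OF Cb] bdd_ops_lp'[OF Kb] op_norm_bound[OF Cb] bdd_ops_lp'[OF LP_bdd[OF B]])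
    have "K (x n) = (K \<circ> Q_op p m) (x n)" using n(2) x(1) by (simp add: Q_op_apply)
    then show "lp_norm p (K (x n)) \<le> 1 / 4 * 1"
      using op_norm_bound'[OF bdd_ops_comp(1)[OF Kb Q_op_bdd] x(1) m] x(2) by (metis order_refl)
  qed
  ultimately show False using n(1) x(2)[of n] by simp
qed

text \<open>The blocks of \<open>T\<close> send the translate of \<open>u\<close> to \<open>g n\<close> to the translate of \<open>- w\<close>, up to the
  cutoff, and \<open>A - \<mu> I\<close> sends it nearly to the translate of \<open>w\<close>, since \<open>g\<close> is a subsequence of the
  sequence \<open>h\<close> that defines the limit operator. So \<open>A + T - \<mu> I\<close> sends it nearly to \<open>0\<close>.\<close>

lemma singular_perturbation:
  fixes A :: "('n::finite, 'x::complex_banach) oper"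
  assumes rich: "rich p A" and band: "A \<in> band_ops p \<or> A \<in> band_dominated_ops p"
    and \<epsilon>: "\<epsilon> > 0"
    and unit: "coset p (A - scalar_op p \<mu>) \<in> Units (LP_mod_KP p)"
    and n: "1 / \<epsilon> < quot_norm p (inv\<^bsub>LP_mod_KP p\<^esub> (coset p (A - scalar_op p \<mu>)))"
  obtains T where "rich p T" "T \<in> band_dominated_ops p" "A \<in> band_ops p \<Longrightarrow> T \<in> band_ops p"
    "op_norm p T < \<epsilon>" "coset p (A + T - scalar_op p \<mu>) \<notin> Units (LP_mod_KP p)"
proof -
  have A: "A \<in> LP p" using rich by (simp add: rich_def)
  note Ab = LP_bdd[OF A]
  obtain h L D u where lim: "is_limit_op p A h L" and u: "u \<in> lp p" "restr (cube D) u = u" "lp_norm p u = 1"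
    and small: "lp_norm p (L u - scalar_op p \<mu> u) < \<epsilon>"
    by (rule almost_kernel_of_limit_op[OF assms])
  have h: "tends_to_infinity h" using lim by (simp add: is_limit_op_def)
  have conv: "P_strongly_converges p (\<lambda>n. conj_shift (h n) A) L"
    using lim by (simp add: is_limit_op_def conj_shift_def)
  have Lb: "L \<in> bdd_ops p" using conv by (simp add: P_strongly_converges_def)
  note hu = bdd_ops_lp'[OF conj_shift_bdd(1)[OF Ab]]
  note \<mu>u = bdd_ops_lp'[OF scalar_op_bdd]
  have convu: "(\<lambda>n. lp_norm p (conj_shift (h n) A u - L u)) \<longlonglongrightarrow> 0"
    by (rule P_strongly_converges_apply[OF conv u(1,2)])
  have B: "A - scalar_op p \<mu> \<in> LP p" by (intro LP_minus A scalar_op_LP)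
  define w where "w = L u - scalar_op p \<mu> u"
  have w: "w \<in> lp p" unfolding w_def by (intro lp_diff bdd_ops_lp'[OF Lb] \<mu>u)
  let ?y = "\<lambda>n. conj_shift (h n) (A - scalar_op p \<mu>) u"
  have y: "?y n = conj_shift (h n) A u - scalar_op p \<mu> u" for n
    using u(1) by (auto simp: conj_shift_apply[OF LP_bdd[OF B]] conj_shift_apply[OF Ab] scalar_op_apply lp_shift fun_eq_iff)
  have ylim: "(\<lambda>n. lp_norm p (?y n - w)) \<longlonglongrightarrow> 0" using convu by (simp add: y w_def)
  have tail: "\<exists>M. lp_norm p (restr (- cube M) w) < e" if "e > 0" for e
    by (rule decay_of_limit[OF w _ ylim _ that])
      (use decay_of_shifted_image[OF B u(1,2)] bdd_ops_lp'[OF conj_shift_bdd(1)[OF LP_bdd[OF B]]] in auto)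
  obtain f :: "('n, 'x) seqs \<Rightarrow> complex" where f: "\<And>x y. f (x + y) = f x + f y"
    "\<And>c x. f (\<lambda>i. c *\<^sub>C x i) = c * f x" "\<And>x. cmod (f x) \<le> lp_norm p (restr (cube D) x)" "f u = 1"
    by (rule norming_functional_on_cube[OF u(3,2)]) blast
  obtain s where s: "strict_mono s"
    "\<And>m n. m \<noteq> n \<Longrightarrow> ball_at (h (s m)) (m + D) \<inter> ball_at (h (s n)) (n + D) = {}"
    by (rule sparse_subsequence[OF h]) blast
  define g where "g = h \<circ> s"
  interpret rank_one_blocks p f D g "\<lambda>n. n + D"
    by unfold_locales (use f s in \<open>auto simp: g_def\<close>)
  define T where "T = block_op (- w)"
  note mw = lp_uminus[OF w]
  have neg: "restr U (- w) = - restr U w" for U by (auto simp: restr_def)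
  have mtail: "\<exists>M. lp_norm p (restr (- cube M) (- w)) < e" if "e > 0" for e
    unfolding neg lp_uminus(2)[OF lp_restr(1)[OF w]] by (rule tail[OF that])
  have T: "T \<in> LP p" unfolding T_def by (rule block_op_LP[OF mw(1)])
  have "op_norm p T < \<epsilon>"
    using block_op_bdd(2)[OF mw(1)] mw(2) small by (simp add: T_def w_def)
  moreover have "rich p T" unfolding T_def by (rule block_op_rich[OF mw(1) mtail])
  moreover have "T \<in> band_dominated_ops p" unfolding T_def by (rule block_op_band_dominated[OF mw(1) mtail])
  moreover have "T \<in> band_ops p" if A_band: "A \<in> band_ops p"
  proof -
    obtain M where M: "\<And>u k i. u \<in> lp p \<Longrightarrow> restr (cube D) u = u \<Longrightarrow> i \<notin> cube (D + M) \<Longrightarrow> conj_shift k A u i = 0"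
      by (rule band_image_support[OF A_band]) blast
    have "w i = 0" if i: "i \<notin> cube (D + M)" for i
    proof -
      have "norm (L u i) \<le> lp_norm p (conj_shift (h n) A u - L u)" for n
        using norm_le_lp_norm[OF lp_diff(1)[OF hu[of "h n" u] bdd_ops_lp'[OF Lb, of u]], of i] M[OF u(1,2) i] by simp
      then have "norm (L u i) \<le> 0" by (intro LIMSEQ_le_const[OF convu]) auto
      moreover have "u i = 0" using fun_cong[OF u(2), of i] i by (auto simp: restr_def cube_def split: if_splits)
      ultimately show ?thesis using u(1) by (simp add: w_def scalar_op_apply)
    qed
    then have "restr (cube (D + M)) (- w) = - w" by (auto simp: restr_def)
    then show ?thesis unfolding T_def by (rule block_op_band[OF mw(1)])
  qed
  moreover have "coset p (A + T - scalar_op p \<mu>) \<notin> Units (LP_mod_KP p)"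
  proof (rule singular_sequence_not_invertible)
    define x where "x n = (\<lambda>i. u (i - g n))" for n
    show BT: "A + T - scalar_op p \<mu> \<in> LP p" by (intro LP_minus LP_plus A T scalar_op_LP)
    show x: "x n \<in> lp p" for n unfolding x_def by (rule lp_shift(1)[OF u(1)])
    show "lp_norm p (x n) = 1" for n unfolding x_def using lp_shift(2)[OF u(1)] u(3) by simp
    have g: "tends_to_infinity g" unfolding g_def by (rule tends_to_infinity_subseq[OF h s(1)])
    show "\<forall>\<^sub>F n in sequentially. restr (- cube m) (x n) = x n" for m
      using g[unfolded tends_to_infinity_iff, rule_format, of "int (m + D) + 1"]
    proof (rule eventually_mono)
      fix n assume gn: "int (m + D) + 1 \<le> mag (g n)"
      have "u (i - g n) = 0" if "i \<in> cube m" for i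
      proof -
        have "i - g n \<notin> cube D"
          using that gn mag_triangle[of "g n - i" i] by (auto simp: cube_def mag_commute[of i])
        then show ?thesis using fun_cong[OF u(2), of "i - g n"] by (simp add: restr_def)
      qed
      then show "restr (- cube m) (x n) = x n" by (auto simp: x_def restr_def)
    qed
    have Tx: "T (x n) = - (\<lambda>i. restr (cube (n + D)) w (i - g n))" for n
    proof -
      have "restr (ball_at (g n) (n + D)) (x n) = x n"
      proof
        fix i
        have "i - g n \<notin> cube D \<Longrightarrow> u (i - g n) = 0" using fun_cong[OF u(2), of "i - g n"] by (simp add: restr_def)
        then show "restr (ball_at (g n) (n + D)) (x n) i = x n i"
          by (auto simp: x_def restr_def ball_at_def cube_def)
      qed
      moreover have "(\<lambda>j. x n (j + g n)) = u" by (simp add: x_def)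
      ultimately show ?thesis
        using block_op_single_block[OF x, of n n "- w"] f(4) by (simp add: T_def neg fun_eq_iff)
    qed
    have id: "(A + T - scalar_op p \<mu>) (x n) =
        (\<lambda>i. (?y (s n) - w + restr (- cube (n + D)) w) (i - g n))" for n
    proof
      fix i
      have "?y (s n) (i - g n) = (A - scalar_op p \<mu>) (x n) i"
        unfolding conj_shift_apply[OF LP_bdd[OF B] u(1)] by (simp add: x_def g_def)
      then show "(A + T - scalar_op p \<mu>) (x n) i = (\<lambda>i. (?y (s n) - w + restr (- cube (n + D)) w) (i - g n)) i"
        by (simp add: Tx restr_def)
    qed
    have yl: "?y n - w \<in> lp p" for n
      using bdd_ops_lp'[OF conj_shift_bdd(1)[OF LP_bdd[OF B]]] w by (rule lp_diff)
    have le: "norm (lp_norm p ((A + T - scalar_op p \<mu>) (x n))) \<le>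
        lp_norm p (?y (s n) - w) + lp_norm p (restr (- cube (n + D)) w)" for n
    proof -
      have "lp_norm p ((A + T - scalar_op p \<mu>) (x n)) = lp_norm p (?y (s n) - w + restr (- cube (n + D)) w)"
        unfolding id by (intro lp_shift lp_add yl lp_restr w)
      also have "\<dots> \<le> lp_norm p (?y (s n) - w) + lp_norm p (restr (- cube (n + D)) w)"
        by (intro lp_add yl lp_restr w)
      finally show ?thesis using lp_norm_nonneg[OF bdd_ops_lp'[OF LP_bdd[OF BT]]] by simp
    qed
    have "(\<lambda>n. lp_norm p (?y (s n) - w)) \<longlonglongrightarrow> 0"
      using LIMSEQ_subseq_LIMSEQ[OF ylim s(1)] by (simp add: comp_def)
    moreover have "(\<lambda>n. lp_norm p (restr (- cube (n + D)) w)) \<longlonglongrightarrow> 0"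
    proof (rule LIMSEQ_I)
      fix e :: real assume "e > 0"
      then obtain M where M: "lp_norm p (restr (- cube M) w) < e" using tail by blast
      have "norm (lp_norm p (restr (- cube (n + D)) w) - 0) < e" if "n \<ge> M" for n
        using restr_tail_mono[OF w, of M "n + D"] that M lp_norm_nonneg[OF lp_restr(1)[OF w]] by simp
      then show "\<exists>N. \<forall>n\<ge>N. norm (lp_norm p (restr (- cube (n + D)) w) - 0) < e" by blast
    qed
    ultimately have "(\<lambda>n. lp_norm p (?y (s n) - w) + lp_norm p (restr (- cube (n + D)) w)) \<longlonglongrightarrow> 0 + 0"
      by (rule tendsto_add)
    then show "(\<lambda>n. lp_norm p ((A + T - scalar_op p \<mu>) (x n))) \<longlonglongrightarrow> 0"
      by (intro Lim_null_comparison[OF always_eventually[OF allI[OF le]]]) simp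
  qed
  ultimately show ?thesis using that by blast
qed

lemma rich_zero: "rich p (0 :: ('n::finite, 'x::complex_banach) oper)"
proof -
  have z: "shift_op p (- h n) \<circ> (0 :: ('n, 'x) oper) \<circ> shift_op p (h n) = 0" for h :: "nat \<Rightarrow> int ^ 'n" and n
    using bdd_ops_0[OF shift_op_bdd] by (auto simp: fun_eq_iff)
  have K: "K \<circ> (0 :: ('n, 'x) oper) = 0" "0 \<circ> K = (0 :: ('n, 'x) oper)" if "K \<in> bdd_ops p" for K :: "('n, 'x) oper"
    using bdd_ops_0[OF that] by (auto simp: fun_eq_iff)
  then have "is_limit_op p (0 :: ('n, 'x) oper) h 0" if "tends_to_infinity h" for h
    using that by (simp add: is_limit_op_def P_strongly_converges_def z K KP_bdd)
  then show ?thesis unfolding rich_def using tends_to_infinity_subseq strict_mono_id zero_LP by metis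
qed

lemma zero_band: "0 \<in> band_ops p"
  unfolding band_ops_def by (rule CollectI, intro exI[of _ "{}"]) auto

lemma zero_band_dominated: "0 \<in> band_dominated_ops p"
  unfolding band_dominated_ops_def using zero_band by (auto intro!: bexI[of _ 0])

end

section \<open>Essential pseudospectra\<close>

theorem theorem4p9:
  fixes p :: ennreal
    and A :: "('n::finite, 'x::complex_banach) oper"
    and \<C> :: "('n, 'x) oper set"
    and \<epsilon> :: real
  assumes "p = 0 \<or> 1 \<le> p"
    and "\<exists>x::'x. x \<noteq> 0"
    and "\<C> = rich_band_ops p \<or> \<C> = rich_band_dominated_ops p"
    and "A \<in> \<C>"
    and "\<epsilon> > 0"
  shows "sp_eps_ess p \<epsilon> A = (\<Union>T\<in>{T \<in> LP p. op_norm p T < \<epsilon>}. sp_ess p (A + T)) \<and>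
    (\<Union>T\<in>{T \<in> LP p. op_norm p T < \<epsilon>}. sp_ess p (A + T)) =
      (\<Union>T\<in>{T \<in> \<C>. op_norm p T < \<epsilon>}. sp_ess p (A + T))"
proof -
  interpret lp_exponent p by standard (rule assms(1))
  have CL: "\<C> \<subseteq> LP p"
    using assms(3) by (auto simp: rich_band_ops_def rich_band_dominated_ops_def rich_def)
  have rich: "rich p A" and band: "A \<in> band_ops p \<or> A \<in> band_dominated_ops p"
    using assms(3,4) by (auto simp: rich_band_ops_def rich_band_dominated_ops_def)
  have A: "A \<in> LP p" using rich by (simp add: rich_def)
  have 1: "(\<Union>T\<in>{T \<in> \<C>. op_norm p T < \<epsilon>}. sp_ess p (A + T)) \<subseteq> (\<Union>T\<in>{T \<in> LP p. op_norm p T < \<epsilon>}. sp_ess p (A + T))"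
    using CL by blast
  have 2: "(\<Union>T\<in>{T \<in> LP p. op_norm p T < \<epsilon>}. sp_ess p (A + T)) \<subseteq> sp_eps_ess p \<epsilon> A"
  proof
    fix \<mu> assume "\<mu> \<in> (\<Union>T\<in>{T \<in> LP p. op_norm p T < \<epsilon>}. sp_ess p (A + T))"
    then obtain T where T: "T \<in> LP p" "op_norm p T < \<epsilon>" "coset p (A + T - scalar_op p \<mu>) \<notin> Units (LP_mod_KP p)"
      by (auto simp: sp_ess_def)
    have B: "A - scalar_op p \<mu> \<in> LP p" by (intro LP_minus A scalar_op_LP)
    have "A + T - scalar_op p \<mu> = (A - scalar_op p \<mu>) + T" by (rule add_diff_eq[symmetric, THEN trans]) (simp add: add.commute)
    then have "1 / \<epsilon> < quot_norm p (inv\<^bsub>LP_mod_KP p\<^esub> (coset p (A - scalar_op p \<mu>)))"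
      if "coset p (A - scalar_op p \<mu>) \<in> Units (LP_mod_KP p)"
      using small_perturbation_invertible[OF B that _ assms(5) T(1,2)] T(3) by (metis not_le)
    then show "\<mu> \<in> sp_eps_ess p \<epsilon> A" by (simp add: sp_eps_ess_def quot_inverse_norm_def)
  qed
  have 3: "sp_eps_ess p \<epsilon> A \<subseteq> (\<Union>T\<in>{T \<in> \<C>. op_norm p T < \<epsilon>}. sp_ess p (A + T))"
  proof
    fix \<mu> assume \<mu>: "\<mu> \<in> sp_eps_ess p \<epsilon> A"
    have "\<exists>T\<in>\<C>. op_norm p T < \<epsilon> \<and> coset p (A + T - scalar_op p \<mu>) \<notin> Units (LP_mod_KP p)"
    proof (cases "coset p (A - scalar_op p \<mu>) \<in> Units (LP_mod_KP p)")
      case True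
      then have "1 / \<epsilon> < quot_norm p (inv\<^bsub>LP_mod_KP p\<^esub> (coset p (A - scalar_op p \<mu>)))"
        using \<mu> by (simp add: sp_eps_ess_def quot_inverse_norm_def)
      then obtain T where T: "rich p T" "T \<in> band_dominated_ops p" "A \<in> band_ops p \<Longrightarrow> T \<in> band_ops p"
        "op_norm p T < \<epsilon>" "coset p (A + T - scalar_op p \<mu>) \<notin> Units (LP_mod_KP p)"
        using singular_perturbation[OF rich band assms(5) True] by metis
      have "T \<in> \<C>" using T(1-3) assms(3,4) by (auto simp: rich_band_ops_def rich_band_dominated_ops_def)
      then show ?thesis using T(4,5) by blast
    next
      case False
      \<comment> \<open>Here \<open>\<mu>\<close> is already in the essential spectrum of \<open>A\<close>.\<close>
      have "0 \<in> \<C>"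
        using assms(3) rich_zero zero_band zero_band_dominated
        by (auto simp: rich_band_ops_def rich_band_dominated_ops_def)
      then show ?thesis using False assms(5) by (intro bexI[of _ 0]) auto
    qed
    then show "\<mu> \<in> (\<Union>T\<in>{T \<in> \<C>. op_norm p T < \<epsilon>}. sp_ess p (A + T))" by (auto simp: sp_ess_def)
  qed
  show ?thesis by (intro conjI equalityI order_trans[OF 3 1] order_trans[OF 2 3] 1 2)
qed

end
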